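(* Let $M$ be a smooth $d$-manifold. If $M$ admits a single-chart autoencoder with latent dimension $d=\dim M$, then the tangent bundle $TM$ is trivialisable, and consequently all Stiefel--Whitney classes vanish: $w_i(TM)=0$ for all $i\ge1$.
   Context: A single-chart autoencoder on a smooth $d$-manifold $M$ consists of maps $E:M\to Z\subset\mathbb{R}^d$ and $D:Z\to M$ such that $E$ is a diffeomorphism onto its image and $D\circ E=\mathrm{Id}_M$. Stiefel--Whitney classes are the usual ones, $w_i(TM)\in H^i(M;\mathbb{Z}/2)$. *)

theory Defs
  imports "HOL-Analysis.Analysis" "HOL-Homology.Homology" "HOL-Library.Z2"
begin

section \<open>Smooth maps between subsets of Euclidean spaces\<close>

text \<open>Here \<open>\<real>\<^sup>d\<close> is \<^term>\<open>Euclidean_space d\<close>: functions \<open>nat \<Rightarrow> real\<close> that vanish from index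
  \<open>d\<close> on. A function on an open subset is of class \<open>C\<^sup>k\<close> if it is continuous and, for \<open>k > 0\<close>, its
  partial derivatives exist and are of class \<open>C\<^sup>k\<^sup>-\<^sup>1\<close>.\<close>

definition partial_deriv :: "nat \<Rightarrow> ((nat \<Rightarrow> real) \<Rightarrow> real) \<Rightarrow> (nat \<Rightarrow> real) \<Rightarrow> real" where
  "partial_deriv j f x = deriv (\<lambda>t. f (x(j := t))) (x j)"

primrec Ck_on :: "nat \<Rightarrow> nat \<Rightarrow> (nat \<Rightarrow> real) set \<Rightarrow> ((nat \<Rightarrow> real) \<Rightarrow> real) \<Rightarrow> bool" where
  "Ck_on d 0 U f \<longleftrightarrow> continuous_map (subtopology (Euclidean_space d) U) euclideanreal f"
| "Ck_on d (Suc k) U f \<longleftrightarrow>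
     continuous_map (subtopology (Euclidean_space d) U) euclideanreal f \<and>
     (\<forall>j<d. (\<forall>x\<in>U. (\<lambda>t. f (x(j := t))) field_differentiable at (x j)) \<and>
            Ck_on d k U (partial_deriv j f))"

definition smooth_on ::
  "nat \<Rightarrow> nat \<Rightarrow> (nat \<Rightarrow> real) set \<Rightarrow> ((nat \<Rightarrow> real) \<Rightarrow> nat \<Rightarrow> real) \<Rightarrow> bool" where
  "smooth_on m n U f \<longleftrightarrow>
     openin (Euclidean_space m) U \<and> f \<in> U \<rightarrow> topspace (Euclidean_space n) \<and>
     (\<forall>i<n. \<forall>k. Ck_on m k U (\<lambda>x. f x i))"

definition jacobian_apply ::
  "nat \<Rightarrow> ((nat \<Rightarrow> real) \<Rightarrow> nat \<Rightarrow> real) \<Rightarrow> (nat \<Rightarrow> real) \<Rightarrow> (nat \<Rightarrow> real) \<Rightarrow> nat \<Rightarrow> real" where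
  "jacobian_apply d f x v =
     (\<lambda>i. if i < d then \<Sum>j<d. partial_deriv j (\<lambda>y. f y i) x * v j else 0)"


section \<open>Smooth manifolds\<close>

type_synonym 'a chart = "'a set \<times> ('a \<Rightarrow> nat \<Rightarrow> real)"

definition chart_inv :: "'a chart \<Rightarrow> (nat \<Rightarrow> real) \<Rightarrow> 'a" where
  "chart_inv c = inv_into (fst c) (snd c)"

definition chart_on :: "nat \<Rightarrow> 'a topology \<Rightarrow> 'a chart \<Rightarrow> bool" where
  "chart_on d M c \<longleftrightarrow>
     openin M (fst c) \<and> openin (Euclidean_space d) (snd c ` fst c) \<and>
     homeomorphic_map (subtopology M (fst c))
       (subtopology (Euclidean_space d) (snd c ` fst c)) (snd c)"

definition smooth_manifold :: "nat \<Rightarrow> 'a topology \<Rightarrow> 'a chart set \<Rightarrow> bool" where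
  "smooth_manifold d M A \<longleftrightarrow>
     Hausdorff_space M \<and> second_countable M \<and>
     (\<forall>c\<in>A. chart_on d M c) \<and> (\<Union>c\<in>A. fst c) = topspace M \<and>
     (\<forall>c\<in>A. \<forall>c'\<in>A. smooth_on d d (snd c ` (fst c \<inter> fst c')) (\<lambda>x. snd c' (chart_inv c x)))"


section \<open>Single-chart autoencoders\<close>

definition smooth_to_Euclidean ::
  "nat \<Rightarrow> 'a chart set \<Rightarrow> nat \<Rightarrow> ('a \<Rightarrow> nat \<Rightarrow> real) \<Rightarrow> bool" where
  "smooth_to_Euclidean d A n E \<longleftrightarrow>
     (\<forall>c\<in>A. smooth_on d n (snd c ` fst c) (\<lambda>x. E (chart_inv c x)))"

text \<open>The domain \<open>S\<close> is an arbitrary subset of \<open>\<real>\<^sup>n\<close>. As usual, a map on \<open>S\<close> is smooth if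
  locally it extends to a smooth map on an open subset of \<open>\<real>\<^sup>n\<close>.\<close>

definition smooth_from_Euclidean ::
  "nat \<Rightarrow> 'a topology \<Rightarrow> 'a chart set \<Rightarrow> nat \<Rightarrow> (nat \<Rightarrow> real) set \<Rightarrow> ((nat \<Rightarrow> real) \<Rightarrow> 'a) \<Rightarrow> bool" where
  "smooth_from_Euclidean d M A n S F \<longleftrightarrow>
     S \<subseteq> topspace (Euclidean_space n) \<and> F \<in> S \<rightarrow> topspace M \<and>
     (\<forall>y\<in>S. \<forall>c\<in>A. F y \<in> fst c \<longrightarrow>
        (\<exists>W G. y \<in> W \<and> smooth_on n d W G \<and>
               (\<forall>z\<in>W \<inter> S. F z \<in> fst c \<and> snd c (F z) = G z)))"

definition diffeo_onto_image ::
  "nat \<Rightarrow> 'a topology \<Rightarrow> 'a chart set \<Rightarrow> nat \<Rightarrow> ('a \<Rightarrow> nat \<Rightarrow> real) \<Rightarrow> bool" where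
  "diffeo_onto_image d M A n E \<longleftrightarrow>
     inj_on E (topspace M) \<and> smooth_to_Euclidean d A n E \<and>
     smooth_from_Euclidean d M A n (E ` topspace M) (inv_into (topspace M) E)"

definition single_chart_autoencoder ::
  "nat \<Rightarrow> 'a topology \<Rightarrow> 'a chart set \<Rightarrow>
     (nat \<Rightarrow> real) set \<Rightarrow> ('a \<Rightarrow> nat \<Rightarrow> real) \<Rightarrow> ((nat \<Rightarrow> real) \<Rightarrow> 'a) \<Rightarrow> bool" where
  "single_chart_autoencoder d M A Z E D \<longleftrightarrow>
     Z \<subseteq> topspace (Euclidean_space d) \<and>
     E \<in> topspace M \<rightarrow> Z \<and> D \<in> Z \<rightarrow> topspace M \<and>
     diffeo_onto_image d M A d E \<and> (\<forall>p\<in>topspace M. D (E p) = p)"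


section \<open>Vector bundles and their isomorphisms\<close>

record ('e, 'b) vbundle =
  total_space :: "'e topology"
  base_space :: "'b topology"
  bundle_proj :: "'e \<Rightarrow> 'b"
  fibre_add :: "'e \<Rightarrow> 'e \<Rightarrow> 'e"
  fibre_scale :: "real \<Rightarrow> 'e \<Rightarrow> 'e"
  fibre_dim :: nat

definition trivial_bundle :: "nat \<Rightarrow> 'b topology \<Rightarrow> ('b \<times> (nat \<Rightarrow> real), 'b) vbundle" where
  "trivial_bundle n B =
     \<lparr>total_space = prod_topology B (Euclidean_space n),
      base_space = B,
      bundle_proj = fst,
      fibre_add = (\<lambda>e e'. (fst e, \<lambda>i. snd e i + snd e' i)),
      fibre_scale = (\<lambda>t e. (fst e, \<lambda>i. t * snd e i)),
      fibre_dim = n\<rparr>"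

definition vbundle_iso :: "('e, 'b) vbundle \<Rightarrow> ('f, 'b) vbundle \<Rightarrow> ('e \<Rightarrow> 'f) \<Rightarrow> bool" where
  "vbundle_iso \<xi> \<eta> h \<longleftrightarrow>
     base_space \<xi> = base_space \<eta> \<and> fibre_dim \<xi> = fibre_dim \<eta> \<and>
     homeomorphic_map (total_space \<xi>) (total_space \<eta>) h \<and>
     (\<forall>e\<in>topspace (total_space \<xi>). bundle_proj \<eta> (h e) = bundle_proj \<xi> e) \<and>
     (\<forall>e\<in>topspace (total_space \<xi>). \<forall>e'\<in>topspace (total_space \<xi>).
        bundle_proj \<xi> e = bundle_proj \<xi> e' \<longrightarrow>
        h (fibre_add \<xi> e e') = fibre_add \<eta> (h e) (h e')) \<and>
     (\<forall>t. \<forall>e\<in>topspace (total_space \<xi>). h (fibre_scale \<xi> t e) = fibre_scale \<eta> t (h e))"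


section \<open>The tangent bundle\<close>

text \<open>A tangent vector at \<open>p\<close> is a family of coordinate vectors, one for each chart around \<open>p\<close>
  (and, as a convention, \<open>0\<close> for every other index), any two of which are related by the Jacobian
  of the change of charts.\<close>

definition tangent_space :: "nat \<Rightarrow> 'a chart set \<Rightarrow> 'a \<Rightarrow> ('a chart \<Rightarrow> nat \<Rightarrow> real) set" where
  "tangent_space d A p =
     {v. (\<forall>c. if c \<in> A \<and> p \<in> fst c then v c \<in> topspace (Euclidean_space d) else v c = (\<lambda>_. 0)) \<and>
         (\<forall>c\<in>A. \<forall>c'\<in>A. p \<in> fst c \<inter> fst c' \<longrightarrow>
            v c' = jacobian_apply d (\<lambda>x. snd c' (chart_inv c x)) (snd c p) (v c))}"

definition tangent_domain ::
  "nat \<Rightarrow> 'a chart set \<Rightarrow> 'a chart \<Rightarrow> ('a \<times> ('a chart \<Rightarrow> nat \<Rightarrow> real)) set" where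
  "tangent_domain d A c = (SIGMA p:fst c. tangent_space d A p)"

definition tangent_chart ::
  "'a chart \<Rightarrow> 'a \<times> ('a chart \<Rightarrow> nat \<Rightarrow> real) \<Rightarrow> (nat \<Rightarrow> real) \<times> (nat \<Rightarrow> real)" where
  "tangent_chart c e = (snd c (fst e), snd e c)"

definition tangent_chart_inv ::
  "nat \<Rightarrow> 'a chart set \<Rightarrow> 'a chart \<Rightarrow> (nat \<Rightarrow> real) \<times> (nat \<Rightarrow> real) \<Rightarrow>
     'a \<times> ('a chart \<Rightarrow> nat \<Rightarrow> real)" where
  "tangent_chart_inv d A c = inv_into (tangent_domain d A c) (tangent_chart c)"

definition tangent_topology ::
  "nat \<Rightarrow> 'a chart set \<Rightarrow> ('a \<times> ('a chart \<Rightarrow> nat \<Rightarrow> real)) topology" where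
  "tangent_topology d A =
     topology_generated_by
       {{e \<in> tangent_domain d A c. tangent_chart c e \<in> W} | c W.
          c \<in> A \<and> openin (prod_topology (Euclidean_space d) (Euclidean_space d)) W}"

definition tangent_bundle ::
  "nat \<Rightarrow> 'a topology \<Rightarrow> 'a chart set \<Rightarrow> ('a \<times> ('a chart \<Rightarrow> nat \<Rightarrow> real), 'a) vbundle" where
  "tangent_bundle d M A =
     \<lparr>total_space = tangent_topology d A,
      base_space = M,
      bundle_proj = fst,
      fibre_add = (\<lambda>e e'. (fst e, \<lambda>c i. snd e c i + snd e' c i)),
      fibre_scale = (\<lambda>t e. (fst e, \<lambda>c i. t * snd e c i)),
      fibre_dim = d\<rparr>"

text \<open>A trivialisation of \<open>TM\<close> is an isomorphism of smooth vector bundles onto \<open>M \<times> \<real>\<^sup>d\<close>.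
  Smoothness of \<open>h\<close> and of its inverse is stated in the charts; as both are linear on the fibres, it
  is enough to require that the coordinates of the image depend smoothly on the base point for each
  fixed coordinate vector \<open>u\<close>.\<close>

definition smooth_trivialisation ::
  "nat \<Rightarrow> 'a topology \<Rightarrow> 'a chart set \<Rightarrow>
     ('a \<times> ('a chart \<Rightarrow> nat \<Rightarrow> real) \<Rightarrow> 'a \<times> (nat \<Rightarrow> real)) \<Rightarrow> bool" where
  "smooth_trivialisation d M A h \<longleftrightarrow>
     vbundle_iso (tangent_bundle d M A) (trivial_bundle d M) h \<and>
     (\<forall>c\<in>A. \<forall>u\<in>topspace (Euclidean_space d).
        smooth_on d d (snd c ` fst c) (\<lambda>x. snd (h (tangent_chart_inv d A c (x, u)))) \<and>
        smooth_on d d (snd c ` fst c)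
          (\<lambda>x. snd (inv_into (topspace (tangent_topology d A)) h (chart_inv c x, u)) c))"

definition tangent_bundle_trivialisable :: "nat \<Rightarrow> 'a topology \<Rightarrow> 'a chart set \<Rightarrow> bool" where
  "tangent_bundle_trivialisable d M A \<longleftrightarrow> (\<exists>h. smooth_trivialisation d M A h)"


section \<open>Singular cohomology with coefficients in \<open>\<int>/2\<close>\<close>

text \<open>A cochain is a function on singular simplices; it is required to be \<open>0\<close> at all functions that
  are not singular simplices of \<open>X\<close>. Signs play no role modulo 2.\<close>

type_synonym 'a cochain = "((nat \<Rightarrow> real) \<Rightarrow> 'a) \<Rightarrow> bit"

definition cochains :: "nat \<Rightarrow> 'a topology \<Rightarrow> 'a cochain set" where
  "cochains p X = {a. \<forall>\<sigma>. \<not> singular_simplex p X \<sigma> \<longrightarrow> a \<sigma> = 0}"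

definition coboundary :: "nat \<Rightarrow> 'a topology \<Rightarrow> 'a cochain \<Rightarrow> 'a cochain" where
  "coboundary p X a =
     (\<lambda>\<sigma>. if singular_simplex (Suc p) X \<sigma> then \<Sum>k\<le>Suc p. a (singular_face (Suc p) k \<sigma>) else 0)"

definition cocycles :: "nat \<Rightarrow> 'a topology \<Rightarrow> 'a cochain set" where
  "cocycles p X = {a \<in> cochains p X. coboundary p X a = (\<lambda>_. 0)}"

definition coboundaries :: "nat \<Rightarrow> 'a topology \<Rightarrow> 'a cochain set" where
  "coboundaries p X =
     (case p of 0 \<Rightarrow> {\<lambda>_. 0} | Suc q \<Rightarrow> coboundary q X ` cochains q X)"

definition cocycle_group :: "nat \<Rightarrow> 'a topology \<Rightarrow> 'a cochain monoid" where
  "cocycle_group p X = \<lparr>carrier = cocycles p X, mult = (\<lambda>a b \<sigma>. a \<sigma> + b \<sigma>), one = (\<lambda>_. 0)\<rparr>"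

definition cohomology_group :: "nat \<Rightarrow> 'a topology \<Rightarrow> 'a cochain set monoid" where
  "cohomology_group p X = cocycle_group p X Mod coboundaries p X"

definition cohomology_class :: "nat \<Rightarrow> 'a topology \<Rightarrow> 'a cochain \<Rightarrow> 'a cochain set" where
  "cohomology_class p X a = coboundaries p X #>\<^bsub>cocycle_group p X\<^esub> a"

definition cochain_pullback ::
  "nat \<Rightarrow> 'a topology \<Rightarrow> ('a \<Rightarrow> 'b) \<Rightarrow> 'b cochain \<Rightarrow> 'a cochain" where
  "cochain_pullback p X f a = (\<lambda>\<sigma>. if singular_simplex p X \<sigma> then a (simplex_map p f \<sigma>) else 0)"

definition front_face :: "nat \<Rightarrow> ((nat \<Rightarrow> real) \<Rightarrow> 'a) \<Rightarrow> (nat \<Rightarrow> real) \<Rightarrow> 'a" where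
  "front_face p \<sigma> = restrict \<sigma> (standard_simplex p)"

definition back_face :: "nat \<Rightarrow> nat \<Rightarrow> ((nat \<Rightarrow> real) \<Rightarrow> 'a) \<Rightarrow> (nat \<Rightarrow> real) \<Rightarrow> 'a" where
  "back_face p q \<sigma> = restrict (\<lambda>x. \<sigma> (\<lambda>i. if i < p then 0 else x (i - p))) (standard_simplex q)"

definition cochain_cup ::
  "nat \<Rightarrow> nat \<Rightarrow> 'a topology \<Rightarrow> 'a cochain \<Rightarrow> 'a cochain \<Rightarrow> 'a cochain" where
  "cochain_cup p q X a b =
     (\<lambda>\<sigma>. if singular_simplex (p + q) X \<sigma> then a (front_face p \<sigma>) * b (back_face p q \<sigma>) else 0)"

text \<open>On cohomology classes, the unions range over all representatives, which yield the same class.\<close>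

definition pullback_class ::
  "nat \<Rightarrow> 'a topology \<Rightarrow> ('a \<Rightarrow> 'b) \<Rightarrow> 'b cochain set \<Rightarrow> 'a cochain set" where
  "pullback_class p X f \<alpha> = (\<Union>a\<in>\<alpha>. cohomology_class p X (cochain_pullback p X f a))"

definition cup_class ::
  "nat \<Rightarrow> nat \<Rightarrow> 'a topology \<Rightarrow> 'a cochain set \<Rightarrow> 'a cochain set \<Rightarrow> 'a cochain set" where
  "cup_class p q X \<alpha> \<beta> = (\<Union>a\<in>\<alpha>. \<Union>b\<in>\<beta>. cohomology_class (p + q) X (cochain_cup p q X a b))"

definition unit_class :: "'a topology \<Rightarrow> 'a cochain set" where
  "unit_class X = cohomology_class 0 X (\<lambda>\<sigma>. if singular_simplex 0 X \<sigma> then 1 else 0)"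

primrec cup_power :: "'a topology \<Rightarrow> 'a cochain set \<Rightarrow> nat \<Rightarrow> 'a cochain set" where
  "cup_power X \<alpha> 0 = unit_class X"
| "cup_power X \<alpha> (Suc k) = cup_class k 1 X (cup_power X \<alpha> k) \<alpha>"


section \<open>Stiefel--Whitney classes\<close>

definition quotient_topology :: "'a topology \<Rightarrow> ('a \<Rightarrow> 'b) \<Rightarrow> 'b topology" where
  "quotient_topology X f =
     topology (\<lambda>U. U \<subseteq> f ` topspace X \<and> openin X {x \<in> topspace X. f x \<in> U})"

lemma openin_quotient_topology:
  "openin (quotient_topology X f) U \<longleftrightarrow>
     U \<subseteq> f ` topspace X \<and> openin X {x \<in> topspace X. f x \<in> U}"
proof -
  have "istopology (\<lambda>U. U \<subseteq> f ` topspace X \<and> openin X {x \<in> topspace X. f x \<in> U})"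
    unfolding istopology_def
  proof (intro conjI allI impI; (elim conjE)?)
    fix S T
    assume "S \<subseteq> f ` topspace X" "openin X {x \<in> topspace X. f x \<in> S}"
      and "T \<subseteq> f ` topspace X" "openin X {x \<in> topspace X. f x \<in> T}"
    moreover have "{x \<in> topspace X. f x \<in> S \<inter> T} =
        {x \<in> topspace X. f x \<in> S} \<inter> {x \<in> topspace X. f x \<in> T}" by auto
    ultimately show "S \<inter> T \<subseteq> f ` topspace X" "openin X {x \<in> topspace X. f x \<in> S \<inter> T}"
      by auto
  next
    fix \<K>
    assume K: "\<forall>K\<in>\<K>. K \<subseteq> f ` topspace X \<and> openin X {x \<in> topspace X. f x \<in> K}"
    have "{x \<in> topspace X. f x \<in> \<Union>\<K>} = (\<Union>K\<in>\<K>. {x \<in> topspace X. f x \<in> K})" by auto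
    with K show "openin X {x \<in> topspace X. f x \<in> \<Union>\<K>}" by auto
    from K show "\<Union>\<K> \<subseteq> f ` topspace X" by auto
  qed
  then show ?thesis
    unfolding quotient_topology_def by (simp add: topology_inverse')
qed

text \<open>The projectivisation \<open>P(\<xi>)\<close> is the quotient of the space of nonzero vectors, with the
  punctured lines \<open>{t \<cdot> v | t \<noteq> 0}\<close> as points.\<close>

definition nonzero_vectors :: "('e, 'b) vbundle \<Rightarrow> 'e topology" where
  "nonzero_vectors \<xi> = subtopology (total_space \<xi>) {e. fibre_scale \<xi> 0 e \<noteq> e}"

definition line_through :: "('e, 'b) vbundle \<Rightarrow> 'e \<Rightarrow> 'e set" where
  "line_through \<xi> e = {fibre_scale \<xi> t e | t. t \<noteq> 0}"

definition projectivisation :: "('e, 'b) vbundle \<Rightarrow> 'e set topology" where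
  "projectivisation \<xi> = quotient_topology (nonzero_vectors \<xi>) (line_through \<xi>)"

definition projectivisation_proj :: "('e, 'b) vbundle \<Rightarrow> 'e set \<Rightarrow> 'b" where
  "projectivisation_proj \<xi> l = the_elem (bundle_proj \<xi> ` l)"

text \<open>The first Stiefel--Whitney class of the tautological line bundle over \<open>P(\<xi>)\<close>, that is, the
  element of \<open>H\<^sup>1(P(\<xi>); \<int>/2)\<close> that classifies the double covering of \<open>P(\<xi>)\<close> by the rays of \<open>\<xi>\<close>.
  Choose an orientation of every line: \<open>s\<close> tells whether a nonzero vector is positive (\<open>s = 0\<close>) or
  negative (\<open>s = 1\<close>). The class is represented by the cocycle \<open>a\<close> whose value at a path of lines
  is 0 if the transport along the path preserves the chosen orientations and 1 if it does not, which
  is the difference of \<open>s\<close> at the two ends of any lift of the path to nonzero vectors.\<close>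

definition line_orientation :: "('e, 'b) vbundle \<Rightarrow> ('e \<Rightarrow> bit) \<Rightarrow> bool" where
  "line_orientation \<xi> s \<longleftrightarrow>
     (\<forall>e\<in>topspace (nonzero_vectors \<xi>). \<forall>t. t \<noteq> 0 \<longrightarrow>
        s (fibre_scale \<xi> t e) = s e + (if t < 0 then 1 else 0))"

definition point_cochain :: "'a topology \<Rightarrow> ('a \<Rightarrow> bit) \<Rightarrow> 'a cochain" where
  "point_cochain X s =
     (\<lambda>\<sigma>. if singular_simplex 0 X \<sigma> then s (\<sigma> (\<lambda>i. if i = 0 then 1 else 0)) else 0)"

definition tautological_class :: "('e, 'b) vbundle \<Rightarrow> 'e set cochain set" where
  "tautological_class \<xi> =
     (THE \<alpha>. \<exists>s a. line_orientation \<xi> s \<and> a \<in> cocycles 1 (projectivisation \<xi>) \<and>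
        cochain_pullback 1 (nonzero_vectors \<xi>) (line_through \<xi>) a =
          coboundary 0 (nonzero_vectors \<xi>) (point_cochain (nonzero_vectors \<xi>) s) \<and>
        \<alpha> = cohomology_class 1 (projectivisation \<xi>) a)"

text \<open>The definition of the Stiefel--Whitney classes through the projective bundle, as in Husemoller's
  \<^emph>\<open>Fibre Bundles\<close> and Hatcher's \<^emph>\<open>Vector Bundles and K-Theory\<close>: for a bundle of rank \<open>n\<close> they are the
  unique classes \<open>w\<^sub>i \<in> H\<^sup>i(B; \<int>/2)\<close> with \<open>w\<^sub>0 = 1\<close>, \<open>w\<^sub>i = 0\<close> for \<open>i > n\<close> and
  \<open>x\<^sup>n + \<pi>\<^sup>*(w\<^sub>1) x\<^sup>n\<^sup>-\<^sup>1 + \<dots> + \<pi>\<^sup>*(w\<^sub>n) = 0\<close> in \<open>H\<^sup>n(P(\<xi>); \<int>/2)\<close>, where \<open>\<pi> : P(\<xi>) \<rightarrow> B\<close> and \<open>x\<close> is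
  the tautological class. The group operation of \<open>H\<^sup>n\<close> is addition of classes, so \<open>finprod\<close> is a sum
  and \<open>\<one>\<close> is the class \<open>0\<close>.\<close>

definition stiefel_whitney_family :: "('e, 'b) vbundle \<Rightarrow> (nat \<Rightarrow> 'b cochain set) \<Rightarrow> bool" where
  "stiefel_whitney_family \<xi> w \<longleftrightarrow>
     (\<forall>i. w i \<in> carrier (cohomology_group i (base_space \<xi>))) \<and>
     w 0 = unit_class (base_space \<xi>) \<and>
     (\<forall>i>fibre_dim \<xi>. w i = \<one>\<^bsub>cohomology_group i (base_space \<xi>)\<^esub>) \<and>
     finprod (cohomology_group (fibre_dim \<xi>) (projectivisation \<xi>))
       (\<lambda>i. cup_class i (fibre_dim \<xi> - i) (projectivisation \<xi>)
          (pullback_class i (projectivisation \<xi>) (projectivisation_proj \<xi>) (w i))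
          (cup_power (projectivisation \<xi>) (tautological_class \<xi>) (fibre_dim \<xi> - i)))
       {..fibre_dim \<xi>}
     = \<one>\<^bsub>cohomology_group (fibre_dim \<xi>) (projectivisation \<xi>)\<^esub>"

definition stiefel_whitney_class :: "('e, 'b) vbundle \<Rightarrow> nat \<Rightarrow> 'b cochain set" where
  "stiefel_whitney_class \<xi> = (THE w. stiefel_whitney_family \<xi> w)"

end

theory Submission
  imports Defs
begin

text \<open>The encoder \<open>E\<close> is a diffeomorphism onto its image, and by invariance of domain this image is open in
  \<open>\<real>\<^sup>d\<close>. The derivatives of \<open>E\<close> and of its inverse, read in charts, are therefore inverse to each other, and
  \<open>(p, v) \<mapsto> (p, dE\<^sub>p v)\<close> is an isomorphism of \<open>TM\<close> onto \<open>M \<times> \<real>\<^sup>d\<close>, smooth in both directions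
  (\<open>smooth_trivialisation_triv\<close>).

  The Stiefel--Whitney classes of a bundle \<open>\<xi>\<close> of rank \<open>d\<close> over \<open>B\<close> are the unique solution of
  \<open>x\<^sup>d + w\<^sub>1 x\<^sup>d\<^sup>-\<^sup>1 + \<dots> + w\<^sub>d = 0\<close> in the cohomology of the projectivisation \<open>P\<close>, where \<open>x\<close> is the tautological
  class. To evaluate them for a trivial bundle one has to show that \<open>w\<^sub>i = 0\<close> is a solution, which means
  \<open>x\<^sup>d = 0\<close>, and that there is no other one.

  The equation \<open>x\<^sup>d = 0\<close> (\<open>tautological_power_vanishes\<close>) holds since \<open>P\<close> is covered by the \<open>d\<close> open sets where one
  of the coordinates does not vanish. Orienting the lines by the \<open>i\<close>-th coordinate represents \<open>x\<close> by a cocycle that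
  vanishes on the paths in the \<open>i\<close>-th set. The product of these \<open>d\<close> cocycles vanishes on all simplices contained in one
  of the sets, and by iterated subdivision such a cocycle is a coboundary
  (\<open>vanishing_on_small_simplices_imp_coboundary\<close>).

  For the uniqueness (\<open>relation_imp_coboundaries\<close>), pull the relation back to \<open>B \<times> S\<^sup>d\<^sup>-\<^sup>1\<close>. Cochains that come
  from \<open>P\<close> become invariant under the antipode \<open>\<tau>\<close>, and \<open>x\<close> becomes \<open>\<delta> s\<close> for a function \<open>s\<close> with
  \<open>s \<circ> \<tau> = s + 1\<close>. Restriction to a section of \<open>B \<times> S\<^sup>d\<^sup>-\<^sup>1\<close> kills \<open>x\<close> and gives \<open>w\<^sub>d = 0\<close>; as moreover \<open>x\<^sup>d = 0\<close>, the relation reads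
  \<open>y x = 0\<close> with \<open>y\<close> of the same form in one degree less. The Gysin sequence of the double covering
  \<open>B \<times> S\<^sup>d\<^sup>-\<^sup>1 \<rightarrow> P\<close> then shows that \<open>y\<close> is a transfer \<open>z + \<tau>\<^sup>* z\<close>, and since the inclusion of the equator \<open>S\<^sup>d\<^sup>-\<^sup>2\<close>
  is homotopic to a constant map, the transfer restricts to zero on \<open>B \<times> S\<^sup>d\<^sup>-\<^sup>2\<close> (\<open>gysin_descent\<close>). This is the
  relation for the next smaller sphere, and induction shows that all \<open>w\<^sub>i\<close> vanish.\<close>

section \<open>Arithmetic modulo 2\<close>

text \<open>By default the simplifier turns sums and products of bits into bitwise operations, which would hide the vector
  space structure of cochains.\<close>

declare add_bit_eq_xor [simp del] mult_bit_eq_and [simp del]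

lemma bit_add_self [simp]: "b + b = (0::bit)"
  by (cases b) simp_all

lemma bit_add_self_left [simp]: "b + (b + c) = (c::bit)"
  by (simp flip: add.assoc)

lemma bit_add_eq_0_iff: "b + c = 0 \<longleftrightarrow> b = (c::bit)"
  by (cases b; cases c) simp_all

section \<open>Evaluation of cochains on chains\<close>

text \<open>Singular chains have integer coefficients; their signs disappear in the values of cochains. Evaluation on chains
  makes the subdivision operator and its chain homotopy available for cochains.\<close>

definition cochain_eval :: "'a cochain \<Rightarrow> 'a chain \<Rightarrow> bit" where
  "cochain_eval a c = (\<Sum>\<sigma>\<in>Poly_Mapping.keys c. of_int (Poly_Mapping.lookup c \<sigma>) * a \<sigma>)"

lemma cochain_eval_superset:
  assumes "finite S" "Poly_Mapping.keys c \<subseteq> S"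
  shows "cochain_eval a c = (\<Sum>\<sigma>\<in>S. of_int (Poly_Mapping.lookup c \<sigma>) * a \<sigma>)"
  unfolding cochain_eval_def
  by (rule sum.mono_neutral_left) (use assms in \<open>auto simp: in_keys_iff\<close>)

lemma cochain_eval_0 [simp]: "cochain_eval a 0 = 0"
  by (simp add: cochain_eval_def)

lemma cochain_eval_of [simp]: "cochain_eval a (frag_of \<sigma>) = a \<sigma>"
  by (simp add: cochain_eval_def)

lemma cochain_eval_add: "cochain_eval a (c + c') = cochain_eval a c + cochain_eval a c'"
proof -
  let ?S = "Poly_Mapping.keys c \<union> Poly_Mapping.keys c'"
  have "Poly_Mapping.keys (c + c') \<subseteq> ?S" by (rule Poly_Mapping.keys_add)
  then show ?thesis
    by (simp add: cochain_eval_superset[of ?S] lookup_add distrib_right sum.distrib)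
qed

lemma cochain_eval_minus: "cochain_eval a (- c) = cochain_eval a c"
  by (simp add: cochain_eval_def)

lemma cochain_eval_diff: "cochain_eval a (c - c') = cochain_eval a c + cochain_eval a c'"
  using cochain_eval_add[of a c "- c'"] by (simp add: cochain_eval_minus)

lemma cochain_eval_cmul: "cochain_eval a (frag_cmul n c) = of_int n * cochain_eval a c"
proof -
  have "Poly_Mapping.keys (frag_cmul n c) \<subseteq> Poly_Mapping.keys c"
    by (rule keys_cmul)
  then show ?thesis
    by (simp add: cochain_eval_superset[of "Poly_Mapping.keys c"] sum_distrib_left mult.assoc)
qed

lemma cochain_eval_sum: "cochain_eval a (sum f I) = (\<Sum>i\<in>I. cochain_eval a (f i))"
  by (induction I rule: infinite_finite_induct) (simp_all add: cochain_eval_add)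

lemma cochain_eval_vanishes:
  "(\<And>\<sigma>. \<sigma> \<in> Poly_Mapping.keys c \<Longrightarrow> a \<sigma> = 0) \<Longrightarrow> cochain_eval a c = 0"
  by (simp add: cochain_eval_def)

lemma coboundary_eq_eval:
  "singular_simplex (Suc p) X \<sigma> \<Longrightarrow>
     coboundary p X a \<sigma> = cochain_eval a (chain_boundary (Suc p) (frag_of \<sigma>))"
  by (simp add: coboundary_def chain_boundary_of cochain_eval_sum cochain_eval_cmul del: sum.atMost_Suc)

lemma cochain_eval_boundary:
  assumes "singular_chain (Suc p) X c"
  shows "cochain_eval a (chain_boundary (Suc p) c) = cochain_eval (coboundary p X a) c"
  using assms unfolding singular_chain_def
proof (induction rule: frag_induction)
  case (one x)
  then show ?case by (simp add: coboundary_eq_eval)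
qed (simp_all add: chain_boundary_diff cochain_eval_diff)


section \<open>The cochain complex\<close>

lemma cochains_vanish: "a \<in> cochains p X \<Longrightarrow> \<not> singular_simplex p X \<sigma> \<Longrightarrow> a \<sigma> = 0"
  by (simp add: cochains_def)

lemma cochains_eqI:
  assumes "a \<in> cochains p X" "b \<in> cochains p X"
    and "\<And>\<sigma>. singular_simplex p X \<sigma> \<Longrightarrow> a \<sigma> = b \<sigma>"
  shows "a = b"
  using assms by (metis cochains_vanish ext)

lemma zero_in_cochains [simp]: "(\<lambda>\<sigma>. 0) \<in> cochains p X"
  by (simp add: cochains_def)

lemma add_in_cochains:
  "a \<in> cochains p X \<Longrightarrow> b \<in> cochains p X \<Longrightarrow> (\<lambda>\<sigma>. a \<sigma> + b \<sigma>) \<in> cochains p X"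
  by (simp add: cochains_def)

lemma sum_in_cochains:
  "(\<And>i. i \<in> I \<Longrightarrow> a i \<in> cochains p X) \<Longrightarrow> (\<lambda>\<sigma>. \<Sum>i\<in>I. a i \<sigma>) \<in> cochains p X"
  by (simp add: cochains_def)

lemma coboundary_in_cochains [simp]: "coboundary p X a \<in> cochains (Suc p) X"
  by (simp add: cochains_def coboundary_def)

lemma coboundary_0 [simp]: "coboundary p X (\<lambda>\<sigma>. 0) = (\<lambda>\<sigma>. 0)"
  by (simp add: coboundary_def fun_eq_iff)

lemma coboundary_add:
  "coboundary p X (\<lambda>\<sigma>. a \<sigma> + b \<sigma>) = (\<lambda>\<sigma>. coboundary p X a \<sigma> + coboundary p X b \<sigma>)"
  by (simp add: coboundary_def sum.distrib fun_eq_iff)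

lemma coboundary_sum:
  "coboundary p X (\<lambda>\<sigma>. \<Sum>i\<in>I. a i \<sigma>) = (\<lambda>\<sigma>. \<Sum>i\<in>I. coboundary p X (a i) \<sigma>)"
  by (auto simp: coboundary_def fun_eq_iff simp del: sum.atMost_Suc intro: sum.swap)

lemma coboundary_coboundary [simp]: "coboundary (Suc p) X (coboundary p X a) = (\<lambda>\<sigma>. 0)"
proof (rule cochains_eqI[of _ "Suc (Suc p)" X])
  fix \<sigma> assume \<sigma>: "singular_simplex (Suc (Suc p)) X \<sigma>"
  then have "coboundary (Suc p) X (coboundary p X a) \<sigma> =
      cochain_eval (coboundary p X a) (chain_boundary (Suc (Suc p)) (frag_of \<sigma>))"
    by (rule coboundary_eq_eval)
  also have "\<dots> = cochain_eval a (chain_boundary (Suc p) (chain_boundary (Suc (Suc p)) (frag_of \<sigma>)))"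
    by (rule cochain_eval_boundary[symmetric])
       (simp add: singular_chain_boundary_alt singular_chain_of \<sigma>)
  also have "chain_boundary (Suc p) (chain_boundary (Suc (Suc p)) (frag_of \<sigma>)) = 0"
    using chain_boundary_boundary_alt[of "Suc p" X "frag_of \<sigma>"] \<sigma> by (simp add: singular_chain_of)
  finally show "coboundary (Suc p) X (coboundary p X a) \<sigma> = 0" by simp
qed simp_all

lemma cocycles_imp_cochains: "a \<in> cocycles p X \<Longrightarrow> a \<in> cochains p X"
  by (simp add: cocycles_def)

lemma coboundary_in_cocycles [simp]: "coboundary p X a \<in> cocycles (Suc p) X"
  by (simp add: cocycles_def)

lemma zero_in_cocycles [simp]: "(\<lambda>\<sigma>. 0) \<in> cocycles p X"
  by (simp add: cocycles_def)

lemma add_in_cocycles: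
  "a \<in> cocycles p X \<Longrightarrow> b \<in> cocycles p X \<Longrightarrow> (\<lambda>\<sigma>. a \<sigma> + b \<sigma>) \<in> cocycles p X"
  by (simp add: cocycles_def add_in_cochains coboundary_add)

lemma sum_in_cocycles:
  "(\<And>i. i \<in> I \<Longrightarrow> a i \<in> cocycles p X) \<Longrightarrow> (\<lambda>\<sigma>. \<Sum>i\<in>I. a i \<sigma>) \<in> cocycles p X"
  by (simp add: cocycles_def sum_in_cochains coboundary_sum)

lemma coboundaries_Suc: "a \<in> coboundaries (Suc p) X \<longleftrightarrow> (\<exists>b\<in>cochains p X. a = coboundary p X b)"
  by (auto simp: coboundaries_def)

lemma coboundaries_imp_cocycles: "a \<in> coboundaries p X \<Longrightarrow> a \<in> cocycles p X"
  by (cases p) (auto simp: coboundaries_def)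

lemma zero_in_coboundaries [simp]: "(\<lambda>\<sigma>. 0) \<in> coboundaries p X"
  by (cases p) (auto simp: coboundaries_def intro!: rev_image_eqI[OF zero_in_cochains])

lemma add_in_coboundaries:
  assumes "a \<in> coboundaries p X" "b \<in> coboundaries p X"
  shows "(\<lambda>\<sigma>. a \<sigma> + b \<sigma>) \<in> coboundaries p X"
proof (cases p)
  case 0
  with assms show ?thesis by (simp add: coboundaries_def)
next
  case (Suc q)
  with assms show ?thesis
    by (auto simp: coboundaries_Suc simp flip: coboundary_add intro: add_in_cochains)
qed

lemma sum_in_coboundaries:
  "finite I \<Longrightarrow> (\<And>i. i \<in> I \<Longrightarrow> a i \<in> coboundaries p X) \<Longrightarrow> (\<lambda>\<sigma>. \<Sum>i\<in>I. a i \<sigma>) \<in> coboundaries p X"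
  by (induction I rule: finite_induct) (simp_all add: add_in_coboundaries)


section \<open>Pullbacks\<close>

lemma pullback_in_cochains [simp]: "cochain_pullback p X f a \<in> cochains p X"
  by (simp add: cochains_def cochain_pullback_def)

lemma pullback_0 [simp]: "cochain_pullback p X f (\<lambda>\<sigma>. 0) = (\<lambda>\<sigma>. 0)"
  by (simp add: cochain_pullback_def fun_eq_iff)

lemma pullback_add:
  "cochain_pullback p X f (\<lambda>\<sigma>. a \<sigma> + b \<sigma>) =
     (\<lambda>\<sigma>. cochain_pullback p X f a \<sigma> + cochain_pullback p X f b \<sigma>)"
  by (simp add: cochain_pullback_def fun_eq_iff)

lemma pullback_sum:
  "cochain_pullback p X f (\<lambda>\<sigma>. \<Sum>i\<in>I. a i \<sigma>) = (\<lambda>\<sigma>. \<Sum>i\<in>I. cochain_pullback p X f (a i) \<sigma>)"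
  by (simp add: cochain_pullback_def fun_eq_iff)

lemma pullback_pullback:
  assumes "continuous_map X Y f"
  shows "cochain_pullback p X f (cochain_pullback p Y g a) = cochain_pullback p X (g \<circ> f) a"
  using assms by (auto simp: cochain_pullback_def fun_eq_iff simplex_map_compose singular_simplex_simplex_map)

lemma pullback_cong:
  "(\<And>x. x \<in> topspace X \<Longrightarrow> f x = g x) \<Longrightarrow> cochain_pullback p X f a = cochain_pullback p X g a"
  by (auto simp: cochain_pullback_def fun_eq_iff cong: simplex_map_eq)

lemma pullback_id:
  "a \<in> cochains p X \<Longrightarrow> (\<And>x. x \<in> topspace X \<Longrightarrow> f x = x) \<Longrightarrow> cochain_pullback p X f a = a"
  by (rule cochains_eqI[of _ p X]) (simp, simp, simp add: cochain_pullback_def simplex_map_id_gen)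

lemma singular_face_simplex_map_commute:
  "k \<le> Suc p \<Longrightarrow> singular_face (Suc p) k (simplex_map (Suc p) f \<sigma>) = simplex_map p f (singular_face (Suc p) k \<sigma>)"
  by (auto simp: singular_face_def simplex_map_def fun_eq_iff simplical_face_in_standard_simplex)

lemma singular_simplex_face:
  "singular_simplex (Suc p) X \<sigma> \<Longrightarrow> k \<le> Suc p \<Longrightarrow> singular_simplex p X (singular_face (Suc p) k \<sigma>)"
  using singular_simplex_singular_face[of "Suc p"] by simp

lemma pullback_coboundary:
  assumes "continuous_map X Y f"
  shows "cochain_pullback (Suc p) X f (coboundary p Y a) = coboundary p X (cochain_pullback p X f a)"
  using assms
  by (auto simp: cochain_pullback_def coboundary_def fun_eq_iff singular_simplex_simplex_map
      singular_face_simplex_map_commute singular_simplex_face intro!: sum.cong)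

lemma pullback_in_cocycles:
  "continuous_map X Y f \<Longrightarrow> a \<in> cocycles p Y \<Longrightarrow> cochain_pullback p X f a \<in> cocycles p X"
  by (simp add: cocycles_def flip: pullback_coboundary)

lemma pullback_in_coboundaries:
  "continuous_map X Y f \<Longrightarrow> a \<in> coboundaries p Y \<Longrightarrow> cochain_pullback p X f a \<in> coboundaries p X"
  by (cases p) (auto simp: coboundaries_Suc pullback_coboundary coboundaries_def[of 0])

section \<open>The cup product\<close>

text \<open>The affine map of the standard simplex onto the face spanned by the vertices from \<open>p\<close> on, which defines back faces.\<close>

definition vertex_shift :: "nat \<Rightarrow> (nat \<Rightarrow> real) \<Rightarrow> nat \<Rightarrow> real" where
  "vertex_shift p x = (\<lambda>i. if i < p then 0 else x (i - p))"

lemma back_face_eq: "back_face p q \<sigma> = restrict (\<sigma> \<circ> vertex_shift p) (standard_simplex q)"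
  by (simp add: back_face_def vertex_shift_def o_def)

lemma vertex_shift_in_standard_simplex:
  assumes "x \<in> standard_simplex q"
  shows "vertex_shift p x \<in> standard_simplex (p + q)"
proof -
  have "(\<Sum>i\<le>p + q. vertex_shift p x i) = (\<Sum>i\<in>{p..p + q}. vertex_shift p x i)"
    by (rule sum.mono_neutral_right) (auto simp: vertex_shift_def)
  also have "\<dots> = (\<Sum>i\<le>q. x i)"
    by (rule sum.reindex_bij_witness[of _ "\<lambda>i. i + p" "\<lambda>i. i - p"]) (auto simp: vertex_shift_def)
  finally show ?thesis
    using assms by (auto simp: standard_simplex_def vertex_shift_def)
qed

lemma continuous_map_coordinates_UNIV:
  "continuous_map (subtopology (powertop_real UNIV) S) euclideanreal (\<lambda>x. x i)"
  by (auto intro: continuous_map_from_subtopology continuous_map_product_projection)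

lemma continuous_vertex_shift:
  "continuous_map (subtopology (powertop_real UNIV) (standard_simplex q))
     (subtopology (powertop_real UNIV) (standard_simplex (p + q))) (vertex_shift p)"
proof -
  have "continuous_map (subtopology (powertop_real UNIV) (standard_simplex q)) euclideanreal
      (\<lambda>x. vertex_shift p x i)" for i
    by (cases "i < p") (simp_all add: vertex_shift_def continuous_map_coordinates_UNIV)
  then show ?thesis
    by (auto simp: continuous_map_in_subtopology continuous_map_componentwise_UNIV
        vertex_shift_in_standard_simplex)
qed

lemma singular_simplex_back_face:
  assumes "singular_simplex (p + q) X \<sigma>"
  shows "singular_simplex q X (back_face p q \<sigma>)"
  using assms unfolding singular_simplex_def back_face_eq
  by (auto intro: continuous_map_compose[OF continuous_vertex_shift])

lemma singular_simplex_front_face: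
  assumes "singular_simplex (p + q) X \<sigma>"
  shows "singular_simplex p X (front_face p \<sigma>)"
proof -
  have "continuous_map (subtopology (powertop_real UNIV) (standard_simplex p)) X \<sigma>"
    using assms continuous_map_from_subtopology_mono standard_simplex_mono[of p "p + q"]
    unfolding singular_simplex_def by auto
  then show ?thesis
    by (auto simp: singular_simplex_def front_face_def)
qed

lemma simplical_face_above:
  "x \<in> standard_simplex p \<Longrightarrow> p < k \<Longrightarrow> simplical_face k x = x"
  by (auto simp: simplical_face_def standard_simplex_def fun_eq_iff)

lemma simplical_face_vertex_shift_low: "k \<le> p \<Longrightarrow> simplical_face k (vertex_shift p x) = vertex_shift (Suc p) x"
  by (auto simp: simplical_face_def vertex_shift_def fun_eq_iff)

lemma simplical_face_vertex_shift_high: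
  "simplical_face (p + j) (vertex_shift p x) = vertex_shift p (simplical_face j x)"
  by (auto simp: simplical_face_def vertex_shift_def fun_eq_iff)

lemma front_face_singular_face_low:
  assumes "k \<le> Suc p"
  shows "front_face p (singular_face (Suc (p + q)) k \<sigma>) = singular_face (Suc p) k (front_face (Suc p) \<sigma>)"
  using assms standard_simplex_mono[of p "p + q"]
  by (auto simp: front_face_def singular_face_def fun_eq_iff simplical_face_in_standard_simplex)

lemma front_face_singular_face_high:
  assumes "p < k"
  shows "front_face p (singular_face (Suc (p + q)) k \<sigma>) = front_face p \<sigma>"
  using assms standard_simplex_mono[of p "p + q"]
  by (auto simp: front_face_def singular_face_def fun_eq_iff simplical_face_above)

lemma back_face_singular_face_low:
  assumes "k \<le> p"
  shows "back_face p q (singular_face (Suc (p + q)) k \<sigma>) = back_face (Suc p) q \<sigma>"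
  using assms vertex_shift_in_standard_simplex[of _ q p]
  by (auto simp: back_face_eq singular_face_def fun_eq_iff simplical_face_vertex_shift_low)

lemma back_face_singular_face_high:
  assumes "j \<le> Suc q"
  shows "back_face p q (singular_face (Suc (p + q)) (p + j) \<sigma>) = singular_face (Suc q) j (back_face p (Suc q) \<sigma>)"
  using assms vertex_shift_in_standard_simplex[of _ q p]
  by (auto simp: back_face_eq singular_face_def fun_eq_iff simplical_face_vertex_shift_high
      simplical_face_in_standard_simplex)

lemma singular_face_front_face_last: "singular_face (Suc p) (Suc p) (front_face (Suc p) \<sigma>) = front_face p \<sigma>"
  using front_face_singular_face_low[of "Suc p" p 0 \<sigma>] front_face_singular_face_high[of p "Suc p" 0 \<sigma>]
  by simp

lemma singular_face_back_face_first: "singular_face (Suc q) 0 (back_face p (Suc q) \<sigma>) = back_face (Suc p) q \<sigma>"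
  using back_face_singular_face_low[of p p q \<sigma>] back_face_singular_face_high[of 0 q p \<sigma>]
  by simp

lemma front_face_simplex_map:
  "front_face p (simplex_map (p + q) f \<sigma>) = simplex_map p f (front_face p \<sigma>)"
  using standard_simplex_mono[of p "p + q"]
  by (auto simp: front_face_def simplex_map_def fun_eq_iff)

lemma back_face_simplex_map:
  "back_face p q (simplex_map (p + q) f \<sigma>) = simplex_map q f (back_face p q \<sigma>)"
  using vertex_shift_in_standard_simplex[of _ q p]
  by (auto simp: back_face_eq simplex_map_def fun_eq_iff)

lemma front_face_front_face: "front_face p (front_face (p + q) \<sigma>) = front_face p \<sigma>"
  using standard_simplex_mono[of p "p + q"] by (auto simp: front_face_def fun_eq_iff)

lemma front_face_back_face: "front_face q (back_face p (q + r) \<sigma>) = back_face p q (front_face (p + q) \<sigma>)"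
  using standard_simplex_mono[of q "q + r"] vertex_shift_in_standard_simplex[of _ q p]
  by (auto simp: front_face_def back_face_eq fun_eq_iff)

lemma back_face_back_face: "back_face q r (back_face p (q + r) \<sigma>) = back_face (p + q) r \<sigma>"
proof -
  have "vertex_shift p (vertex_shift q x) = vertex_shift (p + q) x" for x
    by (rule ext) (auto simp: vertex_shift_def less_diff_conv2 add.commute)
  then show ?thesis
    using vertex_shift_in_standard_simplex[of _ r q] by (auto simp: back_face_eq restrict_def)
qed

lemma front_face_full: "singular_simplex p X \<sigma> \<Longrightarrow> front_face p \<sigma> = \<sigma>"
  by (simp add: front_face_def singular_simplex_def extensional_restrict)

lemma back_face_full: "singular_simplex p X \<sigma> \<Longrightarrow> back_face 0 p \<sigma> = \<sigma>"
  by (simp add: back_face_def singular_simplex_def extensional_restrict)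

lemma cup_in_cochains [simp]: "n = p + q \<Longrightarrow> cochain_cup p q X a b \<in> cochains n X"
  by (simp add: cochains_def cochain_cup_def)

lemma cup_add_left:
  "cochain_cup p q X (\<lambda>\<sigma>. a \<sigma> + a' \<sigma>) b = (\<lambda>\<sigma>. cochain_cup p q X a b \<sigma> + cochain_cup p q X a' b \<sigma>)"
  by (simp add: cochain_cup_def fun_eq_iff distrib_right)

lemma cup_add_right:
  "cochain_cup p q X a (\<lambda>\<sigma>. b \<sigma> + b' \<sigma>) = (\<lambda>\<sigma>. cochain_cup p q X a b \<sigma> + cochain_cup p q X a b' \<sigma>)"
  by (simp add: cochain_cup_def fun_eq_iff distrib_left)

lemma cup_sum_left:
  "cochain_cup p q X (\<lambda>\<sigma>. \<Sum>i\<in>I. a i \<sigma>) b = (\<lambda>\<sigma>. \<Sum>i\<in>I. cochain_cup p q X (a i) b \<sigma>)"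
  by (simp add: cochain_cup_def fun_eq_iff sum_distrib_right)

lemma cup_zero_left [simp]: "cochain_cup p q X (\<lambda>\<sigma>. 0) b = (\<lambda>\<sigma>. 0)"
  by (simp add: cochain_cup_def fun_eq_iff)

lemma cup_zero_right [simp]: "cochain_cup p q X a (\<lambda>\<sigma>. 0) = (\<lambda>\<sigma>. 0)"
  by (simp add: cochain_cup_def fun_eq_iff)

lemma cup_assoc:
  "cochain_cup (p + q) r X (cochain_cup p q X a b) c = cochain_cup p (q + r) X a (cochain_cup q r X b c)"
proof
  fix \<sigma>
  show "cochain_cup (p + q) r X (cochain_cup p q X a b) c \<sigma> =
      cochain_cup p (q + r) X a (cochain_cup q r X b c) \<sigma>"
  proof (cases "singular_simplex (p + q + r) X \<sigma>")
    case True
    then show ?thesis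
      using singular_simplex_front_face[of "p + q" r X \<sigma>] singular_simplex_back_face[of p "q + r" X \<sigma>]
      by (simp add: cochain_cup_def front_face_front_face front_face_back_face back_face_back_face
          add.assoc mult.assoc)
  qed (simp add: cochain_cup_def add.assoc)
qed

lemma pullback_cup:
  assumes "continuous_map X Y f"
  shows "cochain_pullback (p + q) X f (cochain_cup p q Y a b) =
         cochain_cup p q X (cochain_pullback p X f a) (cochain_pullback q X f b)"
  using assms
  by (auto simp: cochain_pullback_def cochain_cup_def fun_eq_iff singular_simplex_simplex_map
      front_face_simplex_map back_face_simplex_map singular_simplex_front_face singular_simplex_back_face)

text \<open>The last face of the front part and the first face of the back part give the same term in the two summands on
  the right; modulo 2 these two terms cancel, and the others are the faces on the left.\<close>

lemma coboundary_cup: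
  "coboundary (p + q) X (cochain_cup p q X a b) =
     (\<lambda>\<sigma>. cochain_cup (Suc p) q X (coboundary p X a) b \<sigma> + cochain_cup p (Suc q) X a (coboundary q X b) \<sigma>)"
proof
  fix \<sigma>
  show "coboundary (p + q) X (cochain_cup p q X a b) \<sigma> =
      cochain_cup (Suc p) q X (coboundary p X a) b \<sigma> + cochain_cup p (Suc q) X a (coboundary q X b) \<sigma>"
  proof (cases "singular_simplex (Suc (p + q)) X \<sigma>")
    case True
    let ?F = "front_face (Suc p) \<sigma>" and ?B = "back_face p (Suc q) \<sigma>"
    have F: "singular_simplex (Suc p) X ?F" and B: "singular_simplex (Suc q) X ?B"
      using True singular_simplex_front_face[of "Suc p" q X \<sigma>] singular_simplex_back_face[of p "Suc q" X \<sigma>]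
      by simp_all
    let ?g = "\<lambda>k. a (front_face p (singular_face (Suc (p + q)) k \<sigma>)) *
                  b (back_face p q (singular_face (Suc (p + q)) k \<sigma>))"
    have "coboundary (p + q) X (cochain_cup p q X a b) \<sigma> = (\<Sum>k\<le>Suc (p + q). ?g k)"
      using True by (simp add: coboundary_def cochain_cup_def singular_simplex_face del: sum.atMost_Suc)
    also have "{..Suc (p + q)} = {..p} \<union> {Suc p..Suc (p + q)}" by auto
    also have "(\<Sum>k\<in>\<dots>. ?g k) = (\<Sum>k\<le>p. ?g k) + (\<Sum>k\<in>{Suc p..Suc (p + q)}. ?g k)"
      by (rule sum.union_disjoint) auto
    also have "(\<Sum>k\<le>p. ?g k) = (\<Sum>k\<le>p. a (singular_face (Suc p) k ?F)) * b (back_face (Suc p) q \<sigma>)"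
      by (simp add: sum_distrib_right front_face_singular_face_low back_face_singular_face_low)
    also have "(\<Sum>k\<in>{Suc p..Suc (p + q)}. ?g k) = (\<Sum>j\<le>q. ?g (p + Suc j))"
      by (rule sum.reindex_bij_witness[of _ "\<lambda>j. p + Suc j" "\<lambda>k. k - Suc p"]) auto
    also have "\<dots> = a (front_face p \<sigma>) * (\<Sum>j\<le>q. b (singular_face (Suc q) (Suc j) ?B))"
      unfolding sum_distrib_left
      by (rule sum.cong[OF refl], subst back_face_singular_face_high) (simp_all add: front_face_singular_face_high)
    also have "(\<Sum>k\<le>p. a (singular_face (Suc p) k ?F)) * b (back_face (Suc p) q \<sigma>) +
        a (front_face p \<sigma>) * (\<Sum>j\<le>q. b (singular_face (Suc q) (Suc j) ?B)) =
        (\<Sum>k\<le>Suc p. a (singular_face (Suc p) k ?F)) * b (back_face (Suc p) q \<sigma>) +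
        a (front_face p \<sigma>) * (\<Sum>j\<le>Suc q. b (singular_face (Suc q) j ?B))"
      unfolding sum.atMost_Suc[of _ p] sum.atMost_Suc_shift[of _ q]
        singular_face_front_face_last singular_face_back_face_first
      by (simp add: algebra_simps)
    finally show ?thesis
      using True F B by (simp add: coboundary_def cochain_cup_def del: sum.atMost_Suc)
  qed (simp add: coboundary_def cochain_cup_def)
qed

lemma cup_in_cocycles:
  assumes "a \<in> cocycles p X" "b \<in> cocycles q X"
  shows "cochain_cup p q X a b \<in> cocycles (p + q) X"
  using assms by (simp add: cocycles_def coboundary_cup)

lemma cup_coboundary_left:
  assumes "b \<in> cocycles q X"
  shows "cochain_cup (Suc p) q X (coboundary p X a) b = coboundary (p + q) X (cochain_cup p q X a b)"
  using assms by (simp add: cocycles_def coboundary_cup)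

lemma cup_coboundary_right:
  assumes "a \<in> cocycles p X"
  shows "cochain_cup p (Suc q) X a (coboundary q X b) = coboundary (p + q) X (cochain_cup p q X a b)"
  using assms by (simp add: cocycles_def coboundary_cup)

lemma cup_in_coboundaries_left:
  assumes "a \<in> coboundaries p X" "b \<in> cocycles q X"
  shows "cochain_cup p q X a b \<in> coboundaries (p + q) X"
proof (cases p)
  case 0
  with assms show ?thesis by (simp add: coboundaries_def[of 0])
next
  case (Suc p')
  with assms obtain c where "a = coboundary p' X c" by (auto simp: coboundaries_Suc)
  with Suc assms show ?thesis by (auto simp: coboundaries_Suc cup_coboundary_left)
qed

lemma cup_in_coboundaries_right:
  assumes "a \<in> cocycles p X" "b \<in> coboundaries q X"
  shows "cochain_cup p q X a b \<in> coboundaries (p + q) X"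
proof (cases q)
  case 0
  with assms show ?thesis by (simp add: coboundaries_def[of 0])
next
  case (Suc q')
  with assms obtain c where "b = coboundary q' X c" by (auto simp: coboundaries_Suc)
  with Suc assms show ?thesis by (auto simp: coboundaries_Suc cup_coboundary_right)
qed

definition unit_cochain :: "'a topology \<Rightarrow> 'a cochain" where
  "unit_cochain X = (\<lambda>\<sigma>. if singular_simplex 0 X \<sigma> then 1 else 0)"

lemma unit_in_cochains [simp]: "unit_cochain X \<in> cochains 0 X"
  by (simp add: unit_cochain_def cochains_def)

lemma unit_in_cocycles [simp]: "unit_cochain X \<in> cocycles 0 X"
proof -
  have "coboundary 0 X (unit_cochain X) = (\<lambda>\<sigma>. 0)"
    using singular_simplex_face[of 0 X]
    by (auto simp: coboundary_def unit_cochain_def fun_eq_iff)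
  then show ?thesis by (simp add: cocycles_def)
qed

lemma pullback_unit [simp]: "continuous_map X Y f \<Longrightarrow> cochain_pullback 0 X f (unit_cochain Y) = unit_cochain X"
  by (auto simp: cochain_pullback_def unit_cochain_def fun_eq_iff singular_simplex_simplex_map)

lemma cup_unit_left:
  assumes "b \<in> cochains q X"
  shows "cochain_cup 0 q X (unit_cochain X) b = b"
  using singular_simplex_front_face[of 0 q X] cochains_vanish[OF assms]
  by (auto simp: cochain_cup_def unit_cochain_def fun_eq_iff back_face_full)

lemma cup_unit_right:
  assumes "a \<in> cochains p X"
  shows "cochain_cup p 0 X a (unit_cochain X) = a"
  using singular_simplex_back_face[of p 0 X] cochains_vanish[OF assms]
  by (auto simp: cochain_cup_def unit_cochain_def fun_eq_iff front_face_full)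

text \<open>The factors are allowed to differ: a power of a class may be represented by a product of different cocycles in
  that class.\<close>

primrec cup_prod :: "'a topology \<Rightarrow> (nat \<Rightarrow> 'a cochain) \<Rightarrow> nat \<Rightarrow> 'a cochain" where
  "cup_prod X x 0 = unit_cochain X"
| "cup_prod X x (Suc k) = cochain_cup k 1 X (cup_prod X x k) (x k)"

lemma cup_prod_in_cocycles:
  "(\<And>i. i < k \<Longrightarrow> x i \<in> cocycles 1 X) \<Longrightarrow> cup_prod X x k \<in> cocycles k X"
  by (induction k) (use cup_in_cocycles[of _ _ X _ 1] in auto)

lemma pullback_cup_prod:
  "continuous_map X Y f \<Longrightarrow>
     cochain_pullback k X f (cup_prod Y x k) = cup_prod X (\<lambda>i. cochain_pullback 1 X f (x i)) k"
  by (induction k) (use pullback_cup[of X Y f _ 1] in auto)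

text \<open>Every factor is evaluated at an edge of the simplex, which stays in \<open>U i\<close>.\<close>

lemma cup_prod_vanishes:
  assumes "\<And>\<sigma>. \<sigma> \<in> standard_simplex 1 \<rightarrow> U i \<Longrightarrow> x i \<sigma> = 0"
    and "i < k" "\<sigma> \<in> standard_simplex k \<rightarrow> U i"
  shows "cup_prod X x k \<sigma> = 0"
  using assms(2,3)
proof (induction k arbitrary: \<sigma>)
  case (Suc k)
  show ?case
  proof (cases "i = k")
    case True
    have "back_face k 1 \<sigma> \<in> standard_simplex 1 \<rightarrow> U i"
      using Suc.prems vertex_shift_in_standard_simplex[of _ 1 k] by (auto simp: back_face_eq)
    with assms(1) True show ?thesis by (simp add: cochain_cup_def)
  next
    case False
    have "front_face k \<sigma> \<in> standard_simplex k \<rightarrow> U i"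
      using Suc.prems standard_simplex_mono[of k "Suc k"] by (auto simp: front_face_def Pi_iff)
    with Suc False show ?thesis by (simp add: cochain_cup_def)
  qed
qed simp

section \<open>Homotopy invariance\<close>

text \<open>The prism over the standard \<open>p\<close>-simplex is cut into the simplices with the vertices
  \<open>(v\<^sub>0, 0), \<dots>, (v\<^sub>i, 0), (v\<^sub>i, 1), \<dots>, (v\<^sub>p, 1)\<close>. In barycentric coordinates of such a simplex, \<open>collapse_vertex i\<close> is
  the projection to the base and \<open>tail_weight (i + 1)\<close>, the total weight of the vertices of height 1, is the height.\<close>

definition collapse_vertex :: "nat \<Rightarrow> (nat \<Rightarrow> real) \<Rightarrow> nat \<Rightarrow> real" where
  "collapse_vertex i x = (\<lambda>k. if k < i then x k else if k = i then x i + x (Suc i) else x (Suc k))"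

definition tail_weight :: "nat \<Rightarrow> (nat \<Rightarrow> real) \<Rightarrow> real" where
  "tail_weight m x = 1 - (\<Sum>j<m. x j)"

definition prism_simplex ::
  "nat \<Rightarrow> (real \<times> 'a \<Rightarrow> 'b) \<Rightarrow> nat \<Rightarrow> ((nat \<Rightarrow> real) \<Rightarrow> 'a) \<Rightarrow> (nat \<Rightarrow> real) \<Rightarrow> 'b" where
  "prism_simplex p H i \<sigma> =
     restrict (\<lambda>x. H (tail_weight (Suc i) x, \<sigma> (collapse_vertex i x))) (standard_simplex (Suc p))"

definition prism_pullback ::
  "nat \<Rightarrow> 'a topology \<Rightarrow> (real \<times> 'a \<Rightarrow> 'b) \<Rightarrow> 'b cochain \<Rightarrow> 'a cochain" where
  "prism_pullback p X H a = (\<lambda>\<sigma>. if singular_simplex p X \<sigma> then \<Sum>i\<le>p. a (prism_simplex p H i \<sigma>) else 0)"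

lemma collapse_vertex_in_standard_simplex:
  assumes "x \<in> standard_simplex (Suc p)" "i \<le> p"
  shows "collapse_vertex i x \<in> standard_simplex p"
proof -
  have x: "\<And>k. 0 \<le> x k" "\<And>k. k > Suc p \<Longrightarrow> x k = 0" and s: "sum x {..Suc p} = 1"
    using assms by (auto simp: standard_simplex_def)
  have "(\<Sum>k<m. collapse_vertex i x k) = (if m \<le> i then \<Sum>k<m. x k else \<Sum>k<Suc m. x k)" for m
    by (induction m) (auto simp: collapse_vertex_def le_less_Suc_eq)
  from this[of "Suc p"] s assms(2) have sum: "sum (collapse_vertex i x) {..p} = 1"
    by (simp add: lessThan_Suc_atMost del: sum.lessThan_Suc sum.atMost_Suc)
  have nonneg: "0 \<le> collapse_vertex i x k" for k
    using x by (auto simp: collapse_vertex_def)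
  have zero: "collapse_vertex i x k = 0" if "k > p" for k
    using x assms(2) that by (auto simp: collapse_vertex_def)
  have "collapse_vertex i x k \<le> 1" for k
  proof (cases "k \<le> p")
    case True
    with nonneg show ?thesis
      using member_le_sum[of k "{..p}" "collapse_vertex i x"] sum by auto
  qed (use zero in auto)
  with nonneg zero sum show ?thesis by (auto simp: standard_simplex_def)
qed

lemma tail_weight_01:
  assumes "x \<in> standard_simplex p"
  shows "tail_weight m x \<in> {0..1}"
proof -
  have "(\<Sum>j<m. x j) \<le> (\<Sum>j\<le>max m p. x j)"
    using assms by (intro sum_mono2) (auto simp: standard_simplex_def)
  also have "\<dots> = (\<Sum>j\<le>p. x j)"
    using assms by (intro sum.mono_neutral_right) (auto simp: standard_simplex_def)
  also have "\<dots> = 1"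
    using assms by (simp add: standard_simplex_def)
  finally show ?thesis
    using assms by (auto simp: tail_weight_def standard_simplex_def sum_nonneg)
qed

lemma singular_simplex_prism:
  assumes "continuous_map (prod_topology (top_of_set {0..1}) X) Y H" "singular_simplex p X \<sigma>" "i \<le> p"
  shows "singular_simplex (Suc p) Y (prism_simplex p H i \<sigma>)"
proof -
  let ?\<Delta> = "\<lambda>p. subtopology (powertop_real UNIV) (standard_simplex p)"
  have "continuous_map (?\<Delta> (Suc p)) euclideanreal (\<lambda>x. collapse_vertex i x k)" for k
    unfolding collapse_vertex_def
    by (cases "k < i"; cases "k = i") (auto intro!: continuous_map_add continuous_map_coordinates_UNIV)
  then have "continuous_map (?\<Delta> (Suc p)) (?\<Delta> p) (collapse_vertex i)"
    using assms(3) collapse_vertex_in_standard_simplex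
    by (auto simp: continuous_map_in_subtopology continuous_map_componentwise_UNIV)
  then have "continuous_map (?\<Delta> (Suc p)) X (\<sigma> \<circ> collapse_vertex i)"
    using assms(2) by (auto simp: singular_simplex_def intro: continuous_map_compose)
  moreover have "continuous_map (?\<Delta> (Suc p)) euclideanreal (tail_weight (Suc i))"
    unfolding tail_weight_def
    by (intro continuous_map_diff continuous_map_sum continuous_map_coordinates_UNIV) auto
  then have "continuous_map (?\<Delta> (Suc p)) (top_of_set {0..1}) (tail_weight (Suc i))"
    using tail_weight_01 by (auto simp: continuous_map_in_subtopology)
  ultimately have "continuous_map (?\<Delta> (Suc p)) (prod_topology (top_of_set {0..1}) X)
      (\<lambda>x. (tail_weight (Suc i) x, (\<sigma> \<circ> collapse_vertex i) x))"
    by (rule continuous_map_pairedI[rotated])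
  from continuous_map_compose[OF this assms(1)] show ?thesis
    by (simp add: singular_simplex_def prism_simplex_def o_def)
qed

lemma tail_weight_simplical_face:
  "tail_weight m (simplical_face k x) = (if k < m then tail_weight (m - 1) x else tail_weight m x)"
proof -
  have "(\<Sum>j<m. simplical_face k x j) = (if k < m then \<Sum>j<m - 1. x j else \<Sum>j<m. x j)"
  proof (induction m)
    case (Suc m)
    consider "k < m" | "k = m" | "m < k" by linarith
    then show ?case
    proof cases
      case 1
      then obtain m' where "m = Suc m'" by (cases m) auto
      with 1 Suc show ?thesis by (simp add: simplical_face_def)
    qed (use Suc in \<open>simp_all add: simplical_face_def\<close>)
  qed simp
  then show ?thesis by (simp add: tail_weight_def)
qed

lemma collapse_vertex_simplical_face:
  "collapse_vertex i (simplical_face k x) =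
     (if k < i then simplical_face k (collapse_vertex (i - 1) x)
      else if k \<le> Suc i then x
      else simplical_face (k - 1) (collapse_vertex i x))"
proof
  fix j
  consider i' where "i = Suc i'" "k \<le> i'" | "k = i" | "k = Suc i" | k' where "k = Suc k'" "i < k'"
    by (metis Suc_lessI less_Suc_eq_le less_imp_Suc_add linorder_neqE_nat lessE)
  then show "collapse_vertex i (simplical_face k x) j =
     (if k < i then simplical_face k (collapse_vertex (i - 1) x)
      else if k \<le> Suc i then x
      else simplical_face (k - 1) (collapse_vertex i x)) j"
    by cases (cases j; auto simp: collapse_vertex_def simplical_face_def)+
qed

lemma singular_face_prism_low:
  assumes "k < i" "i \<le> Suc p"
  shows "singular_face (Suc (Suc p)) k (prism_simplex (Suc p) H i \<sigma>) =
         prism_simplex p H (i - 1) (singular_face (Suc p) k \<sigma>)"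
  using assms collapse_vertex_in_standard_simplex[of _ p "i - 1"]
  by (auto simp: singular_face_def prism_simplex_def fun_eq_iff simplical_face_in_standard_simplex
      tail_weight_simplical_face collapse_vertex_simplical_face)

lemma singular_face_prism_high:
  assumes "i < k" "k \<le> Suc p"
  shows "singular_face (Suc (Suc p)) (Suc k) (prism_simplex (Suc p) H i \<sigma>) =
         prism_simplex p H i (singular_face (Suc p) k \<sigma>)"
  using assms collapse_vertex_in_standard_simplex[of _ p i]
  by (auto simp: singular_face_def prism_simplex_def fun_eq_iff simplical_face_in_standard_simplex
      tail_weight_simplical_face collapse_vertex_simplical_face)

lemma singular_face_prism_middle:
  assumes "i \<le> p"
  shows "singular_face (Suc p) i (prism_simplex p H i \<sigma>) =
           restrict (\<lambda>x. H (tail_weight i x, \<sigma> x)) (standard_simplex p)"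
    and "singular_face (Suc p) (Suc i) (prism_simplex p H i \<sigma>) =
           restrict (\<lambda>x. H (tail_weight (Suc i) x, \<sigma> x)) (standard_simplex p)"
  using assms
  by (auto simp: singular_face_def prism_simplex_def fun_eq_iff simplical_face_in_standard_simplex
      tail_weight_simplical_face collapse_vertex_simplical_face)

lemma sum_bit_telescope: "(\<Sum>i\<le>p. f i + f (Suc i)) = f 0 + (f (Suc p) :: bit)"
  by (induction p) (simp_all add: add.assoc)

text \<open>The faces of the prism fall into three groups: those with \<open>k < i\<close> or \<open>k > i + 1\<close> form the prism over the
  boundary, and the remaining ones telescope to the two ends of the homotopy.\<close>

lemma prism_homotopy:
  assumes H: "continuous_map (prod_topology (top_of_set {0..1}) X) Y H"
    and a: "a \<in> cocycles (Suc p) Y"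
  shows "cochain_pullback (Suc p) X (\<lambda>x. H (1, x)) a =
    (\<lambda>\<sigma>. cochain_pullback (Suc p) X (\<lambda>x. H (0, x)) a \<sigma> + coboundary p X (prism_pullback p X H a) \<sigma>)"
proof (rule cochains_eqI[of _ "Suc p" X])
  show "cochain_pullback (Suc p) X (\<lambda>x. H (1, x)) a \<in> cochains (Suc p) X" by simp
  show "(\<lambda>\<sigma>. cochain_pullback (Suc p) X (\<lambda>x. H (0, x)) a \<sigma> +
      coboundary p X (prism_pullback p X H a) \<sigma>) \<in> cochains (Suc p) X"
    by (simp add: add_in_cochains)
  fix \<sigma> assume \<sigma>: "singular_simplex (Suc p) X \<sigma>"
  let ?q = "Suc p"
  \<comment> \<open>The faces of all simplices of the prism, the slices between consecutive ones, and the prism over the boundary.\<close>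
  define g where "g i k = a (singular_face (Suc ?q) k (prism_simplex ?q H i \<sigma>))" for i k
  define t where "t i = a (restrict (\<lambda>x. H (tail_weight i x, \<sigma> x)) (standard_simplex ?q))" for i
  define f where "f i k = a (prism_simplex p H i (singular_face ?q k \<sigma>))" for i k
  have "(\<Sum>k\<le>Suc ?q. g i k) = 0" if "i \<le> ?q" for i
  proof -
    have "coboundary ?q Y a (prism_simplex ?q H i \<sigma>) = 0"
      using a by (simp add: cocycles_def)
    then show ?thesis
      using singular_simplex_prism[OF H \<sigma> that] by (simp add: coboundary_def g_def del: sum.atMost_Suc)
  qed
  then have "0 = (\<Sum>i\<le>?q. \<Sum>k\<le>Suc ?q. g i k)" by simp
  also have "\<dots> = (\<Sum>i\<le>?q. (\<Sum>k<i. g i k) + (t i + t (Suc i)) + (\<Sum>k\<in>{i<..?q}. g i (Suc k)))"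
  proof (rule sum.cong[OF refl])
    fix i assume "i \<in> {..?q}"
    then have i: "i \<le> ?q" by simp
    have "{..Suc n} = {..<i} \<union> {i, Suc i} \<union> Suc ` {i<..n}" if "i \<le> n" for n
    proof -
      have "Suc ` {i<..n} = {Suc i<..Suc n}"
        using image_Suc_atLeastAtMost[of "Suc i" n] by (simp add: atLeastSucAtMost_greaterThanAtMost)
      with that show ?thesis by auto
    qed
    from this[OF i]
    have "(\<Sum>k\<le>Suc ?q. g i k) = (\<Sum>k\<in>{..<i} \<union> {i, Suc i} \<union> Suc ` {i<..?q}. g i k)"
      by simp
    also have "\<dots> = (\<Sum>k<i. g i k) + (\<Sum>k\<in>{i, Suc i}. g i k) + (\<Sum>k\<in>Suc ` {i<..?q}. g i k)"
      by (subst sum.union_disjoint; (subst sum.union_disjoint)?) auto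
    also have "(\<Sum>k\<in>{i, Suc i}. g i k) = t i + t (Suc i)"
      using i by (simp add: g_def t_def singular_face_prism_middle)
    also have "(\<Sum>k\<in>Suc ` {i<..?q}. g i k) = (\<Sum>k\<in>{i<..?q}. g i (Suc k))"
      by (simp add: sum.reindex)
    finally show "(\<Sum>k\<le>Suc ?q. g i k) = (\<Sum>k<i. g i k) + (t i + t (Suc i)) + (\<Sum>k\<in>{i<..?q}. g i (Suc k))" .
  qed
  also have "\<dots> = (\<Sum>i\<le>?q. \<Sum>k<i. f (i - 1) k) + (t 0 + t (Suc ?q)) + (\<Sum>i\<le>?q. \<Sum>k\<in>{i<..?q}. f i k)"
    unfolding sum.distrib[of _ _ "{..?q}"] sum_bit_telescope[symmetric]
    by (intro arg_cong2[where f = "(+)"] sum.cong refl)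
       (simp_all add: g_def f_def singular_face_prism_low singular_face_prism_high)
  also have "(\<Sum>i\<le>?q. \<Sum>k<i. f (i - 1) k) = (\<Sum>i\<le>p. \<Sum>k\<le>i. f i k)"
    by (simp add: sum.atMost_Suc_shift lessThan_Suc_atMost del: sum.atMost_Suc)
  also have "(\<Sum>i\<le>?q. \<Sum>k\<in>{i<..?q}. f i k) = (\<Sum>i\<le>p. \<Sum>k\<in>{i<..?q}. f i k)"
    by simp
  finally have "t 0 + t (Suc ?q) = (\<Sum>i\<le>p. \<Sum>k\<le>i. f i k) + (\<Sum>i\<le>p. \<Sum>k\<in>{i<..?q}. f i k)"
    by (metis (no_types, lifting) add.assoc add.commute bit_add_eq_0_iff)
  also have "\<dots> = (\<Sum>i\<le>p. \<Sum>k\<le>?q. f i k)"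
    unfolding sum.distrib[symmetric]
  proof (rule sum.cong[OF refl])
    fix i assume "i \<in> {..p}"
    then have "{..?q} = {..i} \<union> {i<..?q}" by auto
    then have "(\<Sum>k\<le>?q. f i k) = (\<Sum>k\<in>{..i} \<union> {i<..?q}. f i k)" by (simp only:)
    also have "\<dots> = (\<Sum>k\<le>i. f i k) + (\<Sum>k\<in>{i<..?q}. f i k)"
      by (rule sum.union_disjoint) auto
    finally show "(\<Sum>k\<le>i. f i k) + (\<Sum>k\<in>{i<..?q}. f i k) = (\<Sum>k\<le>?q. f i k)" ..
  qed
  also have "\<dots> = coboundary p X (prism_pullback p X H a) \<sigma>"
    using \<sigma> by (simp add: coboundary_def prism_pullback_def f_def singular_simplex_face sum.swap[of _ "{..p}"]
        del: sum.atMost_Suc)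
  finally have main: "t 0 + t (Suc ?q) = coboundary p X (prism_pullback p X H a) \<sigma>" .
  have "t 0 = cochain_pullback ?q X (\<lambda>x. H (1, x)) a \<sigma>"
    using \<sigma> by (simp add: t_def tail_weight_def cochain_pullback_def simplex_map_def o_def)
  moreover have "t (Suc ?q) = cochain_pullback ?q X (\<lambda>x. H (0, x)) a \<sigma>"
  proof -
    have "tail_weight (Suc ?q) x = 0" if "x \<in> standard_simplex ?q" for x
      using that by (simp add: tail_weight_def standard_simplex_def lessThan_Suc_atMost del: sum.lessThan_Suc)
    then show ?thesis
      using \<sigma> by (simp add: t_def cochain_pullback_def simplex_map_def o_def cong: restrict_cong)
  qed
  ultimately show "cochain_pullback ?q X (\<lambda>x. H (1, x)) a \<sigma> =
      cochain_pullback ?q X (\<lambda>x. H (0, x)) a \<sigma> + coboundary p X (prism_pullback p X H a) \<sigma>"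
    using main by (metis add.commute bit_add_self_left)
qed

lemma prism_pullback_in_cochains [simp]: "prism_pullback p X H a \<in> cochains p X"
  by (simp add: prism_pullback_def cochains_def)

section \<open>Cocycles that vanish on small simplices\<close>

lemma singular_subdivision_iterate_chain:
  "singular_chain p X c \<Longrightarrow> singular_chain p X ((singular_subdivision p ^^ m) c)"
  by (induction m) (simp_all add: singular_chain_singular_subdivision)

text \<open>With \<open>S\<close> the subdivision operator and \<open>T\<close> a chain homotopy from the identity to \<open>S\<close>, the cochain
  \<open>\<tau> \<mapsto> \<Sum>m. z (S\<^sup>m (T \<tau>))\<close> has coboundary \<open>z\<close>: the sum is finite at every \<open>\<tau>\<close>, as \<open>S\<^sup>m (T \<tau>)\<close> consists of
  small simplices for large \<open>m\<close>, and its coboundary telescopes.\<close>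

lemma vanishing_on_small_simplices_imp_coboundary:
  assumes U: "\<And>U. U \<in> \<U> \<Longrightarrow> openin X U" "topspace X \<subseteq> \<Union>\<U>"
    and z: "z \<in> cocycles (Suc p) X"
    and small: "\<And>U \<sigma>. U \<in> \<U> \<Longrightarrow> \<sigma> \<in> standard_simplex (Suc p) \<rightarrow> U \<Longrightarrow> z \<sigma> = 0"
  shows "z \<in> coboundaries (Suc p) X"
proof -
  obtain T :: "nat \<Rightarrow> 'a chain \<Rightarrow> 'a chain" where T:
        "\<And>p. T p 0 = 0"
        "\<And>p c1 c2. T p (c1-c2) = T p c1 - T p c2"
        "\<And>p X c. singular_chain p X c \<Longrightarrow> singular_chain (Suc p) X (T p c)"
        "\<And>p X c. singular_chain p X c
                 \<Longrightarrow> chain_boundary (Suc p) (T p c) + T (p - Suc 0) (chain_boundary p c) = singular_subdivision p c - c"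
    using chain_homotopic_singular_subdivision by metis
  let ?S = "\<lambda>p m. singular_subdivision p ^^ m"
  define g where "g m \<tau> = cochain_eval z (?S (Suc p) m (T p (frag_of \<tau>)))" for m \<tau>
  define g' where "g' m c = cochain_eval z (?S (Suc p) m (T p c))" for m c
  have eventually_small: "\<exists>n. \<forall>m\<ge>n. cochain_eval z (?S (Suc p) m c) = 0" if c: "singular_chain (Suc p) X c" for c
  proof -
    obtain n where n: "\<And>m f. n \<le> m \<Longrightarrow> f \<in> Poly_Mapping.keys (?S (Suc p) m c)
         \<Longrightarrow> \<exists>V\<in>\<U>. f \<in> standard_simplex (Suc p) \<rightarrow> V"
      using sufficient_iterated_singular_subdivision_exists[OF U c] by metis
    show ?thesis
      by (intro exI[of _ n] allI impI cochain_eval_vanishes) (use n small in blast)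
  qed
  have "\<exists>n. \<forall>m\<ge>n. g m \<tau> = 0" if "singular_simplex p X \<tau>" for \<tau>
    unfolding g_def using that by (intro eventually_small T(3)) (simp add: singular_chain_of)
  then obtain n where n: "\<And>\<tau> m. singular_simplex p X \<tau> \<Longrightarrow> m \<ge> n \<tau> \<Longrightarrow> g m \<tau> = 0"
    by metis
  define b where "b \<tau> = (if singular_simplex p X \<tau> then \<Sum>m<n \<tau>. g m \<tau> else 0)" for \<tau>
  have b_eq: "b \<tau> = (\<Sum>m<N. g m \<tau>)" if "singular_simplex p X \<tau>" "N \<ge> n \<tau>" for \<tau> N
  proof -
    have "\<forall>i\<in>{..<N} - {..<n \<tau>}. g i \<tau> = 0"
      using n[OF that(1)] by (simp add: not_less)
    with that show ?thesis
      unfolding b_def by (simp add: sum.mono_neutral_left)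
  qed
  have S_boundary: "chain_boundary q (?S q m c) = ?S (q - Suc 0) m (chain_boundary q c)"
    if "singular_chain q X c" for q m c
    by (induction m) (simp_all add: that chain_boundary_singular_subdivision[of _ X] singular_subdivision_iterate_chain)
  \<comment> \<open>The relation \<open>\<partial>T + T\<partial> = S - 1\<close>, pushed forward by \<open>S\<^sup>m\<close> and evaluated on the cocycle \<open>z\<close>.\<close>
  have eval_S: "cochain_eval z (?S (Suc p) m (T p (chain_boundary (Suc p) c))) =
      cochain_eval z (?S (Suc p) (Suc m) c) + cochain_eval z (?S (Suc p) m c)"
    if c: "singular_chain (Suc p) X c" for c m
  proof -
    have chain: "singular_chain (Suc (Suc p)) X (T (Suc p) c)" using T(3) c .
    have "T p (chain_boundary (Suc p) c) =
        (singular_subdivision (Suc p) c - c) - chain_boundary (Suc (Suc p)) (T (Suc p) c)"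
      using T(4)[OF c] by (simp add: algebra_simps)
    then have "?S (Suc p) m (T p (chain_boundary (Suc p) c)) =
       (?S (Suc p) (Suc m) c - ?S (Suc p) m c) - chain_boundary (Suc (Suc p)) (?S (Suc (Suc p)) m (T (Suc p) c))"
      using S_boundary[OF chain, of m] by (simp add: singular_subdivision_power_diff funpow_swap1)
    moreover have "cochain_eval z (chain_boundary (Suc (Suc p)) (?S (Suc (Suc p)) m (T (Suc p) c))) = 0"
      using z by (simp add: cochain_eval_boundary[OF singular_subdivision_iterate_chain[OF chain]]
          cocycles_def cochain_eval_vanishes)
    ultimately show ?thesis by (simp add: cochain_eval_diff)
  qed
  have g'_boundary: "g' m (chain_boundary (Suc p) (frag_of \<sigma>)) = (\<Sum>k\<le>Suc p. g m (singular_face (Suc p) k \<sigma>))" for m \<sigma>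
  proof -
    have minus: "T p (- c) = - T p c" "?S (Suc p) m (- c') = - ?S (Suc p) m c'" for c c' :: "'a chain"
      using T(1) T(2)[of p 0 c] singular_subdivision_power_diff[where p = "Suc p" and n = m and a = 0 and b = c']
      by simp_all
    have g'_diff: "g' m (c1 - c2) = g' m c1 + g' m c2" for c1 c2
      by (simp add: g'_def T(2) singular_subdivision_power_diff cochain_eval_diff)
    have g'_minus: "g' m (- c) = g' m c" for c
      by (simp add: g'_def minus cochain_eval_minus)
    have g'_add: "g' m (c1 + c2) = g' m c1 + g' m c2" for c1 c2
      using g'_diff[of c1 "- c2"] g'_minus by simp
    have g'_0: "g' m 0 = 0" by (simp add: g'_def T(1))
    have g'_sum: "g' m (sum F I) = (\<Sum>i\<in>I. g' m (F i))" for F :: "nat \<Rightarrow> _" and I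
      by (induction I rule: infinite_finite_induct) (simp_all add: g'_0 g'_add)
    have "g' m (frag_cmul ((-1) ^ k) c) = g' m c" for k c
      by (cases "even k") (simp_all add: g'_minus)
    then show ?thesis
      by (simp add: chain_boundary_of g'_sum del: sum.atMost_Suc) (simp add: g_def g'_def)
  qed
  have "z = coboundary p X b"
  proof (rule cochains_eqI[of _ "Suc p" X])
    show "z \<in> cochains (Suc p) X" using z by (simp add: cocycles_def)
    show "coboundary p X b \<in> cochains (Suc p) X" by simp
    fix \<sigma> assume \<sigma>: "singular_simplex (Suc p) X \<sigma>"
    then have c: "singular_chain (Suc p) X (frag_of \<sigma>)" by (simp add: singular_chain_of)
    obtain N0 where N0: "\<And>m. m \<ge> N0 \<Longrightarrow> cochain_eval z (?S (Suc p) m (frag_of \<sigma>)) = 0"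
      using eventually_small[OF c] by blast
    define N where "N = N0 + (\<Sum>k\<le>Suc p. n (singular_face (Suc p) k \<sigma>))"
    have N: "N \<ge> n (singular_face (Suc p) k \<sigma>)" if "k \<le> Suc p" for k
      using that member_le_sum[of k "{..Suc p}" "\<lambda>k. n (singular_face (Suc p) k \<sigma>)"]
      by (simp add: N_def del: sum.atMost_Suc)
    have "coboundary p X b \<sigma> = (\<Sum>k\<le>Suc p. \<Sum>m<N. g m (singular_face (Suc p) k \<sigma>))"
      using \<sigma> b_eq[OF singular_simplex_face[OF \<sigma>] N] by (simp add: coboundary_def del: sum.atMost_Suc)
    also have "\<dots> = (\<Sum>m<N. g' m (chain_boundary (Suc p) (frag_of \<sigma>)))"
      unfolding g'_boundary by (rule sum.swap)
    also have "\<dots> = (\<Sum>m<N. cochain_eval z (?S (Suc p) m (frag_of \<sigma>)) + cochain_eval z (?S (Suc p) (Suc m) (frag_of \<sigma>)))"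
      unfolding g'_def eval_S[OF c] by (simp add: add.commute)
    also have "\<dots> = cochain_eval z (?S (Suc p) 0 (frag_of \<sigma>)) + cochain_eval z (?S (Suc p) N (frag_of \<sigma>))"
      by (induction N) (simp_all add: add.assoc)
    also have "\<dots> = z \<sigma>"
      using N0[of N] by (simp add: N_def)
    finally show "z \<sigma> = coboundary p X b \<sigma>" by simp
  qed
  moreover have "b \<in> cochains p X" by (simp add: b_def cochains_def)
  ultimately show ?thesis by (auto simp: coboundaries_Suc)
qed

section \<open>The cohomology groups\<close>

lemma carrier_cocycle_group [simp]: "carrier (cocycle_group p X) = cocycles p X"
  and mult_cocycle_group: "a \<otimes>\<^bsub>cocycle_group p X\<^esub> b = (\<lambda>\<sigma>. a \<sigma> + b \<sigma>)"
  and one_cocycle_group: "\<one>\<^bsub>cocycle_group p X\<^esub> = (\<lambda>\<sigma>. 0)"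
  by (simp_all add: cocycle_group_def)

lemma comm_group_cocycle_group: "comm_group (cocycle_group p X)"
proof (rule comm_groupI)
  show "\<exists>b\<in>carrier (cocycle_group p X). b \<otimes>\<^bsub>cocycle_group p X\<^esub> a = \<one>\<^bsub>cocycle_group p X\<^esub>"
    if "a \<in> carrier (cocycle_group p X)" for a
    using that by (intro bexI[of _ a]) (simp_all add: mult_cocycle_group one_cocycle_group)
qed (simp_all add: mult_cocycle_group one_cocycle_group add_in_cocycles ac_simps)

lemma inv_cocycle_group: "a \<in> cocycles p X \<Longrightarrow> inv\<^bsub>cocycle_group p X\<^esub> a = a"
  by (intro group.inv_equality comm_group.axioms(2) comm_group_cocycle_group)
     (simp_all add: mult_cocycle_group one_cocycle_group)

lemma subgroup_coboundaries: "subgroup (coboundaries p X) (cocycle_group p X)"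
proof (rule group.subgroupI)
  show "group (cocycle_group p X)" by (intro comm_group.axioms(2) comm_group_cocycle_group)
  show "coboundaries p X \<noteq> {}" by (metis zero_in_coboundaries empty_iff)
qed (auto simp: inv_cocycle_group mult_cocycle_group coboundaries_imp_cocycles add_in_coboundaries)

lemma normal_coboundaries: "coboundaries p X \<lhd> cocycle_group p X"
  by (intro comm_group.subgroup_imp_normal comm_group_cocycle_group subgroup_coboundaries)

lemma comm_group_cohomology_group: "comm_group (cohomology_group p X)"
  unfolding cohomology_group_def
  by (intro comm_group.abelian_FactGroup comm_group_cocycle_group subgroup_coboundaries)

lemma mem_cohomology_class:
  "b \<in> cohomology_class p X a \<longleftrightarrow> (\<exists>c\<in>coboundaries p X. b = (\<lambda>\<sigma>. c \<sigma> + a \<sigma>))"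
  by (auto simp: cohomology_class_def r_coset_def mult_cocycle_group)

lemma cohomology_class_eq_iff:
  assumes "a \<in> cocycles p X" "b \<in> cocycles p X"
  shows "cohomology_class p X a = cohomology_class p X b \<longleftrightarrow> (\<lambda>\<sigma>. a \<sigma> + b \<sigma>) \<in> coboundaries p X"
proof
  assume "cohomology_class p X a = cohomology_class p X b"
  moreover have "a \<in> cohomology_class p X a"
    unfolding mem_cohomology_class by (intro bexI[of _ "\<lambda>\<sigma>. 0"]) simp_all
  ultimately obtain c where "c \<in> coboundaries p X" "a = (\<lambda>\<sigma>. c \<sigma> + b \<sigma>)"
    by (auto simp: mem_cohomology_class)
  then show "(\<lambda>\<sigma>. a \<sigma> + b \<sigma>) \<in> coboundaries p X" by (simp add: add.assoc)
next
  have sub: "cohomology_class p X a \<subseteq> cohomology_class p X b"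
    if "(\<lambda>\<sigma>. a \<sigma> + b \<sigma>) \<in> coboundaries p X" for a b
  proof
    fix e assume "e \<in> cohomology_class p X a"
    then obtain c where c: "c \<in> coboundaries p X" "e = (\<lambda>\<sigma>. c \<sigma> + a \<sigma>)"
      by (auto simp: mem_cohomology_class)
    from c(1) that have "(\<lambda>\<sigma>. c \<sigma> + (a \<sigma> + b \<sigma>)) \<in> coboundaries p X"
      by (rule add_in_coboundaries)
    with c show "e \<in> cohomology_class p X b"
      unfolding mem_cohomology_class
      by (intro bexI[of _ "\<lambda>\<sigma>. c \<sigma> + (a \<sigma> + b \<sigma>)"]) (auto simp: ac_simps)
  qed
  assume "(\<lambda>\<sigma>. a \<sigma> + b \<sigma>) \<in> coboundaries p X"
  with sub[of a b] sub[of b a] show "cohomology_class p X a = cohomology_class p X b"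
    by (simp add: add.commute)
qed

lemma one_cohomology_group: "\<one>\<^bsub>cohomology_group p X\<^esub> = cohomology_class p X (\<lambda>\<sigma>. 0)"
  by (auto simp: cohomology_group_def FactGroup_def mem_cohomology_class)

lemma cohomology_class_eq_one_iff:
  "a \<in> cocycles p X \<Longrightarrow> cohomology_class p X a = \<one>\<^bsub>cohomology_group p X\<^esub> \<longleftrightarrow> a \<in> coboundaries p X"
  by (simp add: one_cohomology_group cohomology_class_eq_iff)

lemma carrier_cohomology_group: "carrier (cohomology_group p X) = cohomology_class p X ` cocycles p X"
  by (auto simp: cohomology_group_def FactGroup_def RCOSETS_def cohomology_class_def)

lemma mult_cohomology_class:
  "a \<in> cocycles p X \<Longrightarrow> b \<in> cocycles p X \<Longrightarrow>
     cohomology_class p X a \<otimes>\<^bsub>cohomology_group p X\<^esub> cohomology_class p X b =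
     cohomology_class p X (\<lambda>\<sigma>. a \<sigma> + b \<sigma>)"
  using normal.rcos_sum[OF normal_coboundaries, of a p X b]
  by (simp add: cohomology_group_def FactGroup_def cohomology_class_def mult_cocycle_group)

lemma finprod_cohomology_class:
  assumes "finite I" "\<And>i. i \<in> I \<Longrightarrow> a i \<in> cocycles p X"
  shows "finprod (cohomology_group p X) (\<lambda>i. cohomology_class p X (a i)) I =
         cohomology_class p X (\<lambda>\<sigma>. \<Sum>i\<in>I. a i \<sigma>)"
  using assms
proof (induction I rule: finite_induct)
  case empty
  interpret comm_group "cohomology_group p X" by (rule comm_group_cohomology_group)
  show ?case by (simp add: one_cohomology_group)
next
  case (insert i I)
  interpret comm_group "cohomology_group p X" by (rule comm_group_cohomology_group)
  from insert show ?case
    by (subst finprod_insert) (auto simp: carrier_cohomology_group mult_cohomology_class sum_in_cocycles)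
qed

lemma cohomology_class_self: "a \<in> cohomology_class p X a"
  unfolding mem_cohomology_class by (intro bexI[of _ "\<lambda>\<sigma>. 0"]) simp_all

lemma representative_in_cocycles:
  "a \<in> cocycles p X \<Longrightarrow> b \<in> cohomology_class p X a \<Longrightarrow> b \<in> cocycles p X"
  by (auto simp: mem_cohomology_class add_in_cocycles coboundaries_imp_cocycles)

lemma pullback_cohomology_class:
  assumes f: "continuous_map X Y f" and a: "a \<in> cocycles p Y"
  shows "pullback_class p X f (cohomology_class p Y a) = cohomology_class p X (cochain_pullback p X f a)"
proof -
  have "cohomology_class p X (cochain_pullback p X f b) = cohomology_class p X (cochain_pullback p X f a)"
    if "b \<in> cohomology_class p Y a" for b
  proof -
    from that obtain c where c: "c \<in> coboundaries p Y" "b = (\<lambda>\<sigma>. c \<sigma> + a \<sigma>)"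
      by (auto simp: mem_cohomology_class)
    have "cochain_pullback p X f b \<in> cocycles p X"
      using pullback_in_cocycles[OF f representative_in_cocycles[OF a that]] .
    moreover have "cochain_pullback p X f b \<sigma> + cochain_pullback p X f a \<sigma> = cochain_pullback p X f c \<sigma>" for \<sigma>
      unfolding c(2) pullback_add by (simp add: add.assoc)
    ultimately show ?thesis
      by (subst cohomology_class_eq_iff) (simp_all add: pullback_in_cocycles[OF f] a pullback_in_coboundaries[OF f] c)
  qed
  with cohomology_class_self[of a p Y] show ?thesis
    unfolding pullback_class_def by blast
qed

lemma cup_cohomology_class:
  assumes a: "a \<in> cocycles p X" and b: "b \<in> cocycles q X"
  shows "cup_class p q X (cohomology_class p X a) (cohomology_class q X b) =
         cohomology_class (p + q) X (cochain_cup p q X a b)"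
proof -
  have "cohomology_class (p + q) X (cochain_cup p q X a' b') = cohomology_class (p + q) X (cochain_cup p q X a b)"
    if a': "a' \<in> cohomology_class p X a" and b': "b' \<in> cohomology_class q X b" for a' b'
  proof -
    from a' obtain c where c: "c \<in> coboundaries p X" "a' = (\<lambda>\<sigma>. c \<sigma> + a \<sigma>)"
      by (auto simp: mem_cohomology_class)
    from b' obtain e where e: "e \<in> coboundaries q X" "b' = (\<lambda>\<sigma>. e \<sigma> + b \<sigma>)"
      by (auto simp: mem_cohomology_class)
    have z: "a' \<in> cocycles p X" "b' \<in> cocycles q X"
      using representative_in_cocycles a b a' b' by blast+
    have "(\<lambda>\<sigma>. cochain_cup p q X c b' \<sigma> + cochain_cup p q X a e \<sigma>) \<in> coboundaries (p + q) X"
      by (intro add_in_coboundaries cup_in_coboundaries_left cup_in_coboundaries_right c e a z)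
    moreover have "cochain_cup p q X a' b' \<sigma> + cochain_cup p q X a b \<sigma> =
        cochain_cup p q X c b' \<sigma> + cochain_cup p q X a e \<sigma>" for \<sigma>
      unfolding c(2) cup_add_left unfolding e(2) cup_add_right by (simp add: algebra_simps)
    ultimately show ?thesis
      by (subst cohomology_class_eq_iff) (simp_all add: cup_in_cocycles a b z)
  qed
  with cohomology_class_self[of a p X] cohomology_class_self[of b q X] show ?thesis
    unfolding cup_class_def by blast
qed

lemma unit_class_eq: "unit_class X = cohomology_class 0 X (unit_cochain X)"
  by (simp add: unit_class_def unit_cochain_def)

lemma cup_power_cohomology_class:
  assumes "\<And>i. i < k \<Longrightarrow> x i \<in> cocycles 1 X" "\<And>i. i < k \<Longrightarrow> cohomology_class 1 X (x i) = \<alpha>"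
  shows "cup_power X \<alpha> k = cohomology_class k X (cup_prod X x k)"
  using assms
proof (induction k)
  case (Suc k)
  then have "cup_power X \<alpha> (Suc k) = cup_class k 1 X (cohomology_class k X (cup_prod X x k)) (cohomology_class 1 X (x k))"
    by simp
  also have "\<dots> = cohomology_class (k + 1) X (cochain_cup k 1 X (cup_prod X x k) (x k))"
    by (intro cup_cohomology_class cup_prod_in_cocycles) (use Suc.prems in auto)
  finally show ?case by simp
qed (simp add: unit_class_eq)

section \<open>Descent along double coverings\<close>

text \<open>Exactness in the complex of \<open>\<tau>\<close>-invariant cochains, which stand for the cochains of the quotient
  \<open>Y/\<tau>\<close>.\<close>

definition equivariantly_exact ::
  "nat \<Rightarrow> 'a topology \<Rightarrow> ('a \<Rightarrow> 'a) \<Rightarrow> 'a cochain \<Rightarrow> bool" where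
  "equivariantly_exact p Y \<tau> a \<longleftrightarrow>
     (\<exists>b\<in>cochains p Y. cochain_pullback p Y \<tau> b = b \<and> a = coboundary p Y b)"

text \<open>A choice of one sheet of \<open>Y \<rightarrow> Y/\<tau>\<close> over every point, without any continuity; \<open>\<delta> s\<close> measures how paths change
  sheets.\<close>

definition odd_function :: "'a topology \<Rightarrow> ('a \<Rightarrow> 'a) \<Rightarrow> ('a \<Rightarrow> bit) \<Rightarrow> bool" where
  "odd_function Y \<tau> s \<longleftrightarrow> (\<forall>y\<in>topspace Y. s (\<tau> y) = s y + 1)"

lemma point_cochain_in_cochains [simp]: "point_cochain X s \<in> cochains 0 X"
  by (simp add: cochains_def point_cochain_def)

abbreviation char_cocycle :: "'a topology \<Rightarrow> ('a \<Rightarrow> bit) \<Rightarrow> 'a cochain" where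
  "char_cocycle X s \<equiv> coboundary 0 X (point_cochain X s)"

lemma singular_simplex_in_topspace:
  "singular_simplex p X \<sigma> \<Longrightarrow> x \<in> standard_simplex p \<Longrightarrow> \<sigma> x \<in> topspace X"
  by (auto simp: singular_simplex_def continuous_map_def)

lemma vertex_in_standard_simplex_0: "(\<lambda>i. if i = 0 then 1 else 0) \<in> standard_simplex 0"
  by simp

lemma pullback_point_cochain:
  assumes "continuous_map X Y f"
  shows "cochain_pullback 0 X f (point_cochain Y s) = point_cochain X (s \<circ> f)"
  using assms
  by (auto simp: cochain_pullback_def point_cochain_def fun_eq_iff simplex_map_def singular_simplex_simplex_map[unfolded simplex_map_def])

lemma pullback_point_cochain_odd:
  assumes "continuous_map Y Y \<tau>" "odd_function Y \<tau> s"
  shows "cochain_pullback 0 Y \<tau> (point_cochain Y s) = (\<lambda>\<sigma>. point_cochain Y s \<sigma> + unit_cochain Y \<sigma>)"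
  using assms(2) singular_simplex_in_topspace[of 0 Y] vertex_in_standard_simplex_0
  unfolding pullback_point_cochain[OF assms(1)]
  by (auto simp: odd_function_def point_cochain_def unit_cochain_def fun_eq_iff)

definition path_start :: "nat \<Rightarrow> real" where
  "path_start = simplical_face 1 (\<lambda>i. if i = 0 then 1 else 0)"

definition path_end :: "nat \<Rightarrow> real" where
  "path_end = simplical_face 0 (\<lambda>i. if i = 0 then 1 else 0)"

lemma path_ends_in: "path_start \<in> standard_simplex 1" "path_end \<in> standard_simplex 1"
  by (simp_all add: path_start_def path_end_def simplical_face_in_standard_simplex)

lemma char_cocycle_path:
  assumes \<sigma>: "singular_simplex 1 X \<sigma>"
  shows "char_cocycle X s \<sigma> = s (\<sigma> path_end) + s (\<sigma> path_start)"
proof -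
  have "point_cochain X s (singular_face 1 k \<sigma>) = s (\<sigma> (simplical_face k (\<lambda>i. if i = 0 then 1 else 0)))"
    if "k \<le> 1" for k
    using singular_simplex_face[of 0 X \<sigma> k] \<sigma> that by (simp add: point_cochain_def singular_face_def)
  then show ?thesis using \<sigma> by (simp add: coboundary_def path_start_def path_end_def)
qed

text \<open>The key step. Let \<open>x = \<delta> s\<close> be the characteristic cocycle of the double covering \<open>Y \<rightarrow> Y/\<tau>\<close>. An invariant
  cocycle \<open>y\<close> with \<open>y \<union> x = \<delta> b\<close>, \<open>b\<close> invariant, is the transfer \<open>z + \<tau>\<^sup>* z\<close> of the cocycle \<open>z = y \<union> s + b\<close>; this is the
  exactness of the Gysin sequence of the covering, on the level of cochains. If the inclusion \<open>j\<close> of another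
  such space is homotopic to a \<open>\<tau>\<close>-invariant map \<open>c\<close>, the restriction of \<open>z\<close> is cohomologous to the invariant
  cocycle \<open>c\<^sup>* z\<close>, whose transfer is \<open>2 c\<^sup>* z = 0\<close>.\<close>

lemma gysin_descent:
  fixes Y :: "'a topology" and Y' :: "'b topology" and H :: "real \<times> 'b \<Rightarrow> 'a"
  assumes \<tau>: "continuous_map Y Y \<tau>" and \<tau>': "continuous_map Y' Y' \<tau>'"
    and invol': "\<And>y. y \<in> topspace Y' \<Longrightarrow> \<tau>' (\<tau>' y) = y"
    and H: "continuous_map (prod_topology (top_of_set {0..1}) Y') Y H"
    and j: "\<And>y. y \<in> topspace Y' \<Longrightarrow> H (1, \<tau>' y) = \<tau> (H (1, y))"
    and c: "\<And>y. y \<in> topspace Y' \<Longrightarrow> H (0, \<tau>' y) = H (0, y)"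
    and s: "odd_function Y \<tau> s"
    and y: "y \<in> cocycles (Suc p) Y" "cochain_pullback (Suc p) Y \<tau> y = y"
    and exact: "equivariantly_exact (Suc p) Y \<tau> (cochain_cup (Suc p) 1 Y y (char_cocycle Y s))"
  shows "equivariantly_exact p Y' \<tau>' (cochain_pullback (Suc p) Y' (\<lambda>y. H (1, y)) y)"
proof -
  have H1: "continuous_map Y' Y (\<lambda>y. H (1, y))" and H0: "continuous_map Y' Y (\<lambda>y. H (0, y))"
  proof -
    have "continuous_map Y' Y (H \<circ> (\<lambda>y. (t, y)))" if "t \<in> {0..1::real}" for t
      using that by (intro continuous_map_compose[OF _ H] continuous_map_pairedI) auto
    from this[of 1] this[of 0] show "continuous_map Y' Y (\<lambda>y. H (1, y))" "continuous_map Y' Y (\<lambda>y. H (0, y))"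
      by (simp_all add: o_def)
  qed
  let ?S = "point_cochain Y s"
  obtain b where b: "b \<in> cochains (Suc p) Y" "cochain_pullback (Suc p) Y \<tau> b = b"
      "cochain_cup (Suc p) 1 Y y (coboundary 0 Y ?S) = coboundary (Suc p) Y b"
    using exact by (auto simp: equivariantly_exact_def)
  define z where "z = (\<lambda>\<sigma>. cochain_cup (Suc p) 0 Y y ?S \<sigma> + b \<sigma>)"
  have "coboundary (Suc p) Y z = (\<lambda>\<sigma>. 0)"
    using cup_coboundary_right[OF y(1), of 0 ?S] b(3) by (simp add: z_def coboundary_add)
  moreover have "z \<in> cochains (Suc p) Y"
    unfolding z_def by (intro add_in_cochains b) simp
  ultimately have z: "z \<in> cocycles (Suc p) Y" by (simp add: cocycles_def)
  have "cochain_pullback (Suc p) Y \<tau> (cochain_cup (Suc p) 0 Y y ?S) =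
      (\<lambda>\<sigma>. cochain_cup (Suc p) 0 Y y ?S \<sigma> + y \<sigma>)"
    using pullback_cup[OF \<tau>, of "Suc p" 0 y ?S]
    by (simp add: y(2) pullback_point_cochain_odd[OF \<tau> s] cup_add_right cup_unit_right cocycles_imp_cochains[OF y(1)])
  then have transfer: "y = (\<lambda>\<sigma>. z \<sigma> + cochain_pullback (Suc p) Y \<tau> z \<sigma>)"
    unfolding z_def pullback_add b(2) by (simp add: fun_eq_iff algebra_simps)
  define K where "K = prism_pullback p Y' H z"
  let ?j = "cochain_pullback (Suc p) Y' (\<lambda>y. H (1, y))" and ?c = "cochain_pullback (Suc p) Y' (\<lambda>y. H (0, y))"
  have jz: "?j z = (\<lambda>\<sigma>. ?c z \<sigma> + coboundary p Y' K \<sigma>)"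
    unfolding K_def by (rule prism_homotopy[OF H z])
  have "?j (cochain_pullback (Suc p) Y \<tau> z) = cochain_pullback (Suc p) Y' \<tau>' (?j z)"
    unfolding pullback_pullback[OF H1] pullback_pullback[OF \<tau>'] by (rule pullback_cong) (simp add: j)
  also have "\<dots> = (\<lambda>\<sigma>. ?c z \<sigma> + coboundary p Y' (cochain_pullback p Y' \<tau>' K) \<sigma>)"
  proof -
    have "cochain_pullback (Suc p) Y' \<tau>' (?c z) = ?c z"
      unfolding pullback_pullback[OF \<tau>'] by (rule pullback_cong) (simp add: c)
    then show ?thesis
      unfolding jz pullback_add by (simp add: pullback_coboundary[OF \<tau>'])
  qed
  finally have "?j y = coboundary p Y' (\<lambda>\<sigma>. K \<sigma> + cochain_pullback p Y' \<tau>' K \<sigma>)"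
    by (subst transfer) (simp add: pullback_add jz coboundary_add fun_eq_iff algebra_simps)
  moreover have "cochain_pullback p Y' \<tau>' (cochain_pullback p Y' \<tau>' K) = K"
    unfolding pullback_pullback[OF \<tau>'] by (rule pullback_id) (simp_all add: K_def invol')
  ultimately show ?thesis
    unfolding equivariantly_exact_def
    by (intro bexI[of _ "\<lambda>\<sigma>. K \<sigma> + cochain_pullback p Y' \<tau>' K \<sigma>"])
       (simp_all add: pullback_add add.commute add_in_cochains K_def)
qed


section \<open>Products with spheres\<close>

definition sphere_product :: "nat \<Rightarrow> 'b topology \<Rightarrow> ('b \<times> (nat \<Rightarrow> real)) topology" where
  "sphere_product n B = prod_topology B (nsphere n)"

definition antipode :: "'b \<times> (nat \<Rightarrow> real) \<Rightarrow> 'b \<times> (nat \<Rightarrow> real)" where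
  "antipode y = (fst y, \<lambda>i. - snd y i)"

lemma antipode_antipode [simp]: "antipode (antipode y) = y"
  by (simp add: antipode_def)

lemma topspace_nsphere: "topspace (nsphere n) = {x. (\<Sum>i\<le>n. x i ^ 2) = 1 \<and> (\<forall>i>n. x i = 0)}"
  by (simp add: nsphere)

lemma continuous_map_into_nsphere:
  "continuous_map X (nsphere n) f \<longleftrightarrow>
     (\<forall>i. continuous_map X euclideanreal (\<lambda>x. f x i)) \<and> f \<in> topspace X \<rightarrow> topspace (nsphere n)"
  by (auto simp: nsphere continuous_map_in_subtopology continuous_map_componentwise_UNIV)

lemma continuous_map_sphere_product_coordinate:
  "continuous_map (sphere_product n B) euclideanreal (\<lambda>y. snd y i)"
  using continuous_map_compose[OF continuous_map_snd continuous_map_nsphere_projection[of n i], of B]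
  by (simp add: sphere_product_def o_def)

lemma continuous_map_sphere_product_fst: "continuous_map (sphere_product n B) B fst"
  by (simp add: sphere_product_def continuous_map_fst)

lemma continuous_map_antipode: "continuous_map (sphere_product n B) (sphere_product n B) antipode"
proof -
  have "continuous_map (sphere_product n B) (nsphere n) (\<lambda>y i. - snd y i)"
    unfolding continuous_map_into_nsphere
    by (intro conjI allI continuous_map_minus continuous_map_sphere_product_coordinate)
       (auto simp: sphere_product_def topspace_nsphere)
  then have "continuous_map (sphere_product n B) (prod_topology B (nsphere n)) (\<lambda>y. (fst y, \<lambda>i. - snd y i))"
    by (intro continuous_map_pairedI continuous_map_sphere_product_fst)
  then show ?thesis
    by (simp add: sphere_product_def antipode_def[abs_def])
qed

text \<open>The homotopy lifts the scaled equator point \<open>t v\<close> to the upper hemisphere, so that it ends at the equator for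
  \<open>t = 1\<close> and at the pole for \<open>t = 0\<close>.\<close>

definition hemisphere :: "nat \<Rightarrow> real \<times> 'b \<times> (nat \<Rightarrow> real) \<Rightarrow> 'b \<times> (nat \<Rightarrow> real)" where
  "hemisphere n = (\<lambda>(t, p, v). (p, \<lambda>i. if i = Suc n then sqrt (1 - t ^ 2) else t * v i))"

lemma hemisphere_equator_antipode: "hemisphere n (1, antipode y) = antipode (hemisphere n (1, y))"
  by (auto simp: hemisphere_def antipode_def fun_eq_iff case_prod_beta')

lemma hemisphere_pole_antipode: "hemisphere n (0, antipode y) = hemisphere n (0, y)"
  by (auto simp: hemisphere_def antipode_def fun_eq_iff case_prod_beta')

lemma continuous_map_hemisphere:
  "continuous_map (prod_topology (top_of_set {0..1}) (sphere_product n B)) (sphere_product (Suc n) B) (hemisphere n)"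
proof -
  let ?X = "prod_topology (top_of_set {0..1::real}) (sphere_product n B)"
  have t: "continuous_map ?X euclideanreal fst"
    using continuous_map_fst[of "top_of_set {0..1::real}" "sphere_product n B"]
    by (simp add: continuous_map_in_subtopology)
  have v: "continuous_map ?X euclideanreal (\<lambda>y. snd (snd y) i)" for i
    using continuous_map_compose[OF continuous_map_snd continuous_map_sphere_product_coordinate[of n B i]]
    by (simp add: o_def)
  have "continuous_map ?X euclideanreal (\<lambda>y. if i = Suc n then sqrt (1 - fst y ^ 2) else fst y * snd (snd y) i)" for i
    by (cases "i = Suc n") (auto intro!: continuous_map_real_mult continuous_map_sqrt continuous_map_diff continuous_map_real_pow t v)
  moreover have "(\<Sum>i\<le>n. (if i = Suc n then sqrt (1 - t ^ 2) else t * v i) ^ 2) + sqrt (1 - t ^ 2) ^ 2 = 1"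
    if "0 \<le> t" "t \<le> 1" "(\<Sum>i\<le>n. v i ^ 2) = 1" for t and v :: "nat \<Rightarrow> real"
  proof -
    have "(\<Sum>i\<le>n. (if i = Suc n then sqrt (1 - t ^ 2) else t * v i) ^ 2) = (\<Sum>i\<le>n. t ^ 2 * v i ^ 2)"
      by (rule sum.cong) (auto simp: power_mult_distrib)
    also have "\<dots> = t ^ 2" using that by (simp flip: sum_distrib_left)
    finally show ?thesis using that by (simp add: power_le_one)
  qed
  ultimately have "continuous_map ?X (nsphere (Suc n)) (\<lambda>y i. if i = Suc n then sqrt (1 - fst y ^ 2) else fst y * snd (snd y) i)"
    unfolding continuous_map_into_nsphere by (auto simp: sphere_product_def topspace_nsphere)
  moreover have "continuous_map ?X B (\<lambda>y. fst (snd y))"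
    using continuous_map_compose[OF continuous_map_snd continuous_map_sphere_product_fst[of n B]]
    by (simp add: o_def)
  ultimately have "continuous_map ?X (prod_topology B (nsphere (Suc n)))
      (\<lambda>y. (fst (snd y), \<lambda>i. if i = Suc n then sqrt (1 - fst y ^ 2) else fst y * snd (snd y) i))"
    by (rule continuous_map_pairedI[rotated])
  then show ?thesis
    by (simp add: sphere_product_def[of "Suc n"] hemisphere_def case_prod_beta')
qed

lemma continuous_map_section:
  "continuous_map B (sphere_product n B) (\<lambda>p. (p, \<lambda>i. if i = 0 then 1 else 0))"
  unfolding sphere_product_def
  by (intro continuous_map_pairedI) (simp_all add: in_topspace_nsphere)

text \<open>The sum of \<open>a\<^sub>i x\<^sup>m\<^sup>-\<^sup>i\<close> over \<open>i \<ge> 1\<close>, where \<open>x = \<delta> s\<close>; the leading term \<open>x\<^sup>m\<close> is treated separately.\<close>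

definition sphere_relation_cochain ::
  "nat \<Rightarrow> 'b topology \<Rightarrow> ('b \<times> (nat \<Rightarrow> real) \<Rightarrow> bit) \<Rightarrow> (nat \<Rightarrow> 'b cochain) \<Rightarrow> nat \<Rightarrow> ('b \<times> (nat \<Rightarrow> real)) cochain" where
  "sphere_relation_cochain n B s a m =
     (\<lambda>\<sigma>. \<Sum>i=1..m. cochain_cup i (m - i) (sphere_product n B) (cochain_pullback i (sphere_product n B) fst (a i))
        (cup_prod (sphere_product n B) (\<lambda>_. char_cocycle (sphere_product n B) s) (m - i)) \<sigma>)"

lemma cup_prod_coboundary_in_coboundaries:
  assumes "\<And>i. x i \<in> cocycles 1 X" "x k \<in> coboundaries 1 X"
  shows "cup_prod X x (Suc k) \<in> coboundaries (Suc k) X"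
  using cup_in_coboundaries_right[of "cup_prod X x k" k X "x k" 1] cup_prod_in_cocycles[of k x X] assms by simp

lemma pullback_relation_cochain:
  assumes g: "continuous_map X (sphere_product n B) g"
  shows "cochain_pullback m X g (sphere_relation_cochain n B s a m) =
    (\<lambda>\<sigma>. \<Sum>i=1..m. cochain_cup i (m - i) X (cochain_pullback i X (fst \<circ> g) (a i))
        (cup_prod X (\<lambda>_. char_cocycle X (s \<circ> g)) (m - i)) \<sigma>)"
proof -
  let ?Y = "sphere_product n B"
  have "cochain_pullback m X g (cochain_cup i (m - i) ?Y (cochain_pullback i ?Y fst (a i))
        (cup_prod ?Y (\<lambda>_. char_cocycle ?Y s) (m - i))) =
      cochain_cup i (m - i) X (cochain_pullback i X (fst \<circ> g) (a i))
        (cup_prod X (\<lambda>_. char_cocycle X (s \<circ> g)) (m - i))" if "i \<in> {1..m}" for i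
    using that pullback_cup[OF g, of i "m - i"] pullback_coboundary[OF g, of 0]
    by (simp add: pullback_pullback[OF g] pullback_cup_prod[OF g] pullback_point_cochain[OF g])
  then show ?thesis
    unfolding sphere_relation_cochain_def pullback_sum by (intro ext sum.cong refl) simp
qed

lemma sphere_relation_in_cocycles:
  assumes "\<And>i. i \<in> {1..m} \<Longrightarrow> a i \<in> cocycles i B"
  shows "sphere_relation_cochain n B s a m \<in> cocycles m (sphere_product n B)"
proof -
  have "cochain_cup i (m - i) (sphere_product n B) (cochain_pullback i (sphere_product n B) fst (a i))
        (cup_prod (sphere_product n B) (\<lambda>_. char_cocycle (sphere_product n B) s) (m - i))
      \<in> cocycles (i + (m - i)) (sphere_product n B)" if "i \<in> {1..m}" for i
    using that assms
    by (intro cup_in_cocycles pullback_in_cocycles[OF continuous_map_sphere_product_fst] cup_prod_in_cocycles)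
       (simp_all add: One_nat_def[symmetric] del: One_nat_def coboundary_in_cocycles, use coboundary_in_cocycles[of 0] in simp_all)
  then show ?thesis
    unfolding sphere_relation_cochain_def by (intro sum_in_cocycles) simp
qed

text \<open>On a section of \<open>B \<times> S\<^sup>n\<close> the cocycle \<open>\<delta> s\<close> is a coboundary, and so is every term that contains it; only the
  coefficient of \<open>x\<^sup>0\<close> remains.\<close>

lemma section_kills:
  assumes a: "\<And>i. i \<in> {1..Suc n} \<Longrightarrow> a i \<in> cocycles i B"
    and z: "sphere_relation_cochain n B s a (Suc m) \<in> coboundaries (Suc m) (sphere_product n B)"
    and m: "m \<le> n"
  shows "a (Suc m) \<in> coboundaries (Suc m) B"
proof -
  let ?g = "\<lambda>p. (p, \<lambda>i::nat. if i = 0 then 1 else (0::real))"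
  let ?x = "char_cocycle B (s \<circ> ?g)"
  let ?t = "\<lambda>i. cochain_cup i (Suc m - i) B (a i) (cup_prod B (\<lambda>_. ?x) (Suc m - i))"
  note g = continuous_map_section[of B n]
  have x: "?x \<in> coboundaries 1 B" "?x \<in> cocycles 1 B"
    using coboundary_in_cocycles[of 0 B] by (auto simp: coboundaries_Suc[of _ 0, simplified])
  have id: "cochain_pullback i B (fst \<circ> ?g) (a i) = a i" if "i \<in> {1..Suc m}" for i
    using a[of i] that m by (intro pullback_id) (auto intro: cocycles_imp_cochains)
  have "cochain_pullback (Suc m) B ?g (sphere_relation_cochain n B s a (Suc m)) = (\<lambda>\<sigma>. \<Sum>i=1..Suc m. ?t i \<sigma>)"
    unfolding pullback_relation_cochain[OF g] by (intro ext sum.cong refl) (simp only: id)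
  with pullback_in_coboundaries[OF g z] have "(\<lambda>\<sigma>. \<Sum>i=1..Suc m. ?t i \<sigma>) \<in> coboundaries (Suc m) B"
    by (simp only:)
  moreover have "(\<lambda>\<sigma>. \<Sum>i=1..m. ?t i \<sigma>) \<in> coboundaries (Suc m) B"
  proof (rule sum_in_coboundaries)
    fix i assume i: "i \<in> {1..m}"
    then have "Suc m - i = Suc (m - i)" by auto
    moreover have "cup_prod B (\<lambda>_. ?x) (Suc (m - i)) \<in> coboundaries (Suc (m - i)) B"
      using x by (intro cup_prod_coboundary_in_coboundaries) auto
    ultimately have "?t i \<in> coboundaries (i + (Suc m - i)) B"
      using i a[of i] m by (intro cup_in_coboundaries_right) auto
    with i show "?t i \<in> coboundaries (Suc m) B" by simp
  qed simp
  ultimately have "(\<lambda>\<sigma>. (\<Sum>i=1..Suc m. ?t i \<sigma>) + (\<Sum>i=1..m. ?t i \<sigma>)) \<in> coboundaries (Suc m) B"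
    by (rule add_in_coboundaries)
  moreover have "(\<Sum>i=1..Suc m. ?t i \<sigma>) + (\<Sum>i=1..m. ?t i \<sigma>) = a (Suc m) \<sigma>" for \<sigma>
  proof -
    have "?t (Suc m) = a (Suc m)"
      using a[of "Suc m"] m by (simp add: cup_unit_right cocycles_imp_cochains)
    then show ?thesis by (simp add: algebra_simps)
  qed
  ultimately show ?thesis by simp
qed

text \<open>The injectivity part of the Leray--Hirsch theorem for \<open>B \<times> \<real>P\<^sup>n \<rightarrow> B\<close>: the powers of \<open>x\<close> up to the \<open>n\<close>-th are
  independent over the cohomology of \<open>B\<close>. The induction lowers the dimension of the sphere and the degree together: a
  section isolates the coefficient of \<open>x\<^sup>0\<close>, and the descent lemma divides the rest by \<open>x\<close>.\<close>

theorem sphere_relation_trivial: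
  fixes B :: "'b topology"
  assumes "\<And>i. i \<in> {1..Suc n} \<Longrightarrow> a i \<in> cocycles i B"
    and "odd_function (sphere_product n B) antipode s"
    and "equivariantly_exact n (sphere_product n B) antipode (sphere_relation_cochain n B s a (Suc n))"
    and "i \<in> {1..Suc n}"
  shows "a i \<in> coboundaries i B"
  using assms
proof (induction n arbitrary: s i)
  case 0
  then have "sphere_relation_cochain 0 B s a (Suc 0) \<in> coboundaries (Suc 0) (sphere_product 0 B)"
    by (auto simp: equivariantly_exact_def coboundaries_Suc)
  from section_kills[OF "0.prems"(1) this] 0 show ?case by (simp add: le_Suc_eq)
next
  case (Suc n)
  let ?Y = "sphere_product (Suc n) B" and ?Y' = "sphere_product n B"
  let ?x = "char_cocycle ?Y s"
  let ?j = "\<lambda>y. hemisphere n (1, y)"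
  have fst_antipode: "cochain_pullback q ?Y antipode (cochain_pullback q ?Y fst e) = cochain_pullback q ?Y fst e" for q e
    unfolding pullback_pullback[OF continuous_map_antipode] by (rule pullback_cong) (simp add: antipode_def)
  obtain b where b: "b \<in> cochains (Suc n) ?Y" "cochain_pullback (Suc n) ?Y antipode b = b"
      "sphere_relation_cochain (Suc n) B s a (Suc (Suc n)) = coboundary (Suc n) ?Y b"
    using Suc.prems(3) by (auto simp: equivariantly_exact_def)
  then have "sphere_relation_cochain (Suc n) B s a (Suc (Suc n)) \<in> coboundaries (Suc (Suc n)) ?Y"
    by (auto simp: coboundaries_Suc)
  then have top: "a (Suc (Suc n)) \<in> coboundaries (Suc (Suc n)) B"
    by (intro section_kills[OF Suc.prems(1)]) auto
  then obtain e where e: "e \<in> cochains (Suc n) B" "a (Suc (Suc n)) = coboundary (Suc n) B e"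
    by (auto simp: coboundaries_Suc)
  define y where "y = sphere_relation_cochain (Suc n) B s a (Suc n)"
  have y: "y \<in> cocycles (Suc n) ?Y"
    unfolding y_def by (rule sphere_relation_in_cocycles) (use Suc.prems(1) in auto)
  have split: "sphere_relation_cochain (Suc n) B s a (Suc (Suc n)) =
      (\<lambda>\<sigma>. cochain_cup (Suc n) 1 ?Y y ?x \<sigma> + cochain_pullback (Suc (Suc n)) ?Y fst (a (Suc (Suc n))) \<sigma>)"
  proof -
    have "cochain_cup i (Suc (Suc n) - i) ?Y (cochain_pullback i ?Y fst (a i)) (cup_prod ?Y (\<lambda>_. ?x) (Suc (Suc n) - i)) =
        cochain_cup (Suc n) 1 ?Y (cochain_cup i (Suc n - i) ?Y (cochain_pullback i ?Y fst (a i)) (cup_prod ?Y (\<lambda>_. ?x) (Suc n - i))) ?x"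
      if "i \<in> {1..Suc n}" for i
    proof -
      have "Suc (Suc n) - i = Suc (Suc n - i)" "i + (Suc n - i) = Suc n" using that by auto
      then show ?thesis
        using cup_assoc[of i "Suc n - i" 1 ?Y "cochain_pullback i ?Y fst (a i)" "cup_prod ?Y (\<lambda>_. ?x) (Suc n - i)" ?x]
        by simp
    qed
    then have "(\<Sum>i=1..Suc n. cochain_cup i (Suc (Suc n) - i) ?Y (cochain_pullback i ?Y fst (a i)) (cup_prod ?Y (\<lambda>_. ?x) (Suc (Suc n) - i)) \<sigma>)
        = cochain_cup (Suc n) 1 ?Y y ?x \<sigma>" for \<sigma>
      unfolding y_def sphere_relation_cochain_def cup_sum_left by (intro sum.cong refl) simp
    then show ?thesis
      unfolding sphere_relation_cochain_def[of _ _ _ _ "Suc (Suc n)"]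
      by (subst sum.cl_ivl_Suc) (simp_all add: cup_unit_right del: sum.cl_ivl_Suc)
  qed
  have "equivariantly_exact (Suc n) ?Y antipode (cochain_cup (Suc n) 1 ?Y y ?x)"
  proof -
    let ?b = "\<lambda>\<sigma>. b \<sigma> + cochain_pullback (Suc n) ?Y fst e \<sigma>"
    have "cochain_cup (Suc n) 1 ?Y y ?x = coboundary (Suc n) ?Y ?b"
      using split unfolding b(3) e(2) coboundary_add
      by (simp add: fun_eq_iff pullback_coboundary[OF continuous_map_sphere_product_fst] add.assoc)
    moreover have "cochain_pullback (Suc n) ?Y antipode ?b = ?b"
      by (simp add: pullback_add b(2) fst_antipode)
    ultimately show ?thesis
      unfolding equivariantly_exact_def by (intro bexI[of _ ?b]) (simp_all add: add_in_cochains b)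
  qed
  moreover have "cochain_pullback (Suc n) ?Y antipode y = y"
  proof -
    have "odd_function ?Y antipode s" by fact
    then have x: "char_cocycle ?Y (s \<circ> antipode) = ?x"
      using pullback_point_cochain_odd[OF continuous_map_antipode Suc.prems(2)]
      unfolding pullback_point_cochain[OF continuous_map_antipode]
      using unit_in_cocycles[of ?Y] by (simp add: coboundary_add cocycles_def)
    have "cochain_pullback i ?Y (fst \<circ> antipode) (a i) = cochain_pullback i ?Y fst (a i)" for i
      by (rule pullback_cong) (simp add: antipode_def)
    then show ?thesis
      unfolding y_def pullback_relation_cochain[OF continuous_map_antipode] x
      by (simp only: sphere_relation_cochain_def)
  qed
  ultimately have exact: "equivariantly_exact n ?Y' antipode (cochain_pullback (Suc n) ?Y' ?j y)"
    using y Suc.prems(2)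
    by (intro gysin_descent[OF continuous_map_antipode continuous_map_antipode _ continuous_map_hemisphere, where s = s])
       (simp_all add: hemisphere_equator_antipode hemisphere_pole_antipode)
  have j: "continuous_map ?Y' ?Y ?j"
    by (rule continuous_map_compose[OF _ continuous_map_hemisphere, unfolded o_def])
       (auto intro!: continuous_map_pairedI)
  have jy: "cochain_pullback (Suc n) ?Y' ?j y = sphere_relation_cochain n B (s \<circ> ?j) a (Suc n)"
  proof -
    have "fst \<circ> ?j = (fst :: 'b \<times> (nat \<Rightarrow> real) \<Rightarrow> 'b)" by (auto simp: hemisphere_def fun_eq_iff)
    then show ?thesis
      unfolding y_def pullback_relation_cochain[OF j] by (simp only: sphere_relation_cochain_def)
  qed
  have odd: "odd_function ?Y' antipode (s \<circ> ?j)"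
    unfolding odd_function_def
  proof
    fix y assume y: "y \<in> topspace ?Y'"
    then have "?j y \<in> topspace ?Y" using j by (auto simp: continuous_map_def)
    moreover have "?j (antipode y) = antipode (?j y)"
      by (rule hemisphere_equator_antipode)
    ultimately show "(s \<circ> ?j) (antipode y) = (s \<circ> ?j) y + 1"
      using Suc.prems(2) by (simp add: odd_function_def)
  qed
  have "a i \<in> coboundaries i B" if "i \<in> {1..Suc n}" for i
  proof (rule Suc.IH[OF _ odd _ that])
    show "a k \<in> cocycles k B" if "k \<in> {1..Suc n}" for k
      using Suc.prems(1) that by auto
    show "equivariantly_exact n ?Y' antipode (sphere_relation_cochain n B (s \<circ> ?j) a (Suc n))"
      using exact unfolding jy .
  qed
  with top Suc.prems(4) show ?case by (cases "i = Suc (Suc n)") auto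
qed

section \<open>Sections of line fields over simplices\<close>

lemma standard_simplex_segment:
  assumes "x \<in> standard_simplex p" "y \<in> standard_simplex p" "0 \<le> t" "t \<le> 1"
  shows "(\<lambda>i. (1 - t) * x i + t * y i) \<in> standard_simplex p"
  using assms by (intro convex_standard_simplex) auto

lemma compact_standard_simplex: "compact (standard_simplex p)"
  using compactin_standard_simplex[of p] by (simp add: euclidean_product_topology)

text \<open>A field of lines \<open>\<real> v x\<close> is continuous if the orthogonal projections onto the lines depend continuously on \<open>x\<close>.
  Transport a vector along the segment from a fixed vertex to \<open>x\<close> in \<open>N\<close> equal steps, projecting it onto the current
  line after each step; for large \<open>N\<close> consecutive lines are nowhere orthogonal, so it stays nonzero.\<close>

lemma line_field_section:
  fixes v :: "(nat \<Rightarrow> real) \<Rightarrow> nat \<Rightarrow> real"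
  assumes nonzero: "\<And>x. x \<in> standard_simplex p \<Longrightarrow> (\<Sum>k<d. v x k ^ 2) > 0"
    and cont: "\<And>i j. i < d \<Longrightarrow> j < d \<Longrightarrow>
       continuous_on (standard_simplex p) (\<lambda>x. v x i * v x j / (\<Sum>k<d. v x k ^ 2))"
  obtains u :: "(nat \<Rightarrow> real) \<Rightarrow> nat \<Rightarrow> real"
  where "\<And>i. continuous_on (standard_simplex p) (\<lambda>x. u x i)"
    and "\<And>x i. i \<ge> d \<Longrightarrow> u x i = 0"
    and "\<And>x. x \<in> standard_simplex p \<Longrightarrow> \<exists>c. c \<noteq> 0 \<and> (\<forall>i<d. u x i = c * v x i)"
proof -
  let ?\<Delta> = "standard_simplex p"
  define nrm where "nrm x = (\<Sum>k<d. v x k ^ 2)" for x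
  define m where "m i j x = v x i * v x j / nrm x" for i j x
  define x0 :: "nat \<Rightarrow> real" where "x0 = (\<lambda>j. if j = 0 then 1 else 0)"
  have x0: "x0 \<in> ?\<Delta>" by (simp add: x0_def)
  define \<rho> where "\<rho> t x = (\<lambda>i. (1 - t) * x0 i + t * x i)" for t and x :: "nat \<Rightarrow> real"
  have \<rho>: "\<rho> t x \<in> ?\<Delta>" if "x \<in> ?\<Delta>" "t \<in> {0..1}" for t x
    unfolding \<rho>_def using that x0 by (intro standard_simplex_segment) auto
  have nrm_pos: "nrm x > 0" if "x \<in> ?\<Delta>" for x using nonzero that by (simp add: nrm_def)
  have m_cont: "continuous_on ?\<Delta> (m i j)" if "i < d" "j < d" for i j
    using cont[OF that] by (simp add: m_def[abs_def] nrm_def)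
  \<comment> \<open>\<open>G (t, s, x)\<close> is the squared cosine of the angle between the lines at the points with parameters \<open>t\<close> and \<open>s\<close> on the
    segment from \<open>x0\<close> to \<open>x\<close>; it is 1 for \<open>t = s\<close>, and uniform continuity bounds it below on short steps.\<close>
  define G where "G = (\<lambda>(t, s, x). \<Sum>i<d. \<Sum>j<d. m i j (\<rho> t x) * m i j (\<rho> s x))"
  let ?K = "{0..1::real} \<times> {0..1::real} \<times> ?\<Delta>"
  have \<rho>_cont: "continuous_on ?K (\<lambda>y. \<rho> (f y) (snd (snd y)))" if "continuous_on ?K f" for f
    unfolding \<rho>_def
    by (intro continuous_on_coordinatewise_then_product continuous_intros that
        continuous_on_product_then_coordinatewise[OF continuous_on_snd[OF continuous_on_snd[OF continuous_on_id]]])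
  have "continuous_on ?K (\<lambda>y. \<Sum>i<d. \<Sum>j<d. m i j (\<rho> (fst y) (snd (snd y))) * m i j (\<rho> (fst (snd y)) (snd (snd y))))"
    by (intro continuous_intros continuous_on_compose2[OF m_cont \<rho>_cont]) (use \<rho> in auto)
  then have "continuous_on ?K G" by (simp add: G_def case_prod_beta')
  moreover have "compact ?K" by (intro compact_Times compact_standard_simplex) auto
  ultimately have "uniformly_continuous_on ?K G" by (rule compact_uniformly_continuous)
  then obtain \<delta> where "\<delta> > 0" and
    \<delta>: "\<And>y y'. y \<in> ?K \<Longrightarrow> y' \<in> ?K \<Longrightarrow> dist y' y < \<delta> \<Longrightarrow> dist (G y') (G y) < 1"
    unfolding uniformly_continuous_on_def by (metis zero_less_one)
  have inner: "(\<Sum>i<d. \<Sum>j<d. m i j x * m i j y) = (\<Sum>i<d. v x i * v y i)\<^sup>2 / (nrm x * nrm y)" for x y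
  proof -
    have "(\<Sum>i<d. \<Sum>j<d. m i j x * m i j y) = (\<Sum>i<d. \<Sum>j<d. (v x i * v y i) * (v x j * v y j) / (nrm x * nrm y))"
      by (intro sum.cong refl) (simp add: m_def)
    also have "\<dots> = (\<Sum>i<d. v x i * v y i) * (\<Sum>j<d. v x j * v y j) / (nrm x * nrm y)"
      by (simp only: sum_product sum_divide_distrib)
    finally show ?thesis by (simp add: power2_eq_square)
  qed
  have G_diag: "G (t, t, x) = 1" if "x \<in> ?\<Delta>" "t \<in> {0..1}" for t x
    using nrm_pos[OF \<rho>[OF that]] unfolding G_def prod.case inner
    by (simp add: nrm_def power2_eq_square)
  obtain N :: nat where N: "N > 0" "1 / real N < \<delta>"
    using \<open>\<delta> > 0\<close> by (metis reals_Archimedean inverse_eq_divide zero_less_Suc)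
  define y where "y k x = \<rho> (real k / real N) x" for k x
  have y: "y k x \<in> ?\<Delta>" if "x \<in> ?\<Delta>" "k \<le> N" for k x
    unfolding y_def using that N by (intro \<rho>) auto
  have step: "(\<Sum>i<d. v (y k x) i * v (y (Suc k) x) i) \<noteq> 0" if "x \<in> ?\<Delta>" "k < N" for k x
  proof
    assume 0: "(\<Sum>i<d. v (y k x) i * v (y (Suc k) x) i) = 0"
    let ?t = "real k / real N" and ?s = "real (Suc k) / real N"
    have ts: "?t \<in> {0..1}" "?s \<in> {0..1}" using that N by auto
    have "?s - ?t = 1 / real N" by (simp flip: diff_divide_distrib)
    then have "dist (?t, ?s, x) (?t, ?t, x) < \<delta>"
      using N by (simp add: dist_Pair_Pair dist_real_def)
    then have "dist (G (?t, ?s, x)) (G (?t, ?t, x)) < 1"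
      using ts that by (intro \<delta>) auto
    moreover have "G (?t, ?s, x) = 0"
      using 0 unfolding G_def prod.case inner by (simp add: y_def)
    ultimately show False using G_diag[OF that(1) ts(1)] by (simp add: dist_real_def)
  qed
  define U where "U = rec_nat (\<lambda>x i. if i < d then v x0 i else 0)
      (\<lambda>k u x i. if i < d then \<Sum>j<d. m i j (y (Suc k) x) * u x j else 0)"
  have U0: "U 0 = (\<lambda>x i. if i < d then v x0 i else 0)"
    and USuc: "\<And>k. U (Suc k) = (\<lambda>x i. if i < d then \<Sum>j<d. m i j (y (Suc k) x) * U k x j else 0)"
    unfolding U_def by simp_all
  have U_cont: "continuous_on ?\<Delta> (\<lambda>x. U k x i)" if "k \<le> N" for k i
    using that
  proof (induction k arbitrary: i)
    case 0
    then show ?case by (simp add: U0)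
  next
    case (Suc k)
    have "continuous_on ?\<Delta> (\<lambda>x. y (Suc k) x)"
      unfolding y_def \<rho>_def
      by (intro continuous_on_coordinatewise_then_product continuous_intros
          continuous_on_product_then_coordinatewise[OF continuous_on_id])
    then have "continuous_on ?\<Delta> (\<lambda>x. \<Sum>j<d. m i j (y (Suc k) x) * U k x j)" if "i < d"
      using that Suc y by (intro continuous_on_sum continuous_on_mult continuous_on_compose2[OF m_cont]) auto
    then show ?case by (cases "i < d") (simp_all add: USuc)
  qed
  have U_line: "\<exists>c. c \<noteq> 0 \<and> (\<forall>i<d. U k x i = c * v (y k x) i)" if "x \<in> ?\<Delta>" "k \<le> N" for k x
    using that(2)
  proof (induction k)
    case 0
    have "y 0 x = x0" by (simp add: y_def \<rho>_def)
    then show ?case by (intro exI[of _ 1]) (simp add: U0)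
  next
    case (Suc k)
    then obtain c where c: "c \<noteq> 0" "\<And>i. i < d \<Longrightarrow> U k x i = c * v (y k x) i" by auto
    let ?c = "c * (\<Sum>i<d. v (y k x) i * v (y (Suc k) x) i) / nrm (y (Suc k) x)"
    have "nrm (y (Suc k) x) > 0" using that Suc.prems by (intro nrm_pos y) auto
    then have "?c \<noteq> 0" using c step[OF that(1), of k] Suc.prems by simp
    moreover have "U (Suc k) x i = ?c * v (y (Suc k) x) i" if "i < d" for i
    proof -
      have "U (Suc k) x i = (\<Sum>j<d. c * (v (y k x) j * v (y (Suc k) x) j) / nrm (y (Suc k) x) * v (y (Suc k) x) i)"
        using that c by (simp add: USuc m_def mult_ac)
      then show ?thesis by (simp add: sum_distrib_left sum_distrib_right sum_divide_distrib)
    qed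
    ultimately show ?case by blast
  qed
  show ?thesis
  proof
    show "continuous_on ?\<Delta> (\<lambda>x. U N x i)" for i by (rule U_cont) simp
    show "U N x i = 0" if "i \<ge> d" for x i using that by (cases N) (simp_all add: U0 USuc)
    have "y N x = x" for x using N by (simp add: y_def \<rho>_def)
    then show "\<exists>c. c \<noteq> 0 \<and> (\<forall>i<d. U N x i = c * v x i)" if "x \<in> ?\<Delta>" for x
      using U_line[OF that, of N] by simp
  qed
qed

lemma singular_simplex_constant_sign:
  assumes "continuous_on (standard_simplex p) f" "\<And>x. x \<in> standard_simplex p \<Longrightarrow> f x \<noteq> (0::real)"
    and "x \<in> standard_simplex p" "y \<in> standard_simplex p"
  shows "f x < 0 \<longleftrightarrow> f y < 0"
proof -
  have "connected (f ` standard_simplex p)"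
    using assms(1) connectedin_standard_simplex[of p]
    by (intro connected_continuous_image) (simp_all add: euclidean_product_topology)
  then have "0 \<in> f ` standard_simplex p" if "f a < 0" "f b \<ge> 0" "a \<in> standard_simplex p" "b \<in> standard_simplex p" for a b
    using that unfolding connected_iff_interval by (meson imageI less_imp_le)
  with assms show ?thesis by (metis imageE not_less)
qed

lemma continuous_map_standard_simplex_iff:
  "continuous_map (subtopology (powertop_real UNIV) (standard_simplex p)) euclideanreal f \<longleftrightarrow>
     continuous_on (standard_simplex p) f"
  by (simp add: euclidean_product_topology)


section \<open>The projectivisation of a trivialised bundle\<close>

lemma quotient_map_quotient_topology: "quotient_map X (quotient_topology X f) f"
proof -
  have top: "topspace (quotient_topology X f) = f ` topspace X"
  proof
    show "topspace (quotient_topology X f) \<subseteq> f ` topspace X"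
      by (metis openin_quotient_topology openin_topspace)
    have "{x \<in> topspace X. f x \<in> f ` topspace X} = topspace X" by auto
    then have "openin (quotient_topology X f) (f ` topspace X)"
      by (simp add: openin_quotient_topology)
    then show "f ` topspace X \<subseteq> topspace (quotient_topology X f)"
      by (rule openin_subset)
  qed
  show ?thesis
    unfolding quotient_map_def top by (auto simp: openin_quotient_topology)
qed

text \<open>The record of a bundle does not say that its operations preserve the total space; lines are subsets of the total
  space only if scalar multiplication does.\<close>

locale trivialised_bundle =
  fixes \<xi> :: "('e, 'b) vbundle" and B :: "'b topology" and d :: nat and h :: "'e \<Rightarrow> 'b \<times> (nat \<Rightarrow> real)"
  assumes iso: "vbundle_iso \<xi> (trivial_bundle d B) h"
    and scale_closed: "\<And>e t. e \<in> topspace (total_space \<xi>) \<Longrightarrow> fibre_scale \<xi> t e \<in> topspace (total_space \<xi>)"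
begin

abbreviation T where "T \<equiv> total_space \<xi>"
abbreviation V where "V \<equiv> nonzero_vectors \<xi>"
abbreviation P where "P \<equiv> projectivisation \<xi>"
abbreviation q where "q \<equiv> line_through \<xi>"
abbreviation scale where "scale \<equiv> fibre_scale \<xi>"
abbreviation vec where "vec e \<equiv> snd (h e)"
abbreviation sq_norm where "sq_norm v \<equiv> (\<Sum>k<d. v k ^ 2)"

definition hinv where "hinv = (SOME g. homeomorphic_maps T (prod_topology B (Euclidean_space d)) h g)"

lemma base_eq: "base_space \<xi> = B" and dim_eq: "fibre_dim \<xi> = d"
  using iso by (simp_all add: vbundle_iso_def trivial_bundle_def)

lemma homeomorphic_maps_h: "homeomorphic_maps T (prod_topology B (Euclidean_space d)) h hinv"
proof -
  have "homeomorphic_map T (prod_topology B (Euclidean_space d)) h"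
    using iso by (simp add: vbundle_iso_def trivial_bundle_def)
  then show ?thesis
    unfolding hinv_def homeomorphic_map_maps by (rule someI_ex)
qed

lemma continuous_h: "continuous_map T (prod_topology B (Euclidean_space d)) h"
  and continuous_hinv: "continuous_map (prod_topology B (Euclidean_space d)) T hinv"
  and hinv_h: "e \<in> topspace T \<Longrightarrow> hinv (h e) = e"
  and h_hinv: "y \<in> topspace (prod_topology B (Euclidean_space d)) \<Longrightarrow> h (hinv y) = y"
  using homeomorphic_maps_h by (auto simp: homeomorphic_maps_def)

lemma h_in: "e \<in> topspace T \<Longrightarrow> h e \<in> topspace (prod_topology B (Euclidean_space d))"
  using continuous_h by (auto simp: continuous_map_def)

lemma hinv_in: "y \<in> topspace (prod_topology B (Euclidean_space d)) \<Longrightarrow> hinv y \<in> topspace T"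
  using continuous_hinv by (auto simp: continuous_map_def)

lemma vec_above: "e \<in> topspace T \<Longrightarrow> i \<ge> d \<Longrightarrow> vec e i = 0"
  using h_in[of e] by (auto simp: topspace_Euclidean_space mem_Times_iff)

lemma h_eqD: "e \<in> topspace T \<Longrightarrow> e' \<in> topspace T \<Longrightarrow> h e = h e' \<Longrightarrow> e = e'"
  by (metis hinv_h)

lemma fst_h: "e \<in> topspace T \<Longrightarrow> fst (h e) = bundle_proj \<xi> e"
  using iso by (auto simp: vbundle_iso_def trivial_bundle_def)

lemma h_scale: "e \<in> topspace T \<Longrightarrow> h (scale t e) = (fst (h e), \<lambda>i. t * vec e i)"
  using iso by (auto simp: vbundle_iso_def trivial_bundle_def)

lemma scale_1: "e \<in> topspace T \<Longrightarrow> scale 1 e = e"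
  by (rule h_eqD) (simp_all add: scale_closed h_scale)

lemma scale_scale: "e \<in> topspace T \<Longrightarrow> scale s (scale t e) = scale (s * t) e"
  by (rule h_eqD) (simp_all add: scale_closed h_scale mult.assoc)

lemma sq_norm_pos_iff: "sq_norm v > 0 \<longleftrightarrow> (\<exists>i<d. v i \<noteq> (0::real))"
  by (auto simp: less_le sum_nonneg sum_nonneg_eq_0_iff)

lemma topspace_V: "e \<in> topspace V \<longleftrightarrow> e \<in> topspace T \<and> sq_norm (vec e) > 0"
proof -
  have "scale 0 e \<noteq> e \<longleftrightarrow> (\<exists>i<d. vec e i \<noteq> 0)" if e: "e \<in> topspace T"
  proof -
    have "scale 0 e = e \<longleftrightarrow> h (scale 0 e) = h e"
      using h_eqD scale_closed e by metis
    also have "\<dots> \<longleftrightarrow> (\<forall>i. vec e i = 0)"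
      using e by (auto simp: h_scale prod_eq_iff fun_eq_iff)
    finally show ?thesis using vec_above[OF e] by (metis not_less)
  qed
  then show ?thesis unfolding sq_norm_pos_iff by (auto simp: nonzero_vectors_def)
qed

lemma topspace_V_T: "e \<in> topspace V \<Longrightarrow> e \<in> topspace T"
  by (simp add: topspace_V)

lemma scale_in_V: "e \<in> topspace V \<Longrightarrow> t \<noteq> 0 \<Longrightarrow> scale t e \<in> topspace V"
  by (auto simp: topspace_V scale_closed h_scale sq_norm_pos_iff)

lemma quotient_map_q: "quotient_map V P q"
  unfolding projectivisation_def by (rule quotient_map_quotient_topology)

lemma continuous_q: "continuous_map V P q"
  by (rule quotient_imp_continuous_map[OF quotient_map_q])

lemma topspace_P: "topspace P = q ` topspace V"
  using quotient_imp_surjective_map[OF quotient_map_q] by simp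

lemma q_scale: "e \<in> topspace V \<Longrightarrow> t \<noteq> 0 \<Longrightarrow> q (scale t e) = q e"
proof -
  assume e: "e \<in> topspace V" and t: "t \<noteq> 0"
  have "\<exists>s'. scale s e = scale s' (scale t e) \<and> s' \<noteq> 0" if "s \<noteq> 0" for s
    using that t e by (intro exI[of _ "s / t"]) (simp add: scale_scale topspace_V_T)
  moreover have "\<exists>s'. scale s (scale t e) = scale s' e \<and> s' \<noteq> 0" if "s \<noteq> 0" for s
    using that t e by (intro exI[of _ "s * t"]) (simp add: scale_scale topspace_V_T)
  ultimately show ?thesis
    unfolding line_through_def by blast
qed

lemma self_in_line: "e \<in> topspace V \<Longrightarrow> e \<in> q e"
  unfolding line_through_def using scale_1[of e] by (force simp: topspace_V_T)

lemma q_eqD: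
  assumes "e \<in> topspace V" "e' \<in> topspace V" "q e = q e'"
  obtains t where "t \<noteq> 0" "e' = scale t e"
  using self_in_line[OF assms(2)] assms(3) that by (auto simp: line_through_def)

lemma proj_q: "e \<in> topspace V \<Longrightarrow> projectivisation_proj \<xi> (q e) = fst (h e)"
proof -
  assume e: "e \<in> topspace V"
  have "bundle_proj \<xi> ` q e = {fst (h e)}"
  proof -
    have "bundle_proj \<xi> (scale t e) = fst (h e)" if "t \<noteq> 0" for t
      using scale_in_V[OF e that] e by (simp add: h_scale topspace_V_T flip: fst_h)
    then have "bundle_proj \<xi> ` q e = (\<lambda>_. fst (h e)) ` q e"
      by (intro image_cong refl) (auto simp: line_through_def)
    then show ?thesis using self_in_line[OF e] by auto
  qed
  then show ?thesis by (simp add: projectivisation_proj_def)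
qed

lemma continuous_map_fst_h: "continuous_map V B (\<lambda>e. fst (h e))"
  unfolding nonzero_vectors_def
  using continuous_map_compose[OF continuous_h continuous_map_fst]
  by (auto simp: o_def intro: continuous_map_from_subtopology)

lemma continuous_map_vec: "continuous_map V euclideanreal (\<lambda>e. vec e i)"
proof -
  have "continuous_map (Euclidean_space d) euclideanreal (\<lambda>x. x i)"
    unfolding Euclidean_space_def by (intro continuous_map_from_subtopology continuous_map_product_projection) simp
  from continuous_map_compose[OF continuous_map_compose[OF continuous_h continuous_map_snd] this]
  show ?thesis
    unfolding nonzero_vectors_def by (auto simp: o_def intro: continuous_map_from_subtopology)
qed

lemma continuous_proj: "continuous_map P B (projectivisation_proj \<xi>)"
proof -
  have "continuous_map V B (projectivisation_proj \<xi> \<circ> q)"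
    using continuous_map_fst_h by (rule continuous_map_eq) (simp add: proj_q)
  then show ?thesis
    using continuous_compose_quotient_map_eq[OF quotient_map_q] by blast
qed

text \<open>The matrix of the orthogonal projection onto a line. It does not depend on the vector that spans the line, hence
  gives continuous functions on \<open>P\<close>, from which lines are recovered.\<close>

definition line_projector :: "'e set \<Rightarrow> nat \<Rightarrow> nat \<Rightarrow> real" where
  "line_projector l i j = (let v = vec (SOME e. e \<in> l) in v i * v j / sq_norm v)"

lemma line_projector_q:
  assumes "e \<in> topspace V"
  shows "line_projector (q e) i j = vec e i * vec e j / sq_norm (vec e)"
proof -
  have "(SOME e'. e' \<in> q e) \<in> q e" using self_in_line[OF assms] by (rule someI)
  then obtain t where t: "t \<noteq> 0" "(SOME e'. e' \<in> q e) = scale t e"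
    by (auto simp: line_through_def)
  have "sq_norm (\<lambda>i. t * vec e i) = t ^ 2 * sq_norm (vec e)"
    by (simp add: power_mult_distrib sum_distrib_left)
  then show ?thesis
    using t(1) assms by (simp add: line_projector_def t(2) h_scale topspace_V_T Let_def power2_eq_square)
qed

lemma continuous_line_projector: "continuous_map P euclideanreal (\<lambda>l. line_projector l i j)"
proof -
  have "continuous_map V euclideanreal (\<lambda>e. vec e i * vec e j / sq_norm (vec e))"
    by (intro continuous_map_real_divide continuous_map_real_mult continuous_map_sum continuous_map_real_pow continuous_map_vec)
       (auto simp: topspace_V)
  then have "continuous_map V euclideanreal ((\<lambda>l. line_projector l i j) \<circ> q)"
    by (rule continuous_map_eq) (simp add: line_projector_q)
  then show ?thesis
    using continuous_compose_quotient_map_eq[OF quotient_map_q] by blast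
qed

text \<open>The trivialisation turns a singular simplex of \<open>P\<close> into a map to \<open>B\<close> and a continuous field of lines in \<open>\<real>\<^sup>d\<close>; a
  nowhere vanishing section of the latter is a lift.\<close>

lemma simplex_lift:
  assumes \<sigma>: "singular_simplex p P \<sigma>"
  obtains \<sigma>' where "singular_simplex p V \<sigma>'" "simplex_map p q \<sigma>' = \<sigma>"
proof -
  let ?D = "subtopology (powertop_real UNIV) (standard_simplex p)"
  have \<sigma>_cont: "continuous_map ?D P \<sigma>" using \<sigma> by (simp add: singular_simplex_def)
  have "\<forall>x. \<exists>e. x \<in> standard_simplex p \<longrightarrow> e \<in> topspace V \<and> \<sigma> x = q e"
    using singular_simplex_in_topspace[OF \<sigma>] unfolding topspace_P by blast
  then obtain e where e: "\<And>x. x \<in> standard_simplex p \<Longrightarrow> e x \<in> topspace V \<and> \<sigma> x = q (e x)" by metis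
  have pos: "sq_norm (vec (e x)) > 0" if "x \<in> standard_simplex p" for x
    using e[OF that] by (simp add: topspace_V)
  have cont: "continuous_on (standard_simplex p) (\<lambda>x. vec (e x) i * vec (e x) j / sq_norm (vec (e x)))" for i j
  proof -
    have "continuous_map ?D euclideanreal (\<lambda>x. vec (e x) i * vec (e x) j / sq_norm (vec (e x)))"
      using continuous_map_compose[OF \<sigma>_cont continuous_line_projector[of i j]]
      by (rule continuous_map_eq) (simp add: e line_projector_q)
    then show ?thesis by (simp add: continuous_map_standard_simplex_iff)
  qed
  obtain u where u: "\<And>i. continuous_on (standard_simplex p) (\<lambda>x. u x i)"
     "\<And>x i. i \<ge> d \<Longrightarrow> u x i = 0"
     "\<And>x. x \<in> standard_simplex p \<Longrightarrow> \<exists>c. c \<noteq> 0 \<and> (\<forall>i<d. u x i = c * vec (e x) i)"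
    by (rule line_field_section[where p = p and d = d and v = "\<lambda>x. vec (e x)"]) (use pos cont in \<open>blast+\<close>)
  define \<sigma>' where "\<sigma>' = restrict (\<lambda>x. hinv (projectivisation_proj \<xi> (\<sigma> x), u x)) (standard_simplex p)"
  have "continuous_map ?D (Euclidean_space d) u"
    using u(1,2) by (auto simp: Euclidean_space_def continuous_map_in_subtopology
        continuous_map_componentwise_UNIV continuous_map_standard_simplex_iff)
  then have "continuous_map ?D (prod_topology B (Euclidean_space d)) (\<lambda>x. (projectivisation_proj \<xi> (\<sigma> x), u x))"
    using continuous_map_compose[OF \<sigma>_cont continuous_proj] by (intro continuous_map_pairedI) (simp_all add: o_def)
  from continuous_map_compose[OF this continuous_hinv] have \<sigma>'_cont: "continuous_map ?D T \<sigma>'"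
    by (rule continuous_map_eq) (simp add: \<sigma>'_def)
  have \<sigma>'_eq: "\<exists>c. c \<noteq> 0 \<and> \<sigma>' x = scale c (e x)" if x: "x \<in> standard_simplex p" for x
  proof -
    have ex: "e x \<in> topspace V" "e x \<in> topspace T" and \<sigma>x: "\<sigma> x = q (e x)"
      using e[OF x] topspace_V_T by auto
    obtain c where c: "c \<noteq> 0" "\<And>i. i < d \<Longrightarrow> u x i = c * vec (e x) i" using u(3)[OF x] by blast
    have "u x i = c * vec (e x) i" for i
      using c u(2) vec_above[OF ex(2)] by (cases "i < d") auto
    then have "(projectivisation_proj \<xi> (\<sigma> x), u x) = h (scale c (e x))"
      using ex by (simp add: \<sigma>x proj_q h_scale fun_eq_iff)
    then show ?thesis
      using x c(1) ex by (auto simp: \<sigma>'_def hinv_h scale_closed)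
  qed
  show ?thesis
  proof
    have "continuous_map ?D V \<sigma>'"
      unfolding nonzero_vectors_def continuous_map_in_subtopology
    proof (intro conjI \<sigma>'_cont)
      show "\<sigma>' \<in> topspace ?D \<rightarrow> {e. scale 0 e \<noteq> e}"
      proof
        fix x assume "x \<in> topspace ?D"
        then have x: "x \<in> standard_simplex p" by simp
        then have "\<sigma>' x \<in> topspace V" using \<sigma>'_eq[OF x] e[OF x] scale_in_V by auto
        then show "\<sigma>' x \<in> {e. scale 0 e \<noteq> e}" by (simp add: nonzero_vectors_def)
      qed
    qed
    then show "singular_simplex p V \<sigma>'" by (simp add: singular_simplex_def \<sigma>'_def)
    have "q (\<sigma>' x) = \<sigma> x" if "x \<in> standard_simplex p" for x
      using \<sigma>'_eq[OF that] e[OF that] q_scale by auto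
    then show "simplex_map p q \<sigma>' = \<sigma>"
      using \<sigma> by (auto simp: simplex_map_def singular_simplex_def extensional_def fun_eq_iff)
  qed
qed

lemma pullback_q_inject:
  assumes "a \<in> cochains p P" "b \<in> cochains p P" "cochain_pullback p V q a = cochain_pullback p V q b"
  shows "a = b"
proof (rule cochains_eqI[OF assms(1,2)])
  fix \<sigma> assume "singular_simplex p P \<sigma>"
  then obtain \<sigma>' where "singular_simplex p V \<sigma>'" "simplex_map p q \<sigma>' = \<sigma>" by (rule simplex_lift)
  then show "a \<sigma> = b \<sigma>" using fun_cong[OF assms(3), of \<sigma>'] by (simp add: cochain_pullback_def)
qed

section \<open>The tautological class\<close>

text \<open>Two lifts of a path of lines differ by a continuous function without zeros, which has constant sign.\<close>

lemma coboundary_orientation_lift_unique: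
  assumes s: "line_orientation \<xi> s"
    and \<sigma>: "singular_simplex 1 V \<sigma>" and \<sigma>': "singular_simplex 1 V \<sigma>'"
    and eq: "simplex_map 1 q \<sigma> = simplex_map 1 q \<sigma>'"
  shows "char_cocycle V s \<sigma> = char_cocycle V s \<sigma>'"
proof -
  let ?\<Delta> = "standard_simplex 1"
  define f where "f x = (\<Sum>k<d. vec (\<sigma>' x) k * vec (\<sigma> x) k) / sq_norm (vec (\<sigma> x))" for x
  have in_V: "\<sigma> x \<in> topspace V" "\<sigma>' x \<in> topspace V" if "x \<in> ?\<Delta>" for x
    using singular_simplex_in_topspace \<sigma> \<sigma>' that by fast+
  have scale: "f x \<noteq> 0 \<and> \<sigma>' x = scale (f x) (\<sigma> x)" if x: "x \<in> ?\<Delta>" for x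
  proof -
    have "q (\<sigma> x) = q (\<sigma>' x)" using fun_cong[OF eq, of x] x by (simp add: simplex_map_def)
    then obtain t where t: "t \<noteq> 0" "\<sigma>' x = scale t (\<sigma> x)" using q_eqD in_V[OF x] by metis
    have "f x = t"
      using in_V(1)[OF x] unfolding f_def t(2)
      by (simp add: h_scale topspace_V power2_eq_square mult.assoc flip: sum_distrib_left)
    with t show ?thesis by simp
  qed
  have vec_cont: "continuous_on ?\<Delta> (\<lambda>x. vec (\<tau> x) k)" if "singular_simplex 1 V \<tau>" for \<tau> k
    using continuous_map_compose[OF _ continuous_map_vec[of k], of _ \<tau>] that
    by (simp add: singular_simplex_def continuous_map_standard_simplex_iff[symmetric] o_def)
  have f_cont: "continuous_on ?\<Delta> f"
    unfolding f_def using in_V(1) by (intro continuous_intros vec_cont \<sigma> \<sigma>') (force simp: topspace_V)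
  have s_diff: "s (\<sigma>' x) = s (\<sigma> x) + (if f x < 0 then 1 else 0)" if x: "x \<in> ?\<Delta>" for x
    using s scale[OF x] in_V(1)[OF x] unfolding line_orientation_def by metis
  have sign: "f path_start < 0 \<longleftrightarrow> f path_end < 0"
    using scale path_ends_in by (intro singular_simplex_constant_sign[OF f_cont]) auto
  show ?thesis
    unfolding char_cocycle_path[OF \<sigma>] char_cocycle_path[OF \<sigma>'] s_diff[OF path_ends_in(1)] s_diff[OF path_ends_in(2)]
    using sign by (simp add: ac_simps)
qed

text \<open>The value on a path of lines is read off at an arbitrary lift.\<close>

definition orientation_cochain :: "('e \<Rightarrow> bit) \<Rightarrow> 'e set cochain" where
  "orientation_cochain s = (\<lambda>\<sigma>. if singular_simplex 1 P \<sigma> then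
     char_cocycle V s (SOME \<sigma>'. singular_simplex 1 V \<sigma>' \<and> simplex_map 1 q \<sigma>' = \<sigma>) else 0)"

lemma pullback_orientation_cochain:
  assumes "line_orientation \<xi> s"
  shows "cochain_pullback 1 V q (orientation_cochain s) = char_cocycle V s"
proof (rule cochains_eqI[of _ 1 V])
  show "char_cocycle V s \<in> cochains 1 V" using coboundary_in_cochains[of 0] by simp
  fix \<sigma> assume \<sigma>: "singular_simplex 1 V \<sigma>"
  let ?P = "\<lambda>\<sigma>'. singular_simplex 1 V \<sigma>' \<and> simplex_map 1 q \<sigma>' = simplex_map 1 q \<sigma>"
  have "?P (SOME \<sigma>'. ?P \<sigma>')" using \<sigma> by (intro someI[of ?P]) simp
  then have lift: "singular_simplex 1 V (SOME \<sigma>'. ?P \<sigma>')" "simplex_map 1 q (SOME \<sigma>'. ?P \<sigma>') = simplex_map 1 q \<sigma>"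
    by blast+
  have "cochain_pullback 1 V q (orientation_cochain s) \<sigma> = char_cocycle V s (SOME \<sigma>'. ?P \<sigma>')"
    using \<sigma> singular_simplex_simplex_map[OF \<sigma> continuous_q]
    by (simp add: cochain_pullback_def orientation_cochain_def del: One_nat_def)
  also have "\<dots> = char_cocycle V s \<sigma>"
    by (rule coboundary_orientation_lift_unique[OF assms lift(1) \<sigma> lift(2)])
  finally show "cochain_pullback 1 V q (orientation_cochain s) \<sigma> = char_cocycle V s \<sigma>" .
qed simp

text \<open>As simplices of dimension 2 lift too, it is enough that the pullback to the nonzero vectors is a cocycle, and there
  it is even a coboundary.\<close>

lemma orientation_cochain_in_cocycles:
  assumes "line_orientation \<xi> s"
  shows "orientation_cochain s \<in> cocycles 1 P"
proof -
  have "cochain_pullback 2 V q (coboundary 1 P (orientation_cochain s)) = cochain_pullback 2 V q (\<lambda>\<sigma>. 0)"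
    using pullback_coboundary[OF continuous_q, of 1 "orientation_cochain s"]
    unfolding pullback_orientation_cochain[OF assms] by (simp add: numeral_2_eq_2)
  then have "coboundary 1 P (orientation_cochain s) = (\<lambda>\<sigma>. 0)"
    by (intro pullback_q_inject[of _ 2]) (use coboundary_in_cochains[of 1] in \<open>simp_all add: numeral_2_eq_2\<close>)
  then show ?thesis
    by (simp add: cocycles_def cochains_def orientation_cochain_def)
qed

text \<open>The sum of two orientations is constant on lines; as a function on \<open>P\<close>, its coboundary is the sum of the two
  cocycles.\<close>

lemma orientation_class_unique:
  assumes s: "line_orientation \<xi> s" "a \<in> cocycles 1 P"
      "cochain_pullback 1 V q a = char_cocycle V s"
    and s': "line_orientation \<xi> s'" "a' \<in> cocycles 1 P"
      "cochain_pullback 1 V q a' = char_cocycle V s'"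
  shows "cohomology_class 1 P a = cohomology_class 1 P a'"
proof -
  define r where "r l = (let e = SOME e. e \<in> l in s e + s' e)" for l
  have r: "r (q e) = s e + s' e" if e: "e \<in> topspace V" for e
  proof -
    have "(SOME e'. e' \<in> q e) \<in> q e" using self_in_line[OF e] by (rule someI)
    then obtain t where t: "t \<noteq> 0" "(SOME e'. e' \<in> q e) = scale t e"
      by (auto simp: line_through_def)
    have "s (scale t e) = s e + (if t < 0 then 1 else 0)" "s' (scale t e) = s' e + (if t < 0 then 1 else 0)"
      using s(1) s'(1) t(1) e unfolding line_orientation_def by blast+
    then show ?thesis by (simp add: r_def t(2) algebra_simps)
  qed
  have "cochain_pullback 0 V q (point_cochain P r) = (\<lambda>\<sigma>. point_cochain V s \<sigma> + point_cochain V s' \<sigma>)"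
    unfolding pullback_point_cochain[OF continuous_q]
    using singular_simplex_in_topspace[of 0 V] vertex_in_standard_simplex_0
    by (auto simp: point_cochain_def r fun_eq_iff)
  then have "cochain_pullback 1 V q (char_cocycle P r) =
      cochain_pullback 1 V q (\<lambda>\<sigma>. a \<sigma> + a' \<sigma>)"
    using pullback_coboundary[OF continuous_q, of 0 "point_cochain P r"]
    by (simp add: pullback_add s(3)[simplified] s'(3)[simplified] coboundary_add)
  then have "char_cocycle P r = (\<lambda>\<sigma>. a \<sigma> + a' \<sigma>)"
    using s(2) s'(2) coboundary_in_cochains[of 0 P]
    by (intro pullback_q_inject[of _ 1]) (auto intro: add_in_cochains cocycles_imp_cochains)
  moreover have "char_cocycle P r \<in> coboundaries 1 P"
    by (auto simp: coboundaries_Suc[of _ 0, simplified])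
  ultimately show ?thesis using s(2) s'(2) by (simp add: cohomology_class_eq_iff)
qed

lemma tautological_class_eq:
  assumes "line_orientation \<xi> s"
  shows "tautological_class \<xi> = cohomology_class 1 P (orientation_cochain s)"
  unfolding tautological_class_def
proof (rule the_equality)
  show "\<exists>s' a. line_orientation \<xi> s' \<and> a \<in> cocycles 1 P \<and>
        cochain_pullback 1 V q a = char_cocycle V s' \<and>
        cohomology_class 1 P (orientation_cochain s) = cohomology_class 1 P a"
    using assms orientation_cochain_in_cocycles pullback_orientation_cochain by blast
next
  fix \<alpha>
  assume "\<exists>s' a. line_orientation \<xi> s' \<and> a \<in> cocycles 1 P \<and>
        cochain_pullback 1 V q a = char_cocycle V s' \<and> \<alpha> = cohomology_class 1 P a"
  then show "\<alpha> = cohomology_class 1 P (orientation_cochain s)"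
    using assms orientation_cochain_in_cocycles pullback_orientation_cochain orientation_class_unique by blast
qed

text \<open>The \<open>i\<close>-th coordinate orients the lines on which it does not vanish; the other lines are oriented by their first
  nonzero coordinate, so that the orientation is defined everywhere.\<close>

definition pivot :: "nat \<Rightarrow> (nat \<Rightarrow> real) \<Rightarrow> nat" where
  "pivot i v = (if v i \<noteq> 0 then i else LEAST k. v k \<noteq> 0)"

definition coordinate_orientation :: "nat \<Rightarrow> 'e \<Rightarrow> bit" where
  "coordinate_orientation i e = (if vec e (pivot i (vec e)) < 0 then 1 else 0)"

lemma line_orientation_coordinate: "line_orientation \<xi> (coordinate_orientation i)"
  unfolding line_orientation_def
proof (intro ballI allI impI)
  fix e and t :: real assume e: "e \<in> topspace V" and t: "t \<noteq> 0"
  have "\<exists>k. vec e k \<noteq> 0" using e by (auto simp: topspace_V sq_norm_pos_iff)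
  then have "vec e (pivot i (vec e)) \<noteq> 0"
    unfolding pivot_def using LeastI_ex[of "\<lambda>k. vec e k \<noteq> 0"] by simp
  moreover have "pivot i (\<lambda>k. t * vec e k) = pivot i (vec e)" using t by (simp add: pivot_def)
  ultimately show "coordinate_orientation i (scale t e) = coordinate_orientation i e + (if t < 0 then 1 else 0)"
    using e t by (auto simp: coordinate_orientation_def h_scale topspace_V_T mult_less_0_iff)
qed

definition affine_chart :: "nat \<Rightarrow> 'e set set" where
  "affine_chart i = q ` {e \<in> topspace V. vec e i \<noteq> 0}"

lemma q_in_affine_chart:
  assumes "e \<in> topspace V"
  shows "q e \<in> affine_chart i \<longleftrightarrow> vec e i \<noteq> 0"
proof
  assume "q e \<in> affine_chart i"
  then obtain e' where e': "e' \<in> topspace V" "vec e' i \<noteq> 0" "q e' = q e" by (auto simp: affine_chart_def)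
  then obtain t where "t \<noteq> 0" "e = scale t e'" using q_eqD assms by metis
  with e' show "vec e i \<noteq> 0" by (simp add: h_scale topspace_V_T)
qed (use assms in \<open>auto simp: affine_chart_def\<close>)

lemma openin_affine_chart: "openin P (affine_chart i)"
proof -
  have "openin V {e \<in> topspace V. vec e i \<in> - {0}}"
    by (rule openin_continuous_map_preimage[OF continuous_map_vec]) (simp add: open_Compl flip: open_openin)
  moreover have "{e \<in> topspace V. q e \<in> affine_chart i} = {e \<in> topspace V. vec e i \<in> - {0}}"
    by (auto simp: q_in_affine_chart)
  moreover have "affine_chart i \<subseteq> topspace P" by (auto simp: affine_chart_def topspace_P)
  then have "openin V {e \<in> topspace V. q e \<in> affine_chart i} = openin P (affine_chart i)"
    using quotient_map_q unfolding quotient_map_def by blast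
  ultimately show ?thesis by simp
qed

lemma affine_charts_cover: "topspace P \<subseteq> \<Union> (affine_chart ` {..<d})"
proof
  fix l assume "l \<in> topspace P"
  then obtain e where e: "e \<in> topspace V" "l = q e" by (auto simp: topspace_P)
  then obtain i where "i < d" "vec e i \<noteq> 0" by (auto simp: topspace_V sq_norm_pos_iff)
  with e show "l \<in> \<Union> (affine_chart ` {..<d})" by (auto simp: q_in_affine_chart)
qed

text \<open>Along a lift of a path in the affine chart the \<open>i\<close>-th coordinate has no zero, so it does not change its sign.\<close>

lemma coordinate_orientation_vanishes:
  assumes "\<sigma> \<in> standard_simplex 1 \<rightarrow> affine_chart i"
  shows "orientation_cochain (coordinate_orientation i) \<sigma> = 0"
proof (cases "singular_simplex 1 P \<sigma>")
  case True
  then obtain \<sigma>' where \<sigma>': "singular_simplex 1 V \<sigma>'" "simplex_map 1 q \<sigma>' = \<sigma>" by (rule simplex_lift)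
  let ?\<Delta> = "standard_simplex 1"
  have ne: "vec (\<sigma>' x) i \<noteq> 0" if "x \<in> ?\<Delta>" for x
  proof -
    have "\<sigma>' x \<in> topspace V" using singular_simplex_in_topspace \<sigma>'(1) that by fast
    moreover have "q (\<sigma>' x) = \<sigma> x" using \<sigma>'(2) that by (auto simp: simplex_map_def)
    then have "q (\<sigma>' x) \<in> affine_chart i" using funcset_mem[OF assms that] by simp
    ultimately show ?thesis by (simp add: q_in_affine_chart)
  qed
  have cont: "continuous_on ?\<Delta> (\<lambda>x. vec (\<sigma>' x) i)"
    using continuous_map_compose[OF _ continuous_map_vec[of i], of _ \<sigma>'] \<sigma>'(1)
    by (simp add: singular_simplex_def continuous_map_standard_simplex_iff[symmetric] o_def)
  have sign: "vec (\<sigma>' x) i < 0 \<longleftrightarrow> vec (\<sigma>' y) i < 0" if "x \<in> ?\<Delta>" "y \<in> ?\<Delta>" for x y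
    using singular_simplex_constant_sign[OF cont _ that] ne by blast
  have "coordinate_orientation i (\<sigma>' path_start) = coordinate_orientation i (\<sigma>' path_end)"
    using ne[OF path_ends_in(1)] ne[OF path_ends_in(2)] sign[OF path_ends_in]
    by (simp add: coordinate_orientation_def pivot_def)
  then have "char_cocycle V (coordinate_orientation i) \<sigma>' = 0"
    by (simp add: char_cocycle_path[OF \<sigma>'(1)])
  then show ?thesis
    using fun_cong[OF pullback_orientation_cochain[OF line_orientation_coordinate], of i \<sigma>'] \<sigma>'
    by (simp add: cochain_pullback_def)
qed (simp add: orientation_cochain_def)

abbreviation taut :: "'e set cochain" where
  "taut \<equiv> orientation_cochain (coordinate_orientation 0)"

lemma taut_in_cocycles: "taut \<in> cocycles 1 P"
  by (rule orientation_cochain_in_cocycles[OF line_orientation_coordinate])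

lemma tautological_class_coordinate:
  "tautological_class \<xi> = cohomology_class 1 P (orientation_cochain (coordinate_orientation i))"
  by (rule tautological_class_eq[OF line_orientation_coordinate])

lemma cup_power_tautological: "cup_power P (tautological_class \<xi>) k = cohomology_class k P (cup_prod P (\<lambda>_. taut) k)"
  by (intro cup_power_cohomology_class taut_in_cocycles tautological_class_coordinate[symmetric])

text \<open>The \<open>i\<close>-th factor of a product that represents \<open>x\<^sup>d\<close> may be taken with respect to the \<open>i\<close>-th coordinate; then the
  product vanishes on the simplices in each of the \<open>d\<close> affine charts, which cover \<open>P\<close>.\<close>

lemma tautological_power_vanishes: "cup_prod P (\<lambda>_. taut) d \<in> coboundaries d P"
proof -
  let ?x = "\<lambda>i. orientation_cochain (coordinate_orientation i)"
  have x: "?x i \<in> cocycles 1 P" for i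
    by (rule orientation_cochain_in_cocycles[OF line_orientation_coordinate])
  have "cohomology_class d P (cup_prod P (\<lambda>_. taut) d) = cohomology_class d P (cup_prod P ?x d)"
    unfolding cup_power_tautological[symmetric]
    by (intro cup_power_cohomology_class x tautological_class_coordinate[symmetric])
  moreover have "cup_prod P ?x d \<in> coboundaries d P"
  proof (cases d)
    case 0
    then have "topspace P = {}" using affine_charts_cover by auto
    then have "cup_prod P ?x d = (\<lambda>\<sigma>. 0)"
      using 0 by (auto simp: unit_cochain_def singular_simplex_empty)
    then show ?thesis by simp
  next
    case (Suc n)
    have "cup_prod P ?x (Suc n) \<in> coboundaries (Suc n) P"
    proof (rule vanishing_on_small_simplices_imp_coboundary[of "affine_chart ` {..<d}"])
      show "cup_prod P ?x (Suc n) \<in> cocycles (Suc n) P" by (rule cup_prod_in_cocycles) (rule x)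
      show "cup_prod P ?x (Suc n) \<sigma> = 0"
        if "U \<in> affine_chart ` {..<d}" "\<sigma> \<in> standard_simplex (Suc n) \<rightarrow> U" for U \<sigma>
      proof -
        from that(1) obtain i where i: "i < Suc n" "U = affine_chart i" using Suc by auto
        show ?thesis
          by (rule cup_prod_vanishes[where U = affine_chart and i = i])
             (use i that(2) coordinate_orientation_vanishes in auto)
      qed
    qed (use openin_affine_chart affine_charts_cover in auto)
    then show ?thesis by (simp add: Suc)
  qed
  ultimately show ?thesis
    using cup_prod_in_cocycles[of d "\<lambda>_. taut" P] cup_prod_in_cocycles[of d ?x P] x
    by (simp flip: cohomology_class_eq_one_iff)
qed

section \<open>The Stiefel--Whitney classes of a trivialised bundle\<close>

abbreviation relation_term :: "(nat \<Rightarrow> 'b cochain) \<Rightarrow> nat \<Rightarrow> 'e set cochain" where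
  "relation_term a i \<equiv> cochain_cup i (d - i) P (cochain_pullback i P (projectivisation_proj \<xi>) (a i))
     (cup_prod P (\<lambda>_. taut) (d - i))"

definition relation_cochain :: "(nat \<Rightarrow> 'b cochain) \<Rightarrow> 'e set cochain" where
  "relation_cochain a = (\<lambda>\<sigma>. \<Sum>i\<le>d. relation_term a i \<sigma>)"

lemma relation_term_in_cocycles:
  assumes "a i \<in> cocycles i B" "i \<le> d"
  shows "relation_term a i \<in> cocycles d P"
  using cup_in_cocycles[OF pullback_in_cocycles[OF continuous_proj assms(1)] cup_prod_in_cocycles[of "d - i" "\<lambda>_. taut" P]]
    taut_in_cocycles assms(2) by simp

lemma relation_class_eq:
  assumes a: "\<And>i. i \<le> d \<Longrightarrow> a i \<in> cocycles i B"
    and w: "\<And>i. i \<le> d \<Longrightarrow> w i = cohomology_class i B (a i)"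
  shows "finprod (cohomology_group d P)
       (\<lambda>i. cup_class i (d - i) P (pullback_class i P (projectivisation_proj \<xi>) (w i))
          (cup_power P (tautological_class \<xi>) (d - i))) {..d} = cohomology_class d P (relation_cochain a)"
proof -
  interpret comm_group "cohomology_group d P" by (rule comm_group_cohomology_group)
    have term_eq: "cup_class i (d - i) P (pullback_class i P (projectivisation_proj \<xi>) (w i))
          (cup_power P (tautological_class \<xi>) (d - i)) = cohomology_class d P (relation_term a i)" if i: "i \<le> d" for i
    using cup_cohomology_class[OF pullback_in_cocycles[OF continuous_proj a[OF i]]
        cup_prod_in_cocycles[of "d - i" "\<lambda>_. taut" P]] taut_in_cocycles i
    by (simp add: w[OF i] pullback_cohomology_class[OF continuous_proj a[OF i]] cup_power_tautological)
  have "finprod (cohomology_group d P)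
       (\<lambda>i. cup_class i (d - i) P (pullback_class i P (projectivisation_proj \<xi>) (w i))
          (cup_power P (tautological_class \<xi>) (d - i))) {..d} =
     finprod (cohomology_group d P) (\<lambda>i. cohomology_class d P (relation_term a i)) {..d}"
    by (rule finprod_cong') (use term_eq relation_term_in_cocycles a in \<open>auto simp: carrier_cohomology_group\<close>)
  also have "\<dots> = cohomology_class d P (relation_cochain a)"
    unfolding relation_cochain_def
    by (rule finprod_cohomology_class) (use relation_term_in_cocycles a in auto)
  finally show ?thesis .
qed

lemma relation_in_cocycles:
  assumes "\<And>i. i \<le> d \<Longrightarrow> a i \<in> cocycles i B"
  shows "relation_cochain a \<in> cocycles d P"
  unfolding relation_cochain_def by (intro sum_in_cocycles relation_term_in_cocycles assms) auto

lemma relation_leading_term: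
  "cochain_cup 0 d P (cochain_pullback 0 P (projectivisation_proj \<xi>) (unit_cochain B)) (cup_prod P (\<lambda>_. taut) d) =
     cup_prod P (\<lambda>_. taut) d"
  using taut_in_cocycles cup_prod_in_cocycles[of d "\<lambda>_. taut" P]
  by (simp add: pullback_unit[OF continuous_proj] cup_unit_left cocycles_imp_cochains)

definition trivial_family :: "nat \<Rightarrow> 'b cochain set" where
  "trivial_family i = (if i = 0 then unit_class B else \<one>\<^bsub>cohomology_group i B\<^esub>)"

lemma stiefel_whitney_family_trivial: "stiefel_whitney_family \<xi> trivial_family"
proof -
  define a where "a i = (if i = 0 then unit_cochain B else (\<lambda>\<sigma>. 0))" for i :: nat
  have a: "a i \<in> cocycles i B" and w: "trivial_family i = cohomology_class i B (a i)" for i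
    by (auto simp: a_def trivial_family_def unit_class_eq one_cohomology_group)
  have "relation_cochain a = cup_prod P (\<lambda>_. taut) d"
  proof -
    have "relation_term a i =
        (\<lambda>\<sigma>. if i = 0 then cup_prod P (\<lambda>_. taut) d \<sigma> else 0)" for i
      using relation_leading_term by (cases "i = 0") (simp_all add: a_def)
    then show ?thesis by (simp add: relation_cochain_def)
  qed
  then have "cohomology_class d P (relation_cochain a) = \<one>\<^bsub>cohomology_group d P\<^esub>"
    using tautological_power_vanishes by (simp add: cohomology_class_eq_one_iff coboundaries_imp_cocycles)
  with relation_class_eq[of a trivial_family, OF a w] show ?thesis
    unfolding stiefel_whitney_family_def base_eq dim_eq
  proof (intro conjI allI impI)
    show "trivial_family i \<in> carrier (cohomology_group i B)" for i
      unfolding carrier_cohomology_group w using a by blast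
  qed (simp_all add: trivial_family_def)
qed

lemma continuous_map_sphere_hinv:
  assumes d: "d = Suc n"
  shows "continuous_map (sphere_product n B) V hinv"
proof -
  have sub: "sphere_product n B =
      subtopology (prod_topology B (Euclidean_space d)) (topspace B \<times> {x. (\<Sum>i\<le>n. x i ^ 2) = 1})"
    by (simp add: sphere_product_def nsphere_def d prod_topology_subtopology)
  have in_prod: "y \<in> topspace (prod_topology B (Euclidean_space d))" if "y \<in> topspace (sphere_product n B)" for y
    using that unfolding sub by simp
  have "hinv y \<in> topspace V" if y: "y \<in> topspace (sphere_product n B)" for y
  proof -
    have "sq_norm (snd y) = 1"
      using y by (auto simp: sphere_product_def topspace_nsphere d lessThan_Suc_atMost)
    with hinv_in[OF in_prod[OF y]] show ?thesis
      unfolding topspace_V h_hinv[OF in_prod[OF y]] by simp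
  qed
  moreover have "continuous_map (sphere_product n B) T hinv"
    unfolding sub by (rule continuous_map_from_subtopology[OF continuous_hinv])
  ultimately show ?thesis
    unfolding nonzero_vectors_def by (auto simp: continuous_map_in_subtopology)
qed

lemma hinv_antipode:
  assumes d: "d = Suc n" and y: "y \<in> topspace (sphere_product n B)"
  shows "hinv (antipode y) = scale (- 1) (hinv y)"
proof -
  have V: "hinv y \<in> topspace V" "hinv (antipode y) \<in> topspace V"
    using continuous_map_sphere_hinv[OF d] continuous_map_antipode[of n B] y by (auto simp: continuous_map_def)
  have "topspace (sphere_product n B) \<subseteq> topspace (prod_topology B (Euclidean_space d))"
    by (auto simp: sphere_product_def topspace_nsphere topspace_Euclidean_space d)
  then have in_prod: "y \<in> topspace (prod_topology B (Euclidean_space d))"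
      "antipode y \<in> topspace (prod_topology B (Euclidean_space d))"
    using continuous_map_antipode[of n B] y by (auto simp: continuous_map_def)
  have "h (hinv (antipode y)) = h (scale (- 1) (hinv y))"
    by (simp only: h_hinv[OF in_prod(1)] h_hinv[OF in_prod(2)] h_scale[OF topspace_V_T[OF V(1)]])
       (simp add: antipode_def)
  then show ?thesis
    by (intro h_eqD scale_closed topspace_V_T V)
qed

text \<open>On \<open>B \<times> S\<^sup>d\<^sup>-\<^sup>1\<close>, the relation in the cohomology of the projectivisation is an equation between cochains that are
  invariant under the antipode.\<close>

lemma relation_imp_coboundaries:
  assumes a: "\<And>i. i \<le> d \<Longrightarrow> a i \<in> cocycles i B" and a0: "a 0 = unit_cochain B"
    and rel: "relation_cochain a \<in> coboundaries d P"
    and i: "1 \<le> i" "i \<le> d"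
  shows "a i \<in> coboundaries i B"
proof -
  obtain n where d: "d = Suc n" using i by (cases d) auto
  let ?Y = "sphere_product n B"
  let ?g = "q \<circ> hinv" and ?s = "coordinate_orientation 0 \<circ> hinv"
  note hV = continuous_map_sphere_hinv[OF d]
  have g: "continuous_map ?Y P ?g" by (rule continuous_map_compose[OF hV continuous_q])
  have hinv_V: "hinv y \<in> topspace V" if "y \<in> topspace ?Y" for y
    using hV that by (auto simp: continuous_map_def)
  have g_antipode: "?g (antipode y) = ?g y" if "y \<in> topspace ?Y" for y
    using that hinv_V[OF that] by (simp add: hinv_antipode[OF d] q_scale)
  have invariant: "cochain_pullback p ?Y antipode (cochain_pullback p ?Y ?g b) = cochain_pullback p ?Y ?g b" for p b
    unfolding pullback_pullback[OF continuous_map_antipode] by (rule pullback_cong) (simp add: g_antipode[unfolded comp_apply])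
  have s: "odd_function ?Y antipode ?s"
    unfolding odd_function_def
  proof
    fix y assume y: "y \<in> topspace ?Y"
    have "coordinate_orientation 0 (scale (- 1) (hinv y)) = coordinate_orientation 0 (hinv y) + (if (- 1 :: real) < 0 then 1 else 0)"
      using line_orientation_coordinate[of 0] hinv_V[OF y] unfolding line_orientation_def by (metis neg_equal_0_iff_equal zero_neq_one)
    with y show "?s (antipode y) = ?s y + 1" by (simp add: hinv_antipode[OF d])
  qed
  have taut: "cochain_pullback 1 ?Y ?g taut = char_cocycle ?Y ?s"
  proof -
    have "cochain_pullback 1 ?Y ?g taut = cochain_pullback 1 ?Y hinv (cochain_pullback 1 V q taut)"
      by (simp only: pullback_pullback[OF hV])
    also have "\<dots> = coboundary 0 ?Y (cochain_pullback 0 ?Y hinv (point_cochain V (coordinate_orientation 0)))"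
      using pullback_coboundary[OF hV, of 0]
      unfolding pullback_orientation_cochain[OF line_orientation_coordinate] by simp
    finally show ?thesis by (simp only: pullback_point_cochain[OF hV])
  qed
  have proj: "cochain_pullback p ?Y ?g (cochain_pullback p P (projectivisation_proj \<xi>) b) = cochain_pullback p ?Y fst b" for p b
    unfolding pullback_pullback[OF g]
  proof (rule pullback_cong)
    fix y assume y: "y \<in> topspace ?Y"
    have "y \<in> topspace (prod_topology B (Euclidean_space d))"
      using y by (auto simp: sphere_product_def topspace_nsphere topspace_Euclidean_space d)
    then show "(projectivisation_proj \<xi> \<circ> ?g) y = fst y" by (simp add: proj_q[OF hinv_V[OF y]] h_hinv)
  qed
  obtain b where b: "b \<in> cochains n P" "relation_cochain a = coboundary n P b"
    using rel by (auto simp: d coboundaries_Suc)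
  obtain e where e: "e \<in> cochains n P" "cup_prod P (\<lambda>_. taut) d = coboundary n P e"
    using tautological_power_vanishes by (auto simp: d coboundaries_Suc)
    have split: "coboundary n P (\<lambda>\<sigma>. b \<sigma> + e \<sigma>) = (\<lambda>\<sigma>. \<Sum>i=1..Suc n. relation_term a i \<sigma>)"
  proof
    fix \<sigma>
    have "{..d} = insert 0 {1..Suc n}" by (auto simp: d)
    then have "relation_cochain a \<sigma> = relation_term a 0 \<sigma> + (\<Sum>i=1..Suc n. relation_term a i \<sigma>)"
      by (simp add: relation_cochain_def del: sum.cl_ivl_Suc)
    also have "relation_term a 0 = cup_prod P (\<lambda>_. taut) d" using relation_leading_term by (simp add: a0)
    finally show "coboundary n P (\<lambda>\<sigma>. b \<sigma> + e \<sigma>) \<sigma> = (\<Sum>i=1..Suc n. relation_term a i \<sigma>)"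
      by (simp add: coboundary_add b(2)[symmetric] e(2)[symmetric] add.assoc[symmetric] add.commute del: sum.cl_ivl_Suc)
  qed
  have "cochain_pullback (Suc n) ?Y ?g (\<lambda>\<sigma>. \<Sum>i=1..Suc n. relation_term a i \<sigma>) = sphere_relation_cochain n B ?s a (Suc n)"
  proof -
    have "cochain_pullback d ?Y ?g (relation_term a i) =
       cochain_cup i (d - i) ?Y (cochain_pullback i ?Y fst (a i)) (cup_prod ?Y (\<lambda>_. char_cocycle ?Y ?s) (d - i))"
      if "i \<in> {1..d}" for i
      using that pullback_cup[OF g, of i "d - i"] by (simp add: proj pullback_cup_prod[OF g] taut[unfolded One_nat_def])
    then show ?thesis
      unfolding pullback_sum sphere_relation_cochain_def d[symmetric] by (intro ext sum.cong refl) simp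
  qed
  then have "sphere_relation_cochain n B ?s a (Suc n) = coboundary n ?Y (cochain_pullback n ?Y ?g (\<lambda>\<sigma>. b \<sigma> + e \<sigma>))"
    unfolding split[symmetric] pullback_coboundary[OF g] ..
  then have "equivariantly_exact n ?Y antipode (sphere_relation_cochain n B ?s a (Suc n))"
    unfolding equivariantly_exact_def by (intro bexI conjI) (auto simp: invariant)
  then show ?thesis
    by (intro sphere_relation_trivial[OF _ s]) (use a i d in auto)
qed

theorem stiefel_whitney_class_trivialised:
  assumes "1 \<le> i"
  shows "stiefel_whitney_class \<xi> i = \<one>\<^bsub>cohomology_group i B\<^esub>"
proof -
  have "w = trivial_family" if fam: "stiefel_whitney_family \<xi> w" for w
  proof
    fix i
    have w0: "w 0 = unit_class B" and w_above: "\<And>i. i > d \<Longrightarrow> w i = \<one>\<^bsub>cohomology_group i B\<^esub>"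
      and "\<forall>i. \<exists>a. a \<in> cocycles i B \<and> w i = cohomology_class i B a"
      using fam by (auto simp: stiefel_whitney_family_def base_eq dim_eq carrier_cohomology_group)
    then obtain a' where a': "\<And>i. a' i \<in> cocycles i B" "\<And>i. w i = cohomology_class i B (a' i)" by metis
    define a where "a = a'(0 := unit_cochain B)"
    have a: "a i \<in> cocycles i B" "w i = cohomology_class i B (a i)" for i
      using a' w0 by (auto simp: a_def unit_class_eq)
    have "cohomology_class d P (relation_cochain a) = \<one>\<^bsub>cohomology_group d P\<^esub>"
      using fam relation_class_eq[of a w] a by (simp add: stiefel_whitney_family_def base_eq dim_eq)
    then have rel: "relation_cochain a \<in> coboundaries d P"
      using relation_in_cocycles[of a] a(1) by (simp add: cohomology_class_eq_one_iff)
    show "w i = trivial_family i"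
    proof (cases "1 \<le> i \<and> i \<le> d")
      case True
      then have "a i \<in> coboundaries i B"
        using relation_imp_coboundaries[OF a(1) _ rel] by (simp add: a_def)
      with True a show ?thesis by (simp add: trivial_family_def cohomology_class_eq_one_iff)
    next
      case False
      then show ?thesis using w0 w_above by (cases "i = 0") (auto simp: trivial_family_def)
    qed
  qed
  then have "stiefel_whitney_class \<xi> = trivial_family"
    unfolding stiefel_whitney_class_def using stiefel_whitney_family_trivial by (intro the_equality)
  with assms show ?thesis by (simp add: trivial_family_def)
qed

end

section \<open>Calculus on open subsets of Euclidean spaces\<close>

lemma openin_Euclidean_space_box:
  assumes "openin (Euclidean_space m) U" "x \<in> U"
  obtains e where "e > 0" "\<And>y. y \<in> topspace (Euclidean_space m) \<Longrightarrow> (\<And>i. i < m \<Longrightarrow> \<bar>y i - x i\<bar> < e) \<Longrightarrow> y \<in> U"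
proof -
  obtain T where T: "openin (powertop_real UNIV) T" "U = T \<inter> {x. \<forall>i\<ge>m. x i = 0}"
    using assms(1) by (auto simp: Euclidean_space_def openin_subtopology)
  obtain X where X: "x \<in> (\<Pi>\<^sub>E i\<in>UNIV. X i)" "\<And>i. openin euclideanreal (X i)" "(\<Pi>\<^sub>E i\<in>UNIV. X i) \<subseteq> T"
    using product_topology_open_contains_basis[OF T(1), of x] assms(2) T(2) by auto
  have "\<forall>i. \<exists>e>0. \<forall>t. \<bar>t - x i\<bar> < e \<longrightarrow> t \<in> X i"
    using X(1,2) by (auto simp: open_real PiE_iff simp flip: open_openin)
  then obtain \<epsilon> where \<epsilon>: "\<And>i. \<epsilon> i > 0" "\<And>i t. \<bar>t - x i\<bar> < \<epsilon> i \<Longrightarrow> t \<in> X i" by metis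
  define e where "e = Min (insert 1 (\<epsilon> ` {..<m}))"
  have e: "e > 0" "\<And>i. i < m \<Longrightarrow> e \<le> \<epsilon> i" using \<epsilon>(1) by (auto simp: e_def)
  show ?thesis
  proof (rule that[OF e(1)])
    fix y assume y: "y \<in> topspace (Euclidean_space m)" "\<And>i. i < m \<Longrightarrow> \<bar>y i - x i\<bar> < e"
    have "y i \<in> X i" for i
    proof (cases "i < m")
      case True
      with y(2)[of i] e(2)[of i] show ?thesis by (intro \<epsilon>(2)) auto
    next
      case False
      with y(1) T(2) assms(2) have "y i = x i" by (auto simp: topspace_Euclidean_space)
      with X(1) show ?thesis by (auto simp: PiE_iff)
    qed
    with X(3) y(1) T(2) show "y \<in> U" by (auto simp: topspace_Euclidean_space)
  qed
qed

lemma openin_Euclidean_space_upd: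
  assumes "openin (Euclidean_space m) U" "x \<in> U" "j < m"
  shows "\<forall>\<^sub>F t in nhds (x j). x(j := t) \<in> U"
proof -
  obtain e where e: "e > 0" "\<And>y. y \<in> topspace (Euclidean_space m) \<Longrightarrow> (\<And>i. i < m \<Longrightarrow> \<bar>y i - x i\<bar> < e) \<Longrightarrow> y \<in> U"
    using openin_Euclidean_space_box[OF assms(1,2)] by blast
  have x: "x \<in> topspace (Euclidean_space m)" using assms openin_subset by blast
  have "x(j := t) \<in> U" if "\<bar>t - x j\<bar> < e" for t
    using x assms(3) e(1) that by (intro e(2)) (auto simp: topspace_Euclidean_space)
  with e(1) show ?thesis
    unfolding eventually_nhds_metric by (auto simp: dist_real_def)
qed

lemma continuous_Euclidean_space_box:
  assumes "openin (Euclidean_space m) U" "continuous_map (subtopology (Euclidean_space m) U) euclideanreal f"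
    and "x \<in> U" "r > 0"
  obtains e where "e > 0" "\<And>y. y \<in> topspace (Euclidean_space m) \<Longrightarrow> (\<And>i. i < m \<Longrightarrow> \<bar>y i - x i\<bar> < e) \<Longrightarrow>
      y \<in> U \<and> \<bar>f y - f x\<bar> < r"
proof -
  have "openin (subtopology (Euclidean_space m) U) {y \<in> topspace (subtopology (Euclidean_space m) U). f y \<in> ball (f x) r}"
    by (rule openin_continuous_map_preimage[OF assms(2)]) simp
  then have "openin (Euclidean_space m) {y \<in> topspace (subtopology (Euclidean_space m) U). f y \<in> ball (f x) r}"
    using assms(1) openin_trans_full by blast
  moreover have "x \<in> {y \<in> topspace (subtopology (Euclidean_space m) U). f y \<in> ball (f x) r}"
    using assms openin_subset[OF assms(1)] by auto
  ultimately obtain e where "e > 0" "\<And>y. y \<in> topspace (Euclidean_space m) \<Longrightarrow> (\<And>i. i < m \<Longrightarrow> \<bar>y i - x i\<bar> < e) \<Longrightarrow>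
      y \<in> {y \<in> topspace (subtopology (Euclidean_space m) U). f y \<in> ball (f x) r}"
    by (rule openin_Euclidean_space_box) blast
  with that[of e] show ?thesis by (auto simp: dist_real_def abs_minus_commute)
qed

lemma mean_value_between:
  fixes f :: "real \<Rightarrow> real"
  assumes "\<And>s. min a b \<le> s \<Longrightarrow> s \<le> max a b \<Longrightarrow> (f has_real_derivative f' s) (at s)"
  obtains z where "min a b \<le> z" "z \<le> max a b" "f b - f a = (b - a) * f' z"
proof -
  consider "a < b" | "b < a" | "a = b" by linarith
  then show ?thesis
  proof cases
    case 1
    then obtain z where "a < z" "z < b" "f b - f a = (b - a) * f' z"
      using MVT2[of a b f f'] assms by auto
    with 1 show ?thesis by (intro that[of z]) auto
  next
    case 2
    then obtain z where "b < z" "z < a" "f a - f b = (a - b) * f' z"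
      using MVT2[of b a f f'] assms by auto
    with 2 show ?thesis by (intro that[of z]) (auto simp: algebra_simps)
  next
    case 3
    then show ?thesis by (intro that[of a]) auto
  qed
qed

text \<open>The chain rule from continuity of the partial derivatives: change the coordinates of the argument one at a
  time and apply the mean value theorem to each change.\<close>

lemma chain_rule_partial_deriv:
  assumes U: "openin (Euclidean_space m) U"
    and diff: "\<And>j x. j < m \<Longrightarrow> x \<in> U \<Longrightarrow> (\<lambda>t. f (x(j := t))) field_differentiable at (x j)"
    and cont: "\<And>j. j < m \<Longrightarrow> continuous_map (subtopology (Euclidean_space m) U) euclideanreal (partial_deriv j f)"
    and \<gamma>: "\<gamma> t0 \<in> U" "\<forall>\<^sub>F t in nhds t0. \<gamma> t \<in> topspace (Euclidean_space m)"
    and \<gamma>': "\<And>i. i < m \<Longrightarrow> ((\<lambda>t. \<gamma> t i) has_real_derivative \<gamma>' i) (at t0)"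
  shows "((\<lambda>t. f (\<gamma> t)) has_real_derivative (\<Sum>i<m. partial_deriv i f (\<gamma> t0) * \<gamma>' i)) (at t0)"
proof -
  define x where "x = \<gamma> t0"
  have x: "x \<in> U" "x \<in> topspace (Euclidean_space m)" using \<gamma> U openin_subset by (auto simp: x_def)
  define mix where "mix k t = (\<lambda>i. if i < k then \<gamma> t i else x i)" for k t
  have close: "\<forall>\<^sub>F t in nhds t0. \<forall>i<m. \<bar>\<gamma> t i - x i\<bar> < e" if "e > 0" for e
  proof -
    have "\<forall>\<^sub>F t in nhds t0. \<bar>\<gamma> t i - x i\<bar> < e" if "i < m" for i
    proof -
      have "isCont (\<lambda>t. \<gamma> t i) t0" using \<gamma>'[OF that] by (rule DERIV_isCont)
      then have "((\<lambda>t. \<gamma> t i) \<longlongrightarrow> x i) (nhds t0)"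
        using tendsto_at_iff_tendsto_nhds[of "\<lambda>t. \<gamma> t i" t0] by (simp add: isCont_def x_def)
      from tendstoD[OF this \<open>e > 0\<close>] show ?thesis by (simp add: dist_real_def)
    qed
    then have "\<forall>\<^sub>F t in nhds t0. \<forall>i\<in>{..<m}. \<bar>\<gamma> t i - x i\<bar> < e"
      by (intro eventually_ball_finite) auto
    then show ?thesis by (rule eventually_mono) auto
  qed
  have main: "((\<lambda>t. f (mix k t)) has_real_derivative (\<Sum>i<k. partial_deriv i f x * \<gamma>' i)) (at t0)" if "k \<le> m" for k
    using that
  proof (induction k)
    case 0
    then show ?case by (simp add: mix_def)
  next
    case (Suc k)
    then have k: "k < m" by simp
    let ?D = "\<lambda>t. f (mix (Suc k) t) - f (mix k t)"
    obtain e0 where e0: "e0 > 0"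
      "\<And>y. y \<in> topspace (Euclidean_space m) \<Longrightarrow> (\<And>i. i < m \<Longrightarrow> \<bar>y i - x i\<bar> < e0) \<Longrightarrow> y \<in> U"
      using openin_Euclidean_space_box[OF U x(1)] by blast
    have mix_top: "mix k t \<in> topspace (Euclidean_space m)" for t
      using x(2) k by (auto simp: mix_def topspace_Euclidean_space)
    have ex: "\<exists>z. z \<in> topspace (Euclidean_space m) \<and> (\<forall>i<m. \<bar>z i - x i\<bar> \<le> \<bar>\<gamma> t i - x i\<bar>) \<and>
        ?D t = (\<gamma> t k - x k) * partial_deriv k f z" if t: "\<forall>i<m. \<bar>\<gamma> t i - x i\<bar> < e0" for t
    proof -
      let ?y = "\<lambda>s. (mix k t)(k := s)"
      have y_top: "?y s \<in> topspace (Euclidean_space m)" for s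
        using mix_top[of t] k by (auto simp: topspace_Euclidean_space)
      have y_close: "\<bar>?y s i - x i\<bar> \<le> \<bar>\<gamma> t i - x i\<bar>" if "min (x k) (\<gamma> t k) \<le> s" "s \<le> max (x k) (\<gamma> t k)" for s i
        using that by (auto simp: mix_def)
      have "((\<lambda>s. f (?y s)) has_real_derivative partial_deriv k f (?y s)) (at s)"
        if s: "min (x k) (\<gamma> t k) \<le> s" "s \<le> max (x k) (\<gamma> t k)" for s
      proof -
        have "?y s \<in> U" using t by (intro e0(2) y_top le_less_trans[OF y_close[OF s]]) blast
        from diff[OF k this] show ?thesis
          by (simp add: partial_deriv_def field_differentiable_derivI)
      qed
      then obtain z where z: "min (x k) (\<gamma> t k) \<le> z" "z \<le> max (x k) (\<gamma> t k)"
          "f (?y (\<gamma> t k)) - f (?y (x k)) = (\<gamma> t k - x k) * partial_deriv k f (?y z)"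
        using mean_value_between[of "x k" "\<gamma> t k" "\<lambda>s. f (?y s)" "\<lambda>s. partial_deriv k f (?y s)"] by metis
      moreover have "?y (\<gamma> t k) = mix (Suc k) t" "?y (x k) = mix k t"
        by (auto simp: mix_def fun_eq_iff less_Suc_eq)
      ultimately show ?thesis
        using y_top y_close by (intro exI[of _ "?y z"]) auto
    qed
    then obtain z where z: "\<And>t. \<forall>i<m. \<bar>\<gamma> t i - x i\<bar> < e0 \<Longrightarrow> z t \<in> topspace (Euclidean_space m) \<and>
        (\<forall>i<m. \<bar>z t i - x i\<bar> \<le> \<bar>\<gamma> t i - x i\<bar>) \<and> ?D t = (\<gamma> t k - x k) * partial_deriv k f (z t)"
      by metis
    have lim: "((\<lambda>t. partial_deriv k f (z t)) \<longlongrightarrow> partial_deriv k f x) (at t0)"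
    proof (rule tendstoI)
      fix r :: real assume "r > 0"
      then obtain e where e: "e > 0" "\<And>y. y \<in> topspace (Euclidean_space m) \<Longrightarrow> (\<And>i. i < m \<Longrightarrow> \<bar>y i - x i\<bar> < e) \<Longrightarrow>
          y \<in> U \<and> \<bar>partial_deriv k f y - partial_deriv k f x\<bar> < r"
        using continuous_Euclidean_space_box[OF U cont[OF k] x(1)] by metis
      have "\<forall>\<^sub>F t in nhds t0. \<bar>partial_deriv k f (z t) - partial_deriv k f x\<bar> < r"
        using close[OF e(1)] close[OF e0(1)]
      proof eventually_elim
        case (elim t)
        have "\<bar>z t i - x i\<bar> < e" if "i < m" for i
          using z[OF elim(2)] elim(1) that by (meson le_less_trans)
        with e(2)[of "z t"] z[OF elim(2)] show ?case by blast
      qed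
      then show "\<forall>\<^sub>F t in at t0. dist (partial_deriv k f (z t)) (partial_deriv k f x) < r"
        by (simp add: dist_real_def eventually_nhds_conv_at)
    qed
    have "((\<lambda>t. (\<gamma> t k - x k) / (t - t0)) \<longlongrightarrow> \<gamma>' k) (at t0)"
      using \<gamma>'[OF k] by (simp add: has_field_derivative_iff x_def)
    from tendsto_mult[OF this lim]
    have "((\<lambda>t. (\<gamma> t k - x k) / (t - t0) * partial_deriv k f (z t)) \<longlongrightarrow> partial_deriv k f x * \<gamma>' k) (at t0)"
      by (simp add: mult.commute)
    moreover have "\<forall>\<^sub>F t in at t0. (\<gamma> t k - x k) / (t - t0) * partial_deriv k f (z t) = (?D t - ?D t0) / (t - t0)"
    proof -
      have "mix (Suc k) t0 = mix k t0" by (auto simp: mix_def x_def fun_eq_iff)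
      then have "?D t0 = 0" by simp
      moreover have "\<forall>\<^sub>F t in at t0. \<forall>i<m. \<bar>\<gamma> t i - x i\<bar> < e0"
        using close[OF e0(1)] by (simp add: eventually_nhds_conv_at)
      ultimately show ?thesis
        by (elim eventually_mono) (simp add: z)
    qed
    ultimately have "((\<lambda>t. (?D t - ?D t0) / (t - t0)) \<longlongrightarrow> partial_deriv k f x * \<gamma>' k) (at t0)"
      by (rule Lim_transform_eventually)
    then have "(?D has_real_derivative partial_deriv k f x * \<gamma>' k) (at t0)"
      by (simp add: has_field_derivative_iff)
    from DERIV_add[OF Suc.IH this] k show ?case by simp
  qed
  have "\<forall>\<^sub>F t in nhds t0. f (mix m t) = f (\<gamma> t)"
    using \<gamma>(2)
  proof eventually_elim
    case (elim t)
    with x(2) have "mix m t = \<gamma> t" by (auto simp: mix_def fun_eq_iff topspace_Euclidean_space)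
    then show ?case by simp
  qed
  then show ?thesis
    using main[of m] DERIV_cong_ev[OF refl _ refl, of "\<lambda>t. f (mix m t)" "\<lambda>t. f (\<gamma> t)" t0] by (simp add: x_def)
qed

section \<open>Functions of class \<open>C\<^sup>k\<close>\<close>

lemma partial_deriv_cong:
  assumes "openin (Euclidean_space d) U" "x \<in> U" "j < d" "\<And>y. y \<in> U \<Longrightarrow> f y = g y"
  shows "partial_deriv j f x = partial_deriv j g x"
    and "(\<lambda>t. f (x(j := t))) field_differentiable at (x j) \<Longrightarrow> (\<lambda>t. g (x(j := t))) field_differentiable at (x j)"
proof -
  have ev: "\<forall>\<^sub>F t in nhds (x j). f (x(j := t)) = g (x(j := t))"
    using openin_Euclidean_space_upd[OF assms(1-3)] by (rule eventually_mono) (rule assms(4))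
  then show "partial_deriv j f x = partial_deriv j g x"
    unfolding partial_deriv_def by (rule deriv_cong_ev) simp
  show "(\<lambda>t. g (x(j := t))) field_differentiable at (x j)" if "(\<lambda>t. f (x(j := t))) field_differentiable at (x j)"
    using that DERIV_cong_ev[OF refl ev refl] unfolding field_differentiable_def by blast
qed

lemma partial_deriv_has_derivative:
  "(\<lambda>t. f (x(j := t))) field_differentiable at (x j) \<Longrightarrow>
     ((\<lambda>t. f (x(j := t))) has_real_derivative partial_deriv j f x) (at (x j))"
  unfolding partial_deriv_def by (simp add: field_differentiable_derivI)

lemma Ck_on_Suc_differentiable:
  assumes "Ck_on d (Suc k) U f" "j < d" "x \<in> U"
  shows "(\<lambda>t. f (x(j := t))) field_differentiable at (x j)"
  using assms(1)[unfolded Ck_on.simps] assms(2,3) by blast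

lemma Ck_on_Suc_has_derivative:
  assumes "Ck_on d (Suc k) U f" "j < d" "x \<in> U"
  shows "((\<lambda>t. f (x(j := t))) has_real_derivative partial_deriv j f x) (at (x j))"
  by (rule partial_deriv_has_derivative[OF Ck_on_Suc_differentiable[OF assms]])

lemma Ck_on_cong:
  assumes "openin (Euclidean_space d) U" "\<And>y. y \<in> U \<Longrightarrow> f y = g y" "Ck_on d k U f"
  shows "Ck_on d k U g"
  using assms(2,3)
proof (induction k arbitrary: f g)
  case 0
  then show ?case by (auto elim!: continuous_map_eq)
next
  case (Suc k)
  have "continuous_map (subtopology (Euclidean_space d) U) euclideanreal g"
    using Suc.prems by (auto elim!: continuous_map_eq)
  moreover have "(\<lambda>t. g (x(j := t))) field_differentiable at (x j)" if "j < d" "x \<in> U" for j x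
    by (rule partial_deriv_cong(2)[OF assms(1) that(2,1) Suc.prems(1) Ck_on_Suc_differentiable[OF Suc.prems(2) that]])
  moreover have "Ck_on d k U (partial_deriv j g)" if "j < d" for j
    by (rule Suc.IH[of "partial_deriv j f"])
       (use Suc.prems that partial_deriv_cong(1)[OF assms(1) _ that Suc.prems(1)] in auto)
  ultimately show ?case by simp
qed

lemma Ck_on_imp_continuous:
  "Ck_on d k U f \<Longrightarrow> continuous_map (subtopology (Euclidean_space d) U) euclideanreal f"
  by (cases k) auto

lemma Ck_on_SucD: "Ck_on d (Suc k) U f \<Longrightarrow> Ck_on d k U f"
  by (induction k arbitrary: f) (auto dest: Ck_on_imp_continuous)

lemma Ck_on_subset:
  "Ck_on d k U f \<Longrightarrow> V \<subseteq> U \<Longrightarrow> Ck_on d k V f"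
  by (induction k arbitrary: f) (auto intro: continuous_map_from_subtopology_mono)

text \<open>Both continuity and the partial derivatives at a point depend only on the values nearby.\<close>

lemma Ck_on_local:
  assumes "\<And>x. x \<in> U \<Longrightarrow> \<exists>V. openin (Euclidean_space d) V \<and> x \<in> V \<and> V \<subseteq> U \<and> Ck_on d k V f"
  shows "Ck_on d k U f"
  using assms
proof (induction k arbitrary: f)
  case 0
  then obtain V where V: "\<And>x. x \<in> U \<Longrightarrow> openin (Euclidean_space d) (V x) \<and> x \<in> V x \<and> V x \<subseteq> U \<and>
      continuous_map (subtopology (Euclidean_space d) (V x)) euclideanreal f"
    by (metis Ck_on.simps(1))
  have sub: "subtopology (subtopology (Euclidean_space d) U) (V x) = subtopology (Euclidean_space d) (V x)" if "x \<in> U" for x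
    using V[OF that] by (simp add: subtopology_subtopology Int_absorb1)
  have "continuous_map (subtopology (Euclidean_space d) U) euclideanreal f"
  proof (rule pasting_lemma[where I = U and T = V and f = "\<lambda>_. f" and g = f])
    show "openin (subtopology (Euclidean_space d) U) (V x)" if "x \<in> U" for x
      using V[OF that] by (metis openin_subtopology_Int2 Int_absorb2 inf_commute)
    show "continuous_map (subtopology (subtopology (Euclidean_space d) U) (V x)) euclideanreal f" if "x \<in> U" for x
      using V[OF that] sub[OF that] by simp
    show "\<exists>j. j \<in> U \<and> x \<in> V j \<and> f x = f x" if "x \<in> topspace (subtopology (Euclidean_space d) U)" for x
      using V that by auto
  qed auto
  then show ?case by simp
next
  case (Suc k)
  have "Ck_on d k U f"
    by (rule Suc.IH) (metis Suc.prems Ck_on_SucD)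
  then have "continuous_map (subtopology (Euclidean_space d) U) euclideanreal f"
    by (rule Ck_on_imp_continuous)
  moreover have "(\<lambda>t. f (x(j := t))) field_differentiable at (x j)" if "j < d" "x \<in> U" for j x
    using Suc.prems[OF that(2)] that by auto
  moreover have "Ck_on d k U (partial_deriv j f)" if "j < d" for j
    by (rule Suc.IH) (use Suc.prems that in fastforce)
  ultimately show ?case by simp
qed

lemma Ck_on_const: "Ck_on d k U (\<lambda>_. c)"
proof (induction k arbitrary: c)
  case (Suc k)
  have "partial_deriv j (\<lambda>_. c) = (\<lambda>_. 0)" for j by (simp add: partial_deriv_def fun_eq_iff)
  with Suc show ?case by simp
qed simp

lemma partial_derivI:
  "((\<lambda>t. f (x(j := t))) has_real_derivative D) (at (x j)) \<Longrightarrow>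
     partial_deriv j f x = D \<and> (\<lambda>t. f (x(j := t))) field_differentiable at (x j)"
  unfolding partial_deriv_def by (auto simp: DERIV_imp_deriv field_differentiable_def)

lemma Ck_on_SucI:
  assumes U: "openin (Euclidean_space d) U"
    and "continuous_map (subtopology (Euclidean_space d) U) euclideanreal f"
    and deriv: "\<And>j x. j < d \<Longrightarrow> x \<in> U \<Longrightarrow> ((\<lambda>t. f (x(j := t))) has_real_derivative D j x) (at (x j))"
    and "\<And>j. j < d \<Longrightarrow> Ck_on d k U (D j)"
  shows "Ck_on d (Suc k) U f"
proof -
  have "Ck_on d k U (partial_deriv j f)" if "j < d" for j
    by (rule Ck_on_cong[OF U _ assms(4)[OF that]]) (simp add: partial_derivI[OF deriv[OF that]])
  moreover have "(\<lambda>t. f (x(j := t))) field_differentiable at (x j)" if "j < d" "x \<in> U" for j x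
    using partial_derivI[OF deriv[OF that]] by blast
  ultimately show ?thesis using assms(2) by (simp del: fun_upd_apply)
qed

lemma Ck_on_add:
  assumes U: "openin (Euclidean_space d) U" and "Ck_on d k U f" "Ck_on d k U g"
  shows "Ck_on d k U (\<lambda>x. f x + g x)"
  using assms(2,3)
proof (induction k arbitrary: f g)
  case 0
  then show ?case by (auto intro: continuous_map_add)
next
  case (Suc k)
  show ?case
  proof (rule Ck_on_SucI[OF U, where D = "\<lambda>j x. partial_deriv j f x + partial_deriv j g x"])
    show "continuous_map (subtopology (Euclidean_space d) U) euclideanreal (\<lambda>x. f x + g x)"
      using Suc.prems by (auto intro: continuous_map_add)
    show "((\<lambda>t. f (x(j := t)) + g (x(j := t))) has_real_derivative partial_deriv j f x + partial_deriv j g x) (at (x j))"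
      if "j < d" "x \<in> U" for j x
      by (intro DERIV_add Ck_on_Suc_has_derivative[OF Suc.prems(1) that] Ck_on_Suc_has_derivative[OF Suc.prems(2) that])
    show "Ck_on d k U (\<lambda>x. partial_deriv j f x + partial_deriv j g x)" if "j < d" for j
      using that Suc.prems by (intro Suc.IH) auto
  qed
qed

lemma Ck_on_mult:
  assumes U: "openin (Euclidean_space d) U" and "Ck_on d k U f" "Ck_on d k U g"
  shows "Ck_on d k U (\<lambda>x. f x * g x)"
  using assms(2,3)
proof (induction k arbitrary: f g)
  case 0
  then show ?case by (auto intro: continuous_map_real_mult)
next
  case (Suc k)
  have fg: "Ck_on d k U f" "Ck_on d k U g" using Suc.prems by (auto dest: Ck_on_SucD simp del: Ck_on.simps)
  show ?case
  proof (rule Ck_on_SucI[OF U, where D = "\<lambda>j x. partial_deriv j f x * g x + partial_deriv j g x * f x"])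
    show "continuous_map (subtopology (Euclidean_space d) U) euclideanreal (\<lambda>x. f x * g x)"
      using Suc.prems by (auto intro: continuous_map_real_mult)
    show "((\<lambda>t. f (x(j := t)) * g (x(j := t))) has_real_derivative
        partial_deriv j f x * g x + partial_deriv j g x * f x) (at (x j))" if "j < d" "x \<in> U" for j x
      using DERIV_mult[OF Ck_on_Suc_has_derivative[OF Suc.prems(1) that] Ck_on_Suc_has_derivative[OF Suc.prems(2) that]]
      by (simp only: fun_upd_triv)
    show "Ck_on d k U (\<lambda>x. partial_deriv j f x * g x + partial_deriv j g x * f x)" if "j < d" for j
      using that Suc.prems by (intro Ck_on_add[OF U] Suc.IH fg) auto
  qed
qed

lemma Ck_on_sum:
  assumes U: "openin (Euclidean_space d) U" and "\<And>i. i \<in> I \<Longrightarrow> Ck_on d k U (f i)"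
  shows "Ck_on d k U (\<lambda>x. \<Sum>i\<in>I. f i x)"
  using assms(2)
  by (induction I rule: infinite_finite_induct) (simp_all add: Ck_on_const Ck_on_add[OF U])

lemma continuous_map_into_Euclidean_space:
  "continuous_map X (Euclidean_space n) f \<longleftrightarrow>
     (\<forall>i<n. continuous_map X euclideanreal (\<lambda>x. f x i)) \<and> f \<in> topspace X \<rightarrow> topspace (Euclidean_space n)"
proof
  assume L: "continuous_map X (Euclidean_space n) f"
  then have "continuous_map X (powertop_real UNIV) f"
    by (simp add: Euclidean_space_def continuous_map_in_subtopology)
  then have "\<forall>i. continuous_map X euclideanreal (\<lambda>x. f x i)"
    by (simp add: continuous_map_componentwise_UNIV)
  with L show "(\<forall>i<n. continuous_map X euclideanreal (\<lambda>x. f x i)) \<and> f \<in> topspace X \<rightarrow> topspace (Euclidean_space n)"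
    by (auto simp: continuous_map_def)
next
  assume R: "(\<forall>i<n. continuous_map X euclideanreal (\<lambda>x. f x i)) \<and> f \<in> topspace X \<rightarrow> topspace (Euclidean_space n)"
  then have "continuous_map X (Euclidean_space n) (\<lambda>x i. if i < n then f x i else 0)"
    by (simp add: continuous_map_componentwise_Euclidean_space)
  then show "continuous_map X (Euclidean_space n) f"
    by (rule continuous_map_eq) (use R in \<open>auto simp: topspace_Euclidean_space fun_eq_iff Pi_iff\<close>)
qed

lemma continuous_map_Euclidean_space_coordinate: "continuous_map (Euclidean_space n) euclideanreal (\<lambda>x. x i)"
  unfolding Euclidean_space_def by (rule continuous_map_coordinates_UNIV)

lemma smooth_on_imp_continuous:
  assumes "smooth_on m n U g"
  shows "continuous_map (subtopology (Euclidean_space m) U) (Euclidean_space n) g"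
  using assms Ck_on_imp_continuous unfolding smooth_on_def continuous_map_into_Euclidean_space by fastforce

lemma smooth_on_Ck: "smooth_on m n U g \<Longrightarrow> i < n \<Longrightarrow> Ck_on m k U (\<lambda>x. g x i)"
  by (simp add: smooth_on_def)

lemma partial_deriv_compose:
  assumes f: "openin (Euclidean_space n) W" "Ck_on n 1 W f"
    and g: "smooth_on m n U g" and "x \<in> U" "g x \<in> W" "j < m"
  shows "((\<lambda>t. f (g (x(j := t)))) has_real_derivative
     (\<Sum>i<n. partial_deriv i f (g x) * partial_deriv j (\<lambda>y. g y i) x)) (at (x j))"
proof -
  have U: "openin (Euclidean_space m) U" and gU: "\<And>y. y \<in> U \<Longrightarrow> g y \<in> topspace (Euclidean_space n)"
    using g by (auto simp: smooth_on_def)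
  have "((\<lambda>t. f (g (x(j := t)))) has_real_derivative
     (\<Sum>i<n. partial_deriv i f (g (x(j := x j))) * partial_deriv j (\<lambda>y. g y i) x)) (at (x j))"
  proof (rule chain_rule_partial_deriv[OF f(1), where \<gamma> = "\<lambda>t. g (x(j := t))"])
    show "\<forall>\<^sub>F t in nhds (x j). g (x(j := t)) \<in> topspace (Euclidean_space n)"
      using openin_Euclidean_space_upd[OF U \<open>x \<in> U\<close> \<open>j < m\<close>] by (rule eventually_mono) (rule gU)
    show "((\<lambda>t. g (x(j := t)) i) has_real_derivative partial_deriv j (\<lambda>y. g y i) x) (at (x j))" if "i < n" for i
      by (rule Ck_on_Suc_has_derivative[OF smooth_on_Ck[OF g that] \<open>j < m\<close> \<open>x \<in> U\<close>])
    show "(\<lambda>t. f (z(i := t))) field_differentiable at (z i)" if "i < n" "z \<in> W" for i z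
      using Ck_on_Suc_differentiable[of n 0 W f] f(2) that by simp
    show "continuous_map (subtopology (Euclidean_space n) W) euclideanreal (partial_deriv i f)" if "i < n" for i
      using f(2) that by simp
  qed (use \<open>g x \<in> W\<close> in simp)
  then show ?thesis by simp
qed

lemma Ck_on_compose:
  assumes W: "openin (Euclidean_space n) W" and g: "smooth_on m n U g" "g ` U \<subseteq> W"
    and f: "Ck_on n k W f"
  shows "Ck_on m k U (\<lambda>x. f (g x))"
  using f
proof (induction k arbitrary: f)
  case 0
  have "continuous_map (subtopology (Euclidean_space m) U) (subtopology (Euclidean_space n) W) g"
    using smooth_on_imp_continuous[OF g(1)] g(2) by (auto simp: continuous_map_in_subtopology)
  from continuous_map_compose[OF this] 0 show ?case by (auto simp: o_def)
next
  case (Suc k)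
  have U: "openin (Euclidean_space m) U" using g(1) by (simp add: smooth_on_def)
  have f1: "Ck_on n 1 W f" using Suc.prems by (auto dest: Ck_on_imp_continuous)
  have cont: "continuous_map (subtopology (Euclidean_space m) U) euclideanreal (\<lambda>x. f (g x))"
    using Ck_on_imp_continuous[OF Suc.IH[OF Ck_on_SucD[OF Suc.prems]]] .
  show ?case
  proof (rule Ck_on_SucI[OF U cont])
    show "((\<lambda>t. f (g (x(j := t)))) has_real_derivative
        (\<Sum>i<n. partial_deriv i f (g x) * partial_deriv j (\<lambda>y. g y i) x)) (at (x j))" if "j < m" "x \<in> U" for j x
      using that g(2) by (intro partial_deriv_compose[OF W f1 g(1)]) auto
    show "Ck_on m k U (\<lambda>x. \<Sum>i<n. partial_deriv i f (g x) * partial_deriv j (\<lambda>y. g y i) x)" if "j < m" for j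
      using Suc that smooth_on_Ck[OF g(1), of _ "Suc k"] by (intro Ck_on_sum[OF U] Ck_on_mult[OF U]) auto
  qed
qed

section \<open>Jacobians\<close>

lemma jacobian_apply_in: "jacobian_apply d f x v \<in> topspace (Euclidean_space d)"
  by (simp add: jacobian_apply_def topspace_Euclidean_space)

lemma jacobian_apply_add: "jacobian_apply d f x (\<lambda>i. v i + w i) = (\<lambda>i. jacobian_apply d f x v i + jacobian_apply d f x w i)"
  by (auto simp: jacobian_apply_def fun_eq_iff distrib_left sum.distrib)

lemma jacobian_apply_scale: "jacobian_apply d f x (\<lambda>i. t * v i) = (\<lambda>i. t * jacobian_apply d f x v i)"
  by (auto simp: jacobian_apply_def fun_eq_iff sum_distrib_left mult_ac)

lemma jacobian_apply_cong:
  assumes "openin (Euclidean_space d) U" "x \<in> U" "\<And>y. y \<in> U \<Longrightarrow> f y = g y"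
  shows "jacobian_apply d f x v = jacobian_apply d g x v"
proof -
  have "partial_deriv j (\<lambda>y. f y i) x = partial_deriv j (\<lambda>y. g y i) x" if "j < d" for i j
    using assms(3) by (intro partial_deriv_cong(1)[OF assms(1,2) that]) simp
  then show ?thesis by (auto simp: jacobian_apply_def fun_eq_iff)
qed

lemma jacobian_apply_id:
  assumes "v \<in> topspace (Euclidean_space d)"
  shows "jacobian_apply d (\<lambda>y. y) x v = v"
proof -
  have "partial_deriv j (\<lambda>y. y i) x = (if i = j then 1 else 0)" for i j
    by (auto simp: partial_deriv_def)
  then show ?thesis
    using assms by (auto simp: jacobian_apply_def fun_eq_iff topspace_Euclidean_space
        if_distrib[of "\<lambda>u. u * _"] cong: if_cong)
qed

lemma jacobian_apply_compose:
  assumes f: "smooth_on d d W f" and g: "smooth_on d d U g" and "x \<in> U" "g x \<in> W"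
  shows "jacobian_apply d (\<lambda>y. f (g y)) x v = jacobian_apply d f (g x) (jacobian_apply d g x v)"
proof -
  have W: "openin (Euclidean_space d) W" using f by (simp add: smooth_on_def)
  have chain: "partial_deriv j (\<lambda>y. f (g y) i) x = (\<Sum>k<d. partial_deriv k (\<lambda>z. f z i) (g x) * partial_deriv j (\<lambda>y. g y k) x)"
    if "i < d" "j < d" for i j
    using partial_derivI[OF partial_deriv_compose[OF W smooth_on_Ck[OF f that(1)] g assms(3,4) that(2)]] by simp
  have "jacobian_apply d (\<lambda>y. f (g y)) x v i = jacobian_apply d f (g x) (jacobian_apply d g x v) i" if "i < d" for i
  proof -
    let ?a = "\<lambda>k. partial_deriv k (\<lambda>z. f z i) (g x)" and ?b = "\<lambda>k j. partial_deriv j (\<lambda>y. g y k) x"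
    have "(\<Sum>j<d. (\<Sum>k<d. ?a k * ?b k j) * v j) = (\<Sum>k<d. ?a k * (\<Sum>j<d. ?b k j * v j))"
      unfolding sum_distrib_right sum_distrib_left mult.assoc by (rule sum.swap)
    with that show ?thesis by (simp add: jacobian_apply_def chain)
  qed
  then show ?thesis by (auto simp: jacobian_apply_def fun_eq_iff)
qed

lemma Ck_on_jacobian_apply:
  assumes "smooth_on d d U f" "i < d"
  shows "Ck_on d k U (\<lambda>x. jacobian_apply d f x v i)"
proof -
  have U: "openin (Euclidean_space d) U" using assms by (simp add: smooth_on_def)
  have "Ck_on d k U (partial_deriv j (\<lambda>y. f y i))" if "j < d" for j
    using smooth_on_Ck[OF assms, of "Suc k"] that by simp
  then show ?thesis
    using assms(2) by (simp add: jacobian_apply_def) (intro Ck_on_sum[OF U] Ck_on_mult[OF U] Ck_on_const, auto)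
qed

lemma continuous_map_jacobian_apply:
  assumes f: "smooth_on d d U f"
  shows "continuous_map (prod_topology (subtopology (Euclidean_space d) U) (Euclidean_space d)) (Euclidean_space d)
    (\<lambda>(x, v). jacobian_apply d f x v)"
proof -
  let ?X = "prod_topology (subtopology (Euclidean_space d) U) (Euclidean_space d)"
  have "continuous_map ?X euclideanreal (\<lambda>y. \<Sum>j<d. partial_deriv j (\<lambda>z. f z i) (fst y) * snd y j)" if "i < d" for i
  proof (intro continuous_map_sum continuous_map_real_mult)
    fix j assume "j \<in> {..<d}"
    then have "continuous_map (subtopology (Euclidean_space d) U) euclideanreal (partial_deriv j (\<lambda>z. f z i))"
      using smooth_on_Ck[OF f that, of 1] by simp
    from continuous_map_compose[OF continuous_map_fst this]
    show "continuous_map ?X euclideanreal (\<lambda>y. partial_deriv j (\<lambda>z. f z i) (fst y))" by (simp add: o_def)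
    from continuous_map_compose[OF continuous_map_snd continuous_map_Euclidean_space_coordinate]
    show "continuous_map ?X euclideanreal (\<lambda>y. snd y j)" by (simp add: o_def)
  qed simp
  then have "continuous_map ?X euclideanreal (\<lambda>y. jacobian_apply d f (fst y) (snd y) i)" if "i < d" for i
    using that by (simp add: jacobian_apply_def)
  then show ?thesis
    unfolding continuous_map_into_Euclidean_space by (auto simp: case_prod_beta' jacobian_apply_in)
qed

section \<open>Manifolds with an autoencoder\<close>

locale encoded_manifold =
  fixes d :: nat and M :: "'a topology" and A :: "'a chart set" and E :: "'a \<Rightarrow> nat \<Rightarrow> real"
  assumes manifold: "smooth_manifold d M A"
    and encoder: "diffeo_onto_image d M A d E"
begin

abbreviation Ed where "Ed \<equiv> Euclidean_space d"

text \<open>The encoder and its inverse in the coordinates of a chart.\<close>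

definition local_encoder :: "'a chart \<Rightarrow> (nat \<Rightarrow> real) \<Rightarrow> nat \<Rightarrow> real" where
  "local_encoder c x = E (chart_inv c x)"

definition local_decoder :: "'a chart \<Rightarrow> (nat \<Rightarrow> real) \<Rightarrow> nat \<Rightarrow> real" where
  "local_decoder c z = snd c (inv_into (topspace M) E z)"

lemma charts:
  assumes "c \<in> A"
  shows "openin M (fst c)" "openin Ed (snd c ` fst c)"
    and "homeomorphic_map (subtopology M (fst c)) (subtopology Ed (snd c ` fst c)) (snd c)"
  using assms manifold by (auto simp: smooth_manifold_def chart_on_def)

lemma charts_cover: "(\<Union>c\<in>A. fst c) = topspace M"
  using manifold by (simp add: smooth_manifold_def)

lemma chart_subset: "c \<in> A \<Longrightarrow> fst c \<subseteq> topspace M"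
  using charts_cover by blast

lemma chart_image_subset: "c \<in> A \<Longrightarrow> snd c ` fst c \<subseteq> topspace Ed"
  using charts(2) openin_subset by blast

lemma chart_inj: "c \<in> A \<Longrightarrow> inj_on (snd c) (fst c)"
  using homeomorphic_imp_injective_map[OF charts(3), of c] chart_subset[of c] by (simp add: Int_absorb1)

lemma chart_inv_chart: "c \<in> A \<Longrightarrow> p \<in> fst c \<Longrightarrow> chart_inv c (snd c p) = p"
  by (simp add: chart_inv_def chart_inj)

lemma chart_chart_inv: "x \<in> snd c ` fst c \<Longrightarrow> snd c (chart_inv c x) = x"
  by (simp add: chart_inv_def f_inv_into_f)

lemma chart_inv_in: "x \<in> snd c ` fst c \<Longrightarrow> chart_inv c x \<in> fst c"
  unfolding chart_inv_def by (rule inv_into_into)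

lemma continuous_chart: "c \<in> A \<Longrightarrow> continuous_map (subtopology M (fst c)) Ed (snd c)"
  using homeomorphic_imp_continuous_map[OF charts(3)] by (simp add: continuous_map_in_subtopology)

lemma continuous_chart_inv: 
  assumes c: "c \<in> A"
  shows "continuous_map (subtopology Ed (snd c ` fst c)) M (chart_inv c)"
proof -
  obtain g where g: "homeomorphic_maps (subtopology M (fst c)) (subtopology Ed (snd c ` fst c)) (snd c) g"
    using charts(3)[OF c] by (auto simp: homeomorphic_map_maps)
  then have "continuous_map (subtopology Ed (snd c ` fst c)) (subtopology M (fst c)) g"
    by (simp add: homeomorphic_maps_def)
  then have "continuous_map (subtopology Ed (snd c ` fst c)) M g"
    by (simp add: continuous_map_in_subtopology)
  moreover have "g x = chart_inv c x" if "x \<in> topspace (subtopology Ed (snd c ` fst c))" for x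
  proof -
    from that obtain p where p: "p \<in> fst c" "x = snd c p" by auto
    with g chart_subset[OF c] have "g x = p" by (auto simp: homeomorphic_maps_def)
    with p show ?thesis by (simp add: chart_inv_chart[OF c])
  qed
  ultimately show ?thesis by (rule continuous_map_eq)
qed

lemma encoder_inj: "inj_on E (topspace M)"
  using encoder by (simp add: diffeo_onto_image_def)

lemma inv_encoder: "p \<in> topspace M \<Longrightarrow> inv_into (topspace M) E (E p) = p"
  by (simp add: encoder_inj)

lemma smooth_local_encoder: "c \<in> A \<Longrightarrow> smooth_on d d (snd c ` fst c) (local_encoder c)"
  using encoder by (simp add: diffeo_onto_image_def smooth_to_Euclidean_def local_encoder_def[abs_def])

lemma local_encoder_chart: "c \<in> A \<Longrightarrow> p \<in> fst c \<Longrightarrow> local_encoder c (snd c p) = E p"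
  by (simp add: local_encoder_def chart_inv_chart)

lemma local_encoder_image: "c \<in> A \<Longrightarrow> local_encoder c ` (snd c ` fst c) = E ` fst c"
  by (simp add: image_image local_encoder_chart)

lemma local_decoder_encoder: "c \<in> A \<Longrightarrow> p \<in> fst c \<Longrightarrow> local_decoder c (E p) = snd c p"
  using chart_subset[of c] by (simp add: local_decoder_def inv_encoder subset_iff)

lemma local_decoder_local_encoder:
  "c \<in> A \<Longrightarrow> x \<in> snd c ` fst c \<Longrightarrow> local_decoder c (local_encoder c x) = x"
  by (auto simp: local_encoder_chart local_decoder_encoder)

lemma local_encoder_local_decoder:
  "c \<in> A \<Longrightarrow> z \<in> E ` fst c \<Longrightarrow> local_encoder c (local_decoder c z) = z"
  by (auto simp: local_encoder_chart local_decoder_encoder)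

lemma openin_encoder_image:
  assumes c: "c \<in> A"
  shows "openin Ed (E ` fst c)"
proof -
  have "inj_on (local_encoder c) (snd c ` fst c)"
    by (rule inj_on_inverseI[of _ "local_decoder c"]) (rule local_decoder_local_encoder[OF c])
  from invariance_of_domain_Euclidean_space[OF charts(2)[OF c] smooth_on_imp_continuous[OF smooth_local_encoder[OF c]] this]
  show ?thesis by (simp add: local_encoder_image c)
qed

text \<open>By invariance of domain, the smooth local extensions of the inverse of \<open>E\<close> agree with it on open sets.\<close>

lemma smooth_local_decoder:
  assumes c: "c \<in> A"
  shows "smooth_on d d (E ` fst c) (local_decoder c)"
proof -
  note opn = openin_encoder_image[OF c]
  have "Ck_on d k (E ` fst c) (\<lambda>z. local_decoder c z i)" if i: "i < d" for k i
  proof (rule Ck_on_local)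
    fix z assume z: "z \<in> E ` fst c"
    then obtain p where p: "p \<in> fst c" "z = E p" by blast
    have pM: "p \<in> topspace M" using p chart_subset[OF c] by blast
    obtain W G where W: "z \<in> W" "smooth_on d d W G"
      and G: "\<And>y. y \<in> W \<inter> E ` topspace M \<Longrightarrow> snd c (inv_into (topspace M) E y) = G y"
    proof -
      have "\<forall>y\<in>E ` topspace M. \<forall>c\<in>A. inv_into (topspace M) E y \<in> fst c \<longrightarrow>
        (\<exists>W G. y \<in> W \<and> smooth_on d d W G \<and>
           (\<forall>z\<in>W \<inter> E ` topspace M. inv_into (topspace M) E z \<in> fst c \<and> snd c (inv_into (topspace M) E z) = G z))"
        using encoder unfolding diffeo_onto_image_def smooth_from_Euclidean_def by (elim conjE) assumption
      moreover have "z \<in> E ` topspace M" "inv_into (topspace M) E z \<in> fst c"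
        using p pM inv_encoder[OF pM] by simp_all
      ultimately have "\<exists>W G. z \<in> W \<and> smooth_on d d W G \<and>
           (\<forall>z\<in>W \<inter> E ` topspace M. inv_into (topspace M) E z \<in> fst c \<and> snd c (inv_into (topspace M) E z) = G z)"
        using c by (metis (no_types, lifting))
      then show ?thesis using that by blast
    qed
    let ?V = "W \<inter> E ` fst c"
    have "openin Ed W" using W(2) by (simp add: smooth_on_def)
    then have V: "openin Ed ?V" using opn by (rule openin_Int)
    have "Ck_on d k ?V (\<lambda>y. G y i)"
      using smooth_on_Ck[OF W(2) i] by (rule Ck_on_subset) simp
    then have "Ck_on d k ?V (\<lambda>z. local_decoder c z i)"
      by (rule Ck_on_cong[OF V, rotated]) (use G chart_subset[OF c] in \<open>auto simp: local_decoder_def\<close>)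
    with V W(1) z show "\<exists>V. openin Ed V \<and> z \<in> V \<and> V \<subseteq> E ` fst c \<and> Ck_on d k V (\<lambda>z. local_decoder c z i)"
      by blast
  qed
  moreover have "local_decoder c \<in> E ` fst c \<rightarrow> topspace Ed"
    using chart_image_subset[OF c] by (auto simp: local_decoder_encoder[OF c])
  ultimately show ?thesis using opn by (simp add: smooth_on_def)
qed

definition enc_deriv :: "'a chart \<Rightarrow> 'a \<Rightarrow> (nat \<Rightarrow> real) \<Rightarrow> nat \<Rightarrow> real" where
  "enc_deriv c p = jacobian_apply d (local_encoder c) (snd c p)"

definition dec_deriv :: "'a chart \<Rightarrow> 'a \<Rightarrow> (nat \<Rightarrow> real) \<Rightarrow> nat \<Rightarrow> real" where
  "dec_deriv c p = jacobian_apply d (local_decoder c) (E p)"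

text \<open>The two derivatives are inverse to each other, since both compositions are the identity on open sets; on the side
  of \<open>\<real>\<^sup>d\<close> this needs that the image of \<open>E\<close> is open.\<close>

lemma dec_deriv_enc_deriv:
  assumes c: "c \<in> A" "p \<in> fst c" and v: "v \<in> topspace Ed"
  shows "dec_deriv c p (enc_deriv c p v) = v"
proof -
  have "jacobian_apply d (\<lambda>y. local_decoder c (local_encoder c y)) (snd c p) v =
      dec_deriv c p (enc_deriv c p v)"
    using jacobian_apply_compose[OF smooth_local_decoder[OF c(1)] smooth_local_encoder[OF c(1)], of "snd c p" v] c
    by (simp add: local_encoder_chart enc_deriv_def dec_deriv_def)
  moreover have "jacobian_apply d (\<lambda>y. local_decoder c (local_encoder c y)) (snd c p) v = jacobian_apply d (\<lambda>y. y) (snd c p) v"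
    by (rule jacobian_apply_cong[OF charts(2)[OF c(1)]]) (use c local_decoder_local_encoder in auto)
  ultimately show ?thesis using v by (simp add: jacobian_apply_id)
qed

lemma enc_deriv_dec_deriv:
  assumes c: "c \<in> A" "p \<in> fst c" and u: "u \<in> topspace Ed"
  shows "enc_deriv c p (dec_deriv c p u) = u"
proof -
  have "jacobian_apply d (\<lambda>z. local_encoder c (local_decoder c z)) (E p) u =
      enc_deriv c p (dec_deriv c p u)"
    using jacobian_apply_compose[OF smooth_local_encoder[OF c(1)] smooth_local_decoder[OF c(1)], of "E p" u] c
    by (simp add: local_decoder_encoder enc_deriv_def dec_deriv_def)
  moreover have "jacobian_apply d (\<lambda>z. local_encoder c (local_decoder c z)) (E p) u = jacobian_apply d (\<lambda>y. y) (E p) u"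
    by (rule jacobian_apply_cong[OF openin_encoder_image[OF c(1)]]) (use c local_encoder_local_decoder in auto)
  ultimately show ?thesis using u by (simp add: jacobian_apply_id)
qed

abbreviation transition_deriv :: "'a chart \<Rightarrow> 'a chart \<Rightarrow> 'a \<Rightarrow> (nat \<Rightarrow> real) \<Rightarrow> nat \<Rightarrow> real" where
  "transition_deriv c c' p \<equiv> jacobian_apply d (\<lambda>x. snd c' (chart_inv c x)) (snd c p)"

lemma enc_deriv_change_of_charts:
  assumes c: "c \<in> A" "p \<in> fst c" and c': "c' \<in> A" "p \<in> fst c'"
  shows "enc_deriv c' p (transition_deriv c c' p v) = enc_deriv c p v"
proof -
  let ?U = "snd c ` (fst c \<inter> fst c')"
  have \<tau>: "smooth_on d d ?U (\<lambda>x. snd c' (chart_inv c x))"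
    using manifold c c' by (auto simp: smooth_manifold_def)
  then have U: "openin Ed ?U" by (simp add: smooth_on_def)
  have "enc_deriv c p v = jacobian_apply d (\<lambda>x. local_encoder c' (snd c' (chart_inv c x))) (snd c p) v"
    unfolding enc_deriv_def
    by (rule jacobian_apply_cong[OF U]) (use c c' in \<open>auto simp: local_encoder_chart chart_inv_chart\<close>)
  also have "\<dots> = enc_deriv c' p (transition_deriv c c' p v)"
    using jacobian_apply_compose[OF smooth_local_encoder[OF c'(1)] \<tau>, of "snd c p" v] c c'
    by (simp add: enc_deriv_def chart_inv_chart)
  finally show ?thesis ..
qed

lemma enc_deriv_in: "enc_deriv c p v \<in> topspace Ed" and dec_deriv_in: "dec_deriv c p v \<in> topspace Ed"
  by (simp_all add: enc_deriv_def dec_deriv_def jacobian_apply_in)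

section \<open>The trivialisation of the tangent bundle\<close>

definition chart_at :: "'a \<Rightarrow> 'a chart" where
  "chart_at p = (SOME c. c \<in> A \<and> p \<in> fst c)"

text \<open>The map \<open>(p, v) \<mapsto> (p, dE\<^sub>p v)\<close>. It is computed in one chart around \<open>p\<close>; any other one gives the same value, because
  the coordinates of \<open>v\<close> change by the derivative of the change of charts (\<open>triv_eq\<close>).\<close>

definition triv :: "'a \<times> ('a chart \<Rightarrow> nat \<Rightarrow> real) \<Rightarrow> 'a \<times> (nat \<Rightarrow> real)" where
  "triv e = (fst e, enc_deriv (chart_at (fst e)) (fst e) (snd e (chart_at (fst e))))"

definition triv_inv :: "'a \<times> (nat \<Rightarrow> real) \<Rightarrow> 'a \<times> ('a chart \<Rightarrow> nat \<Rightarrow> real)" where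
  "triv_inv y = (fst y, \<lambda>c. if c \<in> A \<and> fst y \<in> fst c then dec_deriv c (fst y) (snd y) else (\<lambda>_. 0))"

lemma chart_at: "p \<in> topspace M \<Longrightarrow> chart_at p \<in> A \<and> p \<in> fst (chart_at p)"
  using charts_cover unfolding chart_at_def by (intro someI_ex[of "\<lambda>c. c \<in> A \<and> p \<in> fst c"]) blast

lemma tangent_vector_cases:
  assumes "v \<in> tangent_space d A p"
  shows "if c \<in> A \<and> p \<in> fst c then v c \<in> topspace Ed else v c = (\<lambda>_. 0)"
  using assms unfolding tangent_space_def mem_Collect_eq by (elim conjE allE)

lemma tangent_vector_in:
  "v \<in> tangent_space d A p \<Longrightarrow> c \<in> A \<Longrightarrow> p \<in> fst c \<Longrightarrow> v c \<in> topspace Ed"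
  using tangent_vector_cases[of v p c] by simp

lemma tangent_vector_zero:
  "v \<in> tangent_space d A p \<Longrightarrow> \<not> (c \<in> A \<and> p \<in> fst c) \<Longrightarrow> v c = (\<lambda>_. 0)"
  using tangent_vector_cases[of v p c] by (simp only: if_False)

lemma triv_eq:
  assumes v: "v \<in> tangent_space d A p" and c: "c \<in> A" "p \<in> fst c"
  shows "triv (p, v) = (p, enc_deriv c p (v c))"
proof -
  have c': "chart_at p \<in> A" "p \<in> fst (chart_at p)" using chart_at chart_subset c by blast+
  then have "v (chart_at p) = transition_deriv c (chart_at p) p (v c)"
    using v c unfolding tangent_space_def by blast
  then show ?thesis
    by (simp add: triv_def enc_deriv_change_of_charts[OF c c'])
qed

lemma triv_inv_tangent:
  assumes u: "u \<in> topspace Ed"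
  shows "snd (triv_inv (p, u)) \<in> tangent_space d A p"
proof -
  have coord: "snd (triv_inv (p, u)) c = dec_deriv c p u" if "c \<in> A" "p \<in> fst c" for c
    using that by (simp add: triv_inv_def)
  have compatible: "snd (triv_inv (p, u)) c' =
      transition_deriv c c' p (snd (triv_inv (p, u)) c)"
    if c: "c \<in> A" "p \<in> fst c" and c': "c' \<in> A" "p \<in> fst c'" for c c'
  proof -
    let ?w = "transition_deriv c c' p (dec_deriv c p u)"
    have "enc_deriv c' p ?w = u"
      by (simp add: enc_deriv_change_of_charts[OF c c'] enc_deriv_dec_deriv[OF c u])
    then show ?thesis
      using dec_deriv_enc_deriv[OF c', of ?w] by (simp add: coord c c' jacobian_apply_in)
  qed
  show ?thesis
    unfolding tangent_space_def mem_Collect_eq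
  proof (intro conjI allI ballI impI)
    show "if c \<in> A \<and> p \<in> fst c then snd (triv_inv (p, u)) c \<in> topspace Ed
        else snd (triv_inv (p, u)) c = (\<lambda>_. 0)" for c
      by (simp add: triv_inv_def dec_deriv_in)
  qed (rule compatible; blast)
qed

abbreviation TM where "TM \<equiv> tangent_topology d A"

lemma tangent_domain_generator:
  "c \<in> A \<Longrightarrow> tangent_domain d A c = {e \<in> tangent_domain d A c. tangent_chart c e \<in> topspace (prod_topology Ed Ed)}"
  using chart_image_subset[of c] by (auto simp: tangent_domain_def tangent_chart_def tangent_vector_in image_subset_iff)

lemma topspace_TM: "topspace TM = (SIGMA p:topspace M. tangent_space d A p)"
proof -
  have "topspace TM = (\<Union>c\<in>A. tangent_domain d A c)"
  proof
    show "topspace TM \<subseteq> (\<Union>c\<in>A. tangent_domain d A c)"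
      unfolding tangent_topology_def by auto
    show "(\<Union>c\<in>A. tangent_domain d A c) \<subseteq> topspace TM"
      unfolding tangent_topology_def topology_generated_by_topspace
      using tangent_domain_generator openin_topspace[of "prod_topology Ed Ed"] by blast
  qed
  also have "\<dots> = (SIGMA p:topspace M. tangent_space d A p)"
    using charts_cover by (auto simp: tangent_domain_def)
  finally show ?thesis .
qed

lemma openin_TM_chart:
  "c \<in> A \<Longrightarrow> openin (prod_topology Ed Ed) W \<Longrightarrow> openin TM {e \<in> tangent_domain d A c. tangent_chart c e \<in> W}"
  unfolding tangent_topology_def by (rule topology_generated_by_Basis) blast

lemma openin_tangent_domain: "c \<in> A \<Longrightarrow> openin TM (tangent_domain d A c)"
  using openin_TM_chart[of c "topspace (prod_topology Ed Ed)"] tangent_domain_generator[of c] openin_topspace by metis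

lemma continuous_tangent_chart:
  assumes c: "c \<in> A"
  shows "continuous_map (subtopology TM (tangent_domain d A c)) (prod_topology (subtopology Ed (snd c ` fst c)) Ed) (tangent_chart c)"
proof -
  have sub: "tangent_domain d A c \<subseteq> topspace TM" using openin_tangent_domain[OF c] openin_subset by blast
  have "continuous_map (subtopology TM (tangent_domain d A c)) (prod_topology Ed Ed) (tangent_chart c)"
    unfolding continuous_map_def
  proof (intro conjI allI impI)
    show "tangent_chart c \<in> topspace (subtopology TM (tangent_domain d A c)) \<rightarrow> topspace (prod_topology Ed Ed)"
      using tangent_domain_generator[OF c] by auto
    fix W assume "openin (prod_topology Ed Ed) W"
    then have "openin (subtopology TM (tangent_domain d A c)) ({e \<in> tangent_domain d A c. tangent_chart c e \<in> W} \<inter> tangent_domain d A c)"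
      by (intro openin_subtopology_Int openin_TM_chart c)
    moreover have "{e \<in> tangent_domain d A c. tangent_chart c e \<in> W} \<inter> tangent_domain d A c =
        {e \<in> topspace (subtopology TM (tangent_domain d A c)). tangent_chart c e \<in> W}"
      using sub by auto
    ultimately show "openin (subtopology TM (tangent_domain d A c)) {e \<in> topspace (subtopology TM (tangent_domain d A c)). tangent_chart c e \<in> W}"
      by simp
  qed
  then show ?thesis
    by (auto simp: continuous_map_in_subtopology prod_topology_subtopology tangent_domain_def tangent_chart_def topspace_TM
        intro: tangent_vector_in[OF _ c])
qed

lemma continuous_triv: "continuous_map TM (prod_topology M Ed) triv"
proof (rule pasting_lemma[where I = A and T = "tangent_domain d A" and f = "\<lambda>_. triv"])
  fix c assume c: "c \<in> A"
  let ?D = "subtopology TM (tangent_domain d A c)" and ?X = "prod_topology (subtopology Ed (snd c ` fst c)) Ed"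
  have "continuous_map ?X (prod_topology M Ed) (\<lambda>y. (chart_inv c (fst y), jacobian_apply d (local_encoder c) (fst y) (snd y)))"
    using continuous_map_compose[OF continuous_map_fst continuous_chart_inv[OF c]]
      continuous_map_jacobian_apply[OF smooth_local_encoder[OF c]]
    by (intro continuous_map_pairedI) (simp_all add: o_def case_prod_beta')
  from continuous_map_compose[OF continuous_tangent_chart[OF c] this]
  show "continuous_map ?D (prod_topology M Ed) triv"
    by (rule continuous_map_eq)
       (auto simp: tangent_domain_def tangent_chart_def chart_inv_chart[OF c] triv_eq[OF _ c] enc_deriv_def)
next
  fix e assume "e \<in> topspace TM"
  then have "fst e \<in> topspace M" "snd e \<in> tangent_space d A (fst e)" by (auto simp: topspace_TM)
  moreover from this(1) obtain c where "c \<in> A" "fst e \<in> fst c" using charts_cover by blast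
  ultimately have "c \<in> A" "e \<in> tangent_domain d A c"
    by (cases e, simp add: tangent_domain_def)+
  then show "\<exists>c. c \<in> A \<and> e \<in> tangent_domain d A c \<and> triv e = triv e" by blast
qed (simp_all add: openin_tangent_domain)

lemma triv_inv_in:
  assumes "y \<in> topspace (prod_topology M Ed)"
  shows "triv_inv y \<in> topspace TM"
proof -
  have "fst y \<in> topspace M" "snd (triv_inv y) \<in> tangent_space d A (fst y)"
    using assms triv_inv_tangent[of "snd y" "fst y"] by auto
  moreover have "triv_inv y = (fst y, snd (triv_inv y))" by (simp add: triv_inv_def)
  ultimately show ?thesis unfolding topspace_TM by (metis SigmaI)
qed

lemma continuous_triv_inv: "continuous_map (prod_topology M Ed) TM triv_inv"
  unfolding tangent_topology_def
proof (rule continuous_on_generated_topo)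
  show "triv_inv ` topspace (prod_topology M Ed) \<subseteq> \<Union> {{e \<in> tangent_domain d A c. tangent_chart c e \<in> W} |c W.
          c \<in> A \<and> openin (prod_topology Ed Ed) W}"
    unfolding topology_generated_by_topspace[symmetric] tangent_topology_def[symmetric]
    using triv_inv_in by blast
next
  fix U assume "U \<in> {{e \<in> tangent_domain d A c. tangent_chart c e \<in> W} |c W. c \<in> A \<and> openin (prod_topology Ed Ed) W}"
  then obtain c W where c: "c \<in> A" and W: "openin (prod_topology Ed Ed) W"
    and U: "U = {e \<in> tangent_domain d A c. tangent_chart c e \<in> W}" by blast
  let ?X = "prod_topology (subtopology M (fst c)) Ed"
  have enc: "continuous_map (subtopology M (fst c)) (subtopology Ed (E ` fst c)) E"
  proof -
    have "continuous_map (subtopology M (fst c)) Ed (local_encoder c \<circ> snd c)"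
      using homeomorphic_imp_continuous_map[OF charts(3)[OF c]] smooth_on_imp_continuous[OF smooth_local_encoder[OF c]]
      by (rule continuous_map_compose)
    then have "continuous_map (subtopology M (fst c)) Ed E"
      by (rule continuous_map_eq) (simp add: local_encoder_chart c)
    then show ?thesis by (auto simp: continuous_map_in_subtopology)
  qed
  have "continuous_map ?X (prod_topology (subtopology Ed (E ` fst c)) Ed) (\<lambda>y. (E (fst y), snd y))"
    using continuous_map_compose[OF continuous_map_fst enc] by (intro continuous_map_pairedI continuous_map_snd) (simp add: o_def)
  from continuous_map_compose[OF this continuous_map_jacobian_apply[OF smooth_local_decoder[OF c]]]
  have "continuous_map ?X Ed (\<lambda>y. dec_deriv c (fst y) (snd y))"
    by (simp add: o_def dec_deriv_def)
  moreover have "continuous_map ?X Ed (\<lambda>y. snd c (fst y))"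
    using continuous_map_compose[OF continuous_map_fst continuous_chart[OF c]] by (simp add: o_def)
  ultimately have cont: "continuous_map ?X (prod_topology Ed Ed) (\<lambda>y. (snd c (fst y), dec_deriv c (fst y) (snd y)))"
    by (intro continuous_map_pairedI)
  define S where "S = {y \<in> topspace ?X. (snd c (fst y), dec_deriv c (fst y) (snd y)) \<in> W}"
  have "openin ?X S"
    unfolding S_def by (rule openin_continuous_map_preimage[OF cont W])
  then have "openin (subtopology (prod_topology M Ed) (fst c \<times> topspace Ed)) S"
    by (simp add: prod_topology_subtopology)
  then have "openin (prod_topology M Ed) S"
    by (rule openin_trans_full) (simp add: openin_prod_Times_iff charts(1)[OF c])
  moreover have "triv_inv -` U \<inter> topspace (prod_topology M Ed) = S"
  proof -
    have "(p, u) \<in> triv_inv -` U \<longleftrightarrow> (p, u) \<in> S" if p: "p \<in> topspace M" and u: "u \<in> topspace Ed" for p u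
    proof -
      have "triv_inv (p, u) \<in> tangent_domain d A c \<longleftrightarrow> p \<in> fst c"
        using triv_inv_tangent[OF u, of p] by (simp add: tangent_domain_def triv_inv_def)
      moreover have "tangent_chart c (triv_inv (p, u)) = (snd c p, dec_deriv c p u)" if "p \<in> fst c"
        using c that by (simp add: tangent_chart_def triv_inv_def)
      ultimately show ?thesis
        using p u by (auto simp: U S_def)
    qed
    moreover have "S \<subseteq> topspace (prod_topology M Ed)" by (auto simp: S_def)
    ultimately show ?thesis by fastforce
  qed
  ultimately show "openin (prod_topology M Ed) (triv_inv -` U \<inter> topspace (prod_topology M Ed))" by simp
qed

lemma triv_triv_inv: "y \<in> topspace (prod_topology M Ed) \<Longrightarrow> triv (triv_inv y) = y"
  using chart_at[of "fst y"] by (auto simp: triv_def triv_inv_def enc_deriv_dec_deriv)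

lemma triv_inv_triv:
  assumes "e \<in> topspace TM"
  shows "triv_inv (triv e) = e"
proof -
  obtain p v where e: "e = (p, v)" and p: "p \<in> topspace M" and v: "v \<in> tangent_space d A p"
    using assms by (auto simp: topspace_TM)
  obtain c0 where c0: "c0 \<in> A" "p \<in> fst c0" using p charts_cover by blast
  have "snd (triv_inv (triv e)) c = v c" for c
  proof (cases "c \<in> A \<and> p \<in> fst c")
    case True
    then show ?thesis
      using triv_eq[OF v, of c] by (simp add: e triv_inv_def dec_deriv_enc_deriv tangent_vector_in[OF v])
  next
    case False
    then show ?thesis
      using triv_eq[OF v c0] tangent_vector_zero[OF v] by (auto simp: e triv_inv_def)
  qed
  moreover have "fst (triv_inv (triv e)) = p" by (simp add: e triv_inv_def triv_def)
  ultimately show ?thesis by (simp add: e prod_eq_iff fun_eq_iff)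
qed

lemma homeomorphic_maps_triv: "homeomorphic_maps TM (prod_topology M Ed) triv triv_inv"
  by (simp add: homeomorphic_maps_def continuous_triv continuous_triv_inv triv_triv_inv triv_inv_triv)

lemma vbundle_iso_triv: "vbundle_iso (tangent_bundle d M A) (trivial_bundle d M) triv"
proof -
  have "homeomorphic_map TM (prod_topology M Ed) triv"
    using homeomorphic_maps_triv homeomorphic_map_maps by blast
  then show ?thesis
    unfolding vbundle_iso_def tangent_bundle_def trivial_bundle_def
    by (simp add: triv_def enc_deriv_def jacobian_apply_add jacobian_apply_scale)
qed

lemma tangent_space_scale:
  assumes "v \<in> tangent_space d A p"
  shows "(\<lambda>c i. t * v c i) \<in> tangent_space d A p"
  unfolding tangent_space_def mem_Collect_eq
proof (intro conjI allI ballI impI)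
  show "if c \<in> A \<and> p \<in> fst c then (\<lambda>i. t * v c i) \<in> topspace Ed else (\<lambda>i. t * v c i) = (\<lambda>_. 0)" for c
    using tangent_vector_cases[OF assms, of c] by (auto simp: topspace_Euclidean_space fun_eq_iff)
  fix c c' assume "c \<in> A" "c' \<in> A" "p \<in> fst c \<inter> fst c'"
  then have eq: "v c' = transition_deriv c c' p (v c)"
    using assms unfolding tangent_space_def by blast
  show "(\<lambda>i. t * v c' i) = transition_deriv c c' p (\<lambda>i. t * v c i)"
    unfolding jacobian_apply_scale by (subst eq) (rule refl)
qed

lemma smooth_trivialisation_triv: "smooth_trivialisation d M A triv"
  unfolding smooth_trivialisation_def
proof (intro conjI ballI vbundle_iso_triv)
  fix c u assume c: "c \<in> A" and u: "u \<in> topspace Ed"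
  let ?O = "snd c ` fst c"
  note opn = charts(2)[OF c]
  have 1: "snd (triv (tangent_chart_inv d A c (x, u))) = jacobian_apply d (local_encoder c) x u" if x: "x \<in> ?O" for x
  proof -
    let ?p = "chart_inv c x"
    have p: "?p \<in> fst c" "snd c ?p = x" using chart_inv_in[OF x] chart_chart_inv[OF x] by auto
    have "triv_inv (?p, enc_deriv c ?p u) \<in> tangent_domain d A c"
      using triv_inv_tangent[OF enc_deriv_in] p by (auto simp: tangent_domain_def triv_inv_def)
    moreover have "tangent_chart c (triv_inv (?p, enc_deriv c ?p u)) = (x, u)"
      using p c by (simp add: tangent_chart_def triv_inv_def dec_deriv_enc_deriv[OF c p(1) u])
    ultimately have im: "(x, u) \<in> tangent_chart c ` tangent_domain d A c" by force
    obtain q v where qv: "tangent_chart_inv d A c (x, u) = (q, v)" by fastforce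
    have "(q, v) \<in> tangent_domain d A c" "tangent_chart c (q, v) = (x, u)"
      using inv_into_into[OF im] f_inv_into_f[OF im] qv by (simp_all add: tangent_chart_inv_def)
    then show ?thesis
      using triv_eq[of v q c] c by (simp add: qv tangent_domain_def tangent_chart_def enc_deriv_def)
  qed
  have 2: "snd (inv_into (topspace TM) triv (chart_inv c x, u)) c = jacobian_apply d (local_decoder c) (local_encoder c x) u"
    if x: "x \<in> ?O" for x
  proof -
    let ?p = "chart_inv c x"
    have p: "?p \<in> fst c" using chart_inv_in[OF x] .
    then have y: "(?p, u) \<in> topspace (prod_topology M Ed)" using u chart_subset[OF c] by auto
    have "inv_into (topspace TM) triv (?p, u) = triv_inv (?p, u)"
      by (rule inv_into_f_eq[OF inj_on_inverseI[of _ triv_inv]])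
         (use triv_inv_triv triv_triv_inv[OF y] triv_inv_in[OF y] in simp_all)
    then show ?thesis using c p by (simp add: triv_inv_def dec_deriv_def local_encoder_def)
  qed
  show "smooth_on d d ?O (\<lambda>x. snd (triv (tangent_chart_inv d A c (x, u))))"
    unfolding smooth_on_def
  proof (intro conjI allI impI opn)
    show "Ck_on d k ?O (\<lambda>x. snd (triv (tangent_chart_inv d A c (x, u))) i)" if "i < d" for i k
      by (rule Ck_on_cong[OF opn _ Ck_on_jacobian_apply[OF smooth_local_encoder[OF c] that]]) (simp add: 1)
  qed (simp add: 1 jacobian_apply_in)
  show "smooth_on d d ?O (\<lambda>x. snd (inv_into (topspace TM) triv (chart_inv c x, u)) c)"
    unfolding smooth_on_def
  proof (intro conjI allI impI opn)
    show "Ck_on d k ?O (\<lambda>x. snd (inv_into (topspace TM) triv (chart_inv c x, u)) c i)" if "i < d" for i k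
      by (rule Ck_on_cong[OF opn _ Ck_on_compose[OF openin_encoder_image[OF c] smooth_local_encoder[OF c] _
            Ck_on_jacobian_apply[OF smooth_local_decoder[OF c] that]]])
         (simp_all add: 2 local_encoder_image c)
  qed (simp add: 2 jacobian_apply_in)
qed

end

theorem proposition5p2:
  fixes M :: "'a topology" and A :: "'a chart set" and d :: nat
  assumes "smooth_manifold d M A"
    and "\<exists>Z E D. single_chart_autoencoder d M A Z E D"
  shows "tangent_bundle_trivialisable d M A \<and>
    (\<forall>i\<ge>1. stiefel_whitney_class (tangent_bundle d M A) i = \<one>\<^bsub>cohomology_group i M\<^esub>)"
proof -
  obtain E where "diffeo_onto_image d M A d E"
    using assms(2) by (auto simp: single_chart_autoencoder_def)
  with assms(1) interpret encoded_manifold d M A E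
    by unfold_locales
  interpret trivialised_bundle "tangent_bundle d M A" M d triv
  proof
    show "fibre_scale (tangent_bundle d M A) t e \<in> topspace (total_space (tangent_bundle d M A))"
      if "e \<in> topspace (total_space (tangent_bundle d M A))" for e t
      using that by (auto simp: tangent_bundle_def topspace_TM tangent_space_scale)
  qed (rule vbundle_iso_triv)
  show ?thesis
    using smooth_trivialisation_triv stiefel_whitney_class_trivialised
    unfolding tangent_bundle_trivialisable_def by blast
qed

end
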